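(* Let $(M,L)$ be a pseudo-Finsler manifold, let $\gamma:[a,b]\rightarrow M$ be a smooth embedded $L$-admissible curve and $V$ an $L$-admissible smooth vector field defined on an open subset $\Omega\subset M$. Assume that $\gamma([a,b])\subset \Omega$ and that $V$ coincides with $\dot\gamma$ along $\gamma$. Let $U$ and $W$ be smooth vector fields along $\gamma$, and let $\tilde{U},\tilde W$ be extensions of $U,W$, respectively, to smooth vector fields on $\Omega$. Then $$R^\gamma(\dot\gamma,U)W=\left(R^V(V,\tilde U)\tilde W+P_V(V,\tilde W,[\tilde{U},V])\right)(\gamma).$$
   Context: Pseudo-Finsler manifold: $M$ is a smooth manifold, $\pi:TM\to M$ the tangent bundle, $A\subset TM\setminus 0$ an open conic subset ($v\in A,\lambda>0\Rightarrow \lambda v\in A$), and $L:A\to\mathbb{R}$ is smooth with $L(\lambda v)=\lambda^2L(v)$ for $\lambda>0$ and such that for every $v\in A$ the fundamental tensor $g_v(u,w)=\frac12\frac{\partial^2}{\partial t\,\partial s}L(v+tu+sw)|_{t=s=0}$ ($u,w\in T_{\pi(v)}M$) is nondegenerate. The Cartan tensor is $C_v(w_1,w_2,w_3)=\frac14\frac{\partial^3}{\partial s_1\partial s_2\partial s_3}L(v+s_1w_1+s_2w_2+s_3w_3)|_{s_1=s_2=s_3=0}$. Chern connection: a vector field $V$ on an open set $\Omega\subset M$ is $L$-admissible if $V(p)\in A$ for all $p\in\Omega$. For such $V$, $\nabla^V$ is the unique torsion-free affine connection on $\Omega$ with $X(g_V(Y,Z))=g_V(\nabla^V_XY,Z)+g_V(Y,\nabla^V_XZ)+2C_V(\nabla^V_XV,Y,Z)$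 for all smooth vector fields $X,Y,Z$ on $\Omega$. In a chart $(\Omega,(u^i))$ of $M$ with induced chart $(x^i,y^i)$ on $TM$ ($x^i=u^i\circ\pi$, $y^i(v)=v(u^i)$), the Christoffel symbols are the functions $\Gamma^i_{\,jk}:A\cap\pi^{-1}(\Omega)\to\mathbb{R}$, symmetric in $j,k$, with $\nabla^V_{\partial/\partial u^j}\frac{\partial}{\partial u^k}=\Gamma^i_{\,jk}(V)\frac{\partial}{\partial u^i}$ for every $L$-admissible $V$. Curvature tensor of the affine connection $\nabla^V$: $R^V(X,Y)Z=\nabla^V_X\nabla^V_YZ-\nabla^V_Y\nabla^V_XZ-\nabla^V_{[X,Y]}Z$. Chern tensor: for $v\in A$ and $X,Y,Z\in T_{\pi(v)}M$, $P_v(X,Y,Z)=X^jY^kZ^l\frac{\partial\Gamma^i_{\,jk}}{\partial y^l}(v)\frac{\partial}{\partial u^i}$; equivalently, for vector fields on $\Omega$ and $L$-admissible $V$, $P_V(X,Y,Z)=\frac{\partial}{\partial t}(\nabla^{V+tZ}_XY)|_{t=0}$. Covariant derivative along curves: for a smooth curve $\gamma$ in $M$, a smooth vector field $T$ along $\gamma$ with values in $A$, and a smooth vector field $X$ along $\gamma$, $D_\gamma^TX=\left(\frac{dX^i}{dt}+X^j\dot\gamma^k\Gamma^i_{\,jk}(T)\right)\frac{\partial}{\partial u^i}$ in coordinates. The curve $\gamma$ is $L$-admissible if $\dot\gamma(t)\in A$ for all $t$. Two parameter maps: $\Lambda:[a,b]\times(-\varepsilon,\varepsilon)\to M$, $(t,s)\mapsto\Lambda(t,s)$,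 is assumed to extend to a smooth map on $(\bar a,\bar b)\times(-\varepsilon,\varepsilon)$ for some $(\bar a,\bar b)\supset[a,b]$; $\Lambda_t,\Lambda_s$ denote its partial velocity fields; it is $L$-admissible if $\Lambda_t(t,s)\in A$ for all $(t,s)$. Write $\gamma_s(t)=\Lambda(t,s)=\beta_t(s)$. For a smooth vector field $W$ along $\Lambda$, $R^\Lambda(W):=D_{\gamma_s}^{\Lambda_t}D_{\beta_t}^{\Lambda_t}W-D_{\beta_t}^{\Lambda_t}D_{\gamma_s}^{\Lambda_t}W$. Definition of $R^\gamma$: for an $L$-admissible smooth curve $\gamma$ and smooth vector fields $U,W$ along $\gamma$, $R^\gamma(\dot\gamma,U)W:=R^\Lambda(\tilde W)$ (evaluated along $\gamma$, i.e. at $s=0$), where $\Lambda$ is any $L$-admissible two parameter map with $\Lambda(\cdot,0)=\gamma$ and $\Lambda_s(t,0)=U(t)$, and here $\tilde W$ is any smooth vector field along $\Lambda$ extending $W$; this does not depend on the choice of $\Lambda$ or of the extension of $W$ to $\Lambda$. *)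

theory Defs
  imports "HOL-Analysis.Analysis" "HOL-Library.Function_Algebras"
begin

section \<open>Pointwise scalar multiplication of functions\<close>

instantiation "fun" :: (type, scaleR) scaleR
begin

definition "c *\<^sub>R f = (\<lambda>x. c *\<^sub>R f x)"

instance ..

end

lemma scaleR_fun_apply [simp]: "(c *\<^sub>R f) x = c *\<^sub>R f x"
  by (simp add: scaleR_fun_def)

instance "fun" :: (type, real_vector) real_vector
  by standard (simp_all add: fun_eq_iff scaleR_add_right scaleR_add_left)


section \<open>Smooth manifolds\<close>

text \<open>Both predicates are meant for open \<open>S\<close>.\<close>

fun Ck_on :: "nat \<Rightarrow> 'a::euclidean_space set \<Rightarrow> ('a \<Rightarrow> 'b::real_normed_vector) \<Rightarrow> bool" where
  "Ck_on 0 S f \<longleftrightarrow> continuous_on S f"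
| "Ck_on (Suc k) S f \<longleftrightarrow>
     (\<forall>x\<in>S. f differentiable (at x)) \<and>
     (\<forall>h. Ck_on k S (\<lambda>x. frechet_derivative f (at x) h))"

definition smooth_on :: "'a::euclidean_space set \<Rightarrow> ('a \<Rightarrow> 'b::real_normed_vector) \<Rightarrow> bool" where
  "smooth_on S f \<longleftrightarrow> (\<forall>k. Ck_on k S f)"

text \<open>
  A chart is a pair of its domain and its coordinate map \<open>u = (u\<^sup>i)\<close>. The underlying set of the
  manifold is the whole type \<open>'m\<close>, which carries the Hausdorff second countable topology; the smooth
  structure is given by an atlas \<open>M\<close> (any atlas of the structure, for instance the maximal one).
\<close>

type_synonym ('m, 'n) chart = "'m set \<times> ('m \<Rightarrow> real ^ 'n)"

abbreviation cdom :: "('m, 'n::finite) chart \<Rightarrow> 'm set" where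
  "cdom c \<equiv> fst c"

abbreviation cmap :: "('m, 'n::finite) chart \<Rightarrow> 'm \<Rightarrow> real ^ 'n" where
  "cmap c \<equiv> snd c"

definition cinv :: "('m, 'n::finite) chart \<Rightarrow> real ^ 'n \<Rightarrow> 'm" where
  "cinv c = inv_into (cdom c) (cmap c)"

definition smooth_manifold ::
    "('m::{t2_space,second_countable_topology}, 'n::finite) chart set \<Rightarrow> bool" where
  "smooth_manifold M \<longleftrightarrow>
     (\<Union>c\<in>M. cdom c) = UNIV \<and>
     (\<forall>c\<in>M. open (cdom c) \<and> open (cmap c ` cdom c) \<and>
        homeomorphism (cdom c) (cmap c ` cdom c) (cmap c) (cinv c)) \<and>
     (\<forall>c\<in>M. \<forall>d\<in>M. smooth_on (cmap c ` (cdom c \<inter> cdom d)) (cmap d \<circ> cinv c))"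

definition smooth_fun ::
    "('m::topological_space, 'n::finite) chart set \<Rightarrow> 'm set \<Rightarrow> ('m \<Rightarrow> real) \<Rightarrow> bool" where
  "smooth_fun M \<Omega> f \<longleftrightarrow> (\<forall>c\<in>M. smooth_on (cmap c ` (\<Omega> \<inter> cdom c)) (f \<circ> cinv c))"

definition smooth_map ::
    "('m::topological_space, 'n::finite) chart set \<Rightarrow> 'a::euclidean_space set \<Rightarrow> ('a \<Rightarrow> 'm) \<Rightarrow> bool" where
  "smooth_map M J f \<longleftrightarrow>
     continuous_on J f \<and> (\<forall>c\<in>M. smooth_on (J \<inter> f -` cdom c) (cmap c \<circ> f))"


section \<open>Tangent vectors and vector fields\<close>

text \<open>
  A tangent vector at \<open>p\<close> is a family assigning to every chart \<open>c\<close> around \<open>p\<close> a component vector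
  \<open>v c = (v(u\<^sup>i))\<close>, such that components in different charts are related by the derivative of the
  change of coordinates. For definiteness the family is \<open>0\<close> at the charts that do not contain \<open>p\<close>.
\<close>

type_synonym ('m, 'n) tvec = "('m, 'n) chart \<Rightarrow> real ^ 'n"

definition tangent_space :: "('m, 'n::finite) chart set \<Rightarrow> 'm \<Rightarrow> ('m, 'n) tvec set" where
  "tangent_space M p = {v.
     (\<forall>c\<in>M. \<forall>d\<in>M. p \<in> cdom c \<inter> cdom d \<longrightarrow>
        v d = frechet_derivative (cmap d \<circ> cinv c) (at (cmap c p)) (v c)) \<and>
     (\<forall>c. \<not> (c \<in> M \<and> p \<in> cdom c) \<longrightarrow> v c = 0)}"

definition tangent_bundle :: "('m, 'n::finite) chart set \<Rightarrow> ('m \<times> ('m, 'n) tvec) set" where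
  "tangent_bundle M = (SIGMA p:UNIV. tangent_space M p)"

definition at_chart ::
    "('m, 'n::finite) chart set \<Rightarrow> 'm \<Rightarrow> (('m, 'n) chart \<Rightarrow> real ^ 'n) \<Rightarrow> ('m, 'n) tvec" where
  "at_chart M p F = (\<lambda>c. if c \<in> M \<and> p \<in> cdom c then F c else 0)"

text \<open>The tangent vector at \<open>p\<close> whose components in the chart \<open>c\<close> are \<open>y\<close>.\<close>

definition coord_vec ::
    "('m, 'n::finite) chart set \<Rightarrow> ('m, 'n) chart \<Rightarrow> 'm \<Rightarrow> real ^ 'n \<Rightarrow> ('m, 'n) tvec" where
  "coord_vec M c p y =
     at_chart M p (\<lambda>d. frechet_derivative (cmap d \<circ> cinv c) (at (cmap c p)) y)"

definition coord_field ::
    "('m, 'n::finite) chart set \<Rightarrow> ('m, 'n) chart \<Rightarrow> 'n \<Rightarrow> 'm \<Rightarrow> ('m, 'n) tvec" where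
  "coord_field M c j = (\<lambda>p. coord_vec M c p (axis j 1))"

text \<open>
  The induced charts \<open>(p, v) \<mapsto> (x, y) = (u(p), v(u))\<close> of the tangent bundle, and their inverses.
\<close>

definition tb_chart :: "('m, 'n::finite) chart \<Rightarrow> 'm \<times> ('m, 'n) tvec \<Rightarrow> (real ^ 'n) \<times> (real ^ 'n)" where
  "tb_chart c = (\<lambda>(p, v). (cmap c p, v c))"

definition tb_inv ::
    "('m, 'n::finite) chart set \<Rightarrow> ('m, 'n) chart \<Rightarrow> (real ^ 'n) \<times> (real ^ 'n) \<Rightarrow> 'm \<times> ('m, 'n) tvec" where
  "tb_inv M c = (\<lambda>(x, y). (cinv c x, coord_vec M c (cinv c x) y))"

definition tb_open :: "('m, 'n::finite) chart set \<Rightarrow> ('m \<times> ('m, 'n) tvec) set \<Rightarrow> bool" where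
  "tb_open M A \<longleftrightarrow> A \<subseteq> tangent_bundle M \<and>
     (\<forall>c\<in>M. open (tb_chart c ` {w \<in> A. fst w \<in> cdom c}))"

definition tb_smooth ::
    "('m, 'n::finite) chart set \<Rightarrow> ('m \<times> ('m, 'n) tvec) set \<Rightarrow> ('m \<times> ('m, 'n) tvec \<Rightarrow> real) \<Rightarrow> bool" where
  "tb_smooth M A F \<longleftrightarrow>
     (\<forall>c\<in>M. smooth_on (tb_chart c ` {w \<in> A. fst w \<in> cdom c}) (F \<circ> tb_inv M c))"

text \<open>Vector fields are total functions; only their values on the open set \<open>\<Omega>\<close> matter.\<close>

definition smooth_field ::
    "('m::topological_space, 'n::finite) chart set \<Rightarrow> 'm set \<Rightarrow> ('m \<Rightarrow> ('m, 'n) tvec) \<Rightarrow> bool" where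
  "smooth_field M \<Omega> X \<longleftrightarrow>
     (\<forall>p\<in>\<Omega>. X p \<in> tangent_space M p) \<and>
     (\<forall>c\<in>M. smooth_on (cmap c ` (\<Omega> \<inter> cdom c)) (\<lambda>x. X (cinv c x) c))"

definition smooth_field_along ::
    "('m::topological_space, 'n::finite) chart set \<Rightarrow> 'a::euclidean_space set \<Rightarrow>
     ('a \<Rightarrow> 'm) \<Rightarrow> ('a \<Rightarrow> ('m, 'n) tvec) \<Rightarrow> bool" where
  "smooth_field_along M J f W \<longleftrightarrow>
     (\<forall>x\<in>J. W x \<in> tangent_space M (f x)) \<and>
     (\<forall>c\<in>M. smooth_on (J \<inter> f -` cdom c) (\<lambda>x. W x c))"

text \<open>The derivative \<open>v(f)\<close> of a function; it does not depend on the chart used to compute it.\<close>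

definition vec_deriv :: "('m, 'n::finite) chart set \<Rightarrow> 'm \<Rightarrow> ('m, 'n) tvec \<Rightarrow> ('m \<Rightarrow> real) \<Rightarrow> real" where
  "vec_deriv M p v f =
     (let c = (SOME c. c \<in> M \<and> p \<in> cdom c)
      in frechet_derivative (f \<circ> cinv c) (at (cmap c p)) (v c))"

text \<open>In coordinates \<open>[X,Y]\<^sup>i = X(Y\<^sup>i) - Y(X\<^sup>i)\<close>.\<close>

definition lie_bracket ::
    "('m, 'n::finite) chart set \<Rightarrow> ('m \<Rightarrow> ('m, 'n) tvec) \<Rightarrow> ('m \<Rightarrow> ('m, 'n) tvec) \<Rightarrow>
     'm \<Rightarrow> ('m, 'n) tvec" where
  "lie_bracket M X Y p = at_chart M p (\<lambda>c.
     frechet_derivative (\<lambda>x. Y (cinv c x) c) (at (cmap c p)) (X p c) -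
     frechet_derivative (\<lambda>x. X (cinv c x) c) (at (cmap c p)) (Y p c))"


section \<open>Pseudo-Finsler structures\<close>

definition fund_tensor ::
    "('m \<times> ('m, 'n::finite) tvec \<Rightarrow> real) \<Rightarrow> 'm \<Rightarrow> ('m, 'n) tvec \<Rightarrow>
     ('m, 'n) tvec \<Rightarrow> ('m, 'n) tvec \<Rightarrow> real" where
  "fund_tensor L p v u w =
     1/2 * deriv (\<lambda>t. deriv (\<lambda>s. L (p, v + t *\<^sub>R u + s *\<^sub>R w)) 0) 0"

definition cartan_tensor ::
    "('m \<times> ('m, 'n::finite) tvec \<Rightarrow> real) \<Rightarrow> 'm \<Rightarrow> ('m, 'n) tvec \<Rightarrow>
     ('m, 'n) tvec \<Rightarrow> ('m, 'n) tvec \<Rightarrow> ('m, 'n) tvec \<Rightarrow> real" where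
  "cartan_tensor L p v w\<^sub>1 w\<^sub>2 w\<^sub>3 =
     1/4 * deriv (\<lambda>s\<^sub>1. deriv (\<lambda>s\<^sub>2. deriv (\<lambda>s\<^sub>3.
       L (p, v + s\<^sub>1 *\<^sub>R w\<^sub>1 + s\<^sub>2 *\<^sub>R w\<^sub>2 + s\<^sub>3 *\<^sub>R w\<^sub>3)) 0) 0) 0"

definition pseudo_finsler ::
    "('m::{t2_space,second_countable_topology}, 'n::finite) chart set \<Rightarrow>
     ('m \<times> ('m, 'n) tvec) set \<Rightarrow> ('m \<times> ('m, 'n) tvec \<Rightarrow> real) \<Rightarrow> bool" where
  "pseudo_finsler M A L \<longleftrightarrow>
     smooth_manifold M \<and>
     tb_open M A \<and>
     (\<forall>(p, v)\<in>A. v \<noteq> 0) \<and>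
     (\<forall>(p, v)\<in>A. \<forall>r>0. (p, r *\<^sub>R v) \<in> A) \<and>
     tb_smooth M A L \<and>
     (\<forall>(p, v)\<in>A. \<forall>r>0. L (p, r *\<^sub>R v) = r\<^sup>2 * L (p, v)) \<and>
     (\<forall>(p, v)\<in>A. \<forall>u\<in>tangent_space M p.
        (\<forall>w\<in>tangent_space M p. fund_tensor L p v u w = 0) \<longrightarrow> u = 0)"

definition admissible_field ::
    "('m::topological_space, 'n::finite) chart set \<Rightarrow> ('m \<times> ('m, 'n) tvec) set \<Rightarrow>
     'm set \<Rightarrow> ('m \<Rightarrow> ('m, 'n) tvec) \<Rightarrow> bool" where
  "admissible_field M A \<Omega> V \<longleftrightarrow> smooth_field M \<Omega> V \<and> (\<forall>p\<in>\<Omega>. (p, V p) \<in> A)"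


section \<open>Chern connection\<close>

type_synonym ('m, 'n) field_op =
  "('m \<Rightarrow> ('m, 'n) tvec) \<Rightarrow> ('m \<Rightarrow> ('m, 'n) tvec) \<Rightarrow> 'm \<Rightarrow> ('m, 'n) tvec"

definition affine_connection ::
    "('m::topological_space, 'n::finite) chart set \<Rightarrow> 'm set \<Rightarrow> ('m, 'n) field_op \<Rightarrow> bool" where
  "affine_connection M \<Omega> N \<longleftrightarrow>
     (\<forall>X Y. smooth_field M \<Omega> X \<longrightarrow> smooth_field M \<Omega> Y \<longrightarrow> smooth_field M \<Omega> (N X Y)) \<and>
     (\<forall>X X' Y. smooth_field M \<Omega> X \<longrightarrow> smooth_field M \<Omega> X' \<longrightarrow> smooth_field M \<Omega> Y \<longrightarrow>
        (\<forall>p\<in>\<Omega>. N (X + X') Y p = N X Y p + N X' Y p)) \<and>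
     (\<forall>X Y Y'. smooth_field M \<Omega> X \<longrightarrow> smooth_field M \<Omega> Y \<longrightarrow> smooth_field M \<Omega> Y' \<longrightarrow>
        (\<forall>p\<in>\<Omega>. N X (Y + Y') p = N X Y p + N X Y' p)) \<and>
     (\<forall>f X Y. smooth_fun M \<Omega> f \<longrightarrow> smooth_field M \<Omega> X \<longrightarrow> smooth_field M \<Omega> Y \<longrightarrow>
        (\<forall>p\<in>\<Omega>. N (\<lambda>q. f q *\<^sub>R X q) Y p = f p *\<^sub>R N X Y p \<and>
              N X (\<lambda>q. f q *\<^sub>R Y q) p = vec_deriv M p (X p) f *\<^sub>R Y p + f p *\<^sub>R N X Y p))"

definition torsion_free ::
    "('m::topological_space, 'n::finite) chart set \<Rightarrow> 'm set \<Rightarrow> ('m, 'n) field_op \<Rightarrow> bool" where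
  "torsion_free M \<Omega> N \<longleftrightarrow>
     (\<forall>X Y. smooth_field M \<Omega> X \<longrightarrow> smooth_field M \<Omega> Y \<longrightarrow>
        (\<forall>p\<in>\<Omega>. N X Y p - N Y X p = lie_bracket M X Y p))"

definition almost_metric ::
    "('m::topological_space, 'n::finite) chart set \<Rightarrow> ('m \<times> ('m, 'n) tvec \<Rightarrow> real) \<Rightarrow>
     'm set \<Rightarrow> ('m \<Rightarrow> ('m, 'n) tvec) \<Rightarrow> ('m, 'n) field_op \<Rightarrow> bool" where
  "almost_metric M L \<Omega> V N \<longleftrightarrow>
     (\<forall>X Y Z. smooth_field M \<Omega> X \<longrightarrow> smooth_field M \<Omega> Y \<longrightarrow> smooth_field M \<Omega> Z \<longrightarrow>
        (\<forall>p\<in>\<Omega>. vec_deriv M p (X p) (\<lambda>q. fund_tensor L q (V q) (Y q) (Z q)) =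
           fund_tensor L p (V p) (N X Y p) (Z p) + fund_tensor L p (V p) (Y p) (N X Z p) +
           2 * cartan_tensor L p (V p) (N X V p) (Y p) (Z p)))"

text \<open>
  \<open>\<nabla>\<^sup>V\<close>. Its values on smooth vector fields at points of \<open>\<Omega>\<close> are determined by the three properties;
  \<open>SOME\<close> instead of \<open>THE\<close> only because operators on arbitrary functions, which need not be smooth
  fields, are not determined by them.
\<close>

definition chern_connection ::
    "('m::topological_space, 'n::finite) chart set \<Rightarrow> ('m \<times> ('m, 'n) tvec \<Rightarrow> real) \<Rightarrow>
     'm set \<Rightarrow> ('m \<Rightarrow> ('m, 'n) tvec) \<Rightarrow> ('m, 'n) field_op" where
  "chern_connection M L \<Omega> V =
     (SOME N. affine_connection M \<Omega> N \<and> torsion_free M \<Omega> N \<and> almost_metric M L \<Omega> V N)"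

definition curvature :: "('m, 'n::finite) chart set \<Rightarrow> ('m, 'n) field_op \<Rightarrow>
    ('m \<Rightarrow> ('m, 'n) tvec) \<Rightarrow> ('m \<Rightarrow> ('m, 'n) tvec) \<Rightarrow> ('m \<Rightarrow> ('m, 'n) tvec) \<Rightarrow>
    'm \<Rightarrow> ('m, 'n) tvec" where
  "curvature M N X Y Z p = N X (N Y Z) p - N Y (N X Z) p - N (lie_bracket M X Y) Z p"

text \<open>
  \<open>\<Gamma> (p, v) i j k\<close> is \<open>\<Gamma>\<^sup>i\<^sub>j\<^sub>k(v)\<close>. The admissible fields are taken on arbitrary open subsets of the
  chart domain, since a vector of \<open>A\<close> need not extend to an admissible field on the whole domain.
  The values of \<open>\<Gamma>\<close> on \<open>A\<close> over the chart domain are determined by these properties.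
\<close>

definition christoffel ::
    "('m::topological_space, 'n::finite) chart set \<Rightarrow> ('m \<times> ('m, 'n) tvec) set \<Rightarrow>
     ('m \<times> ('m, 'n) tvec \<Rightarrow> real) \<Rightarrow> ('m, 'n) chart \<Rightarrow>
     'm \<times> ('m, 'n) tvec \<Rightarrow> 'n \<Rightarrow> 'n \<Rightarrow> 'n \<Rightarrow> real" where
  "christoffel M A L c = (SOME \<Gamma>.
     (\<forall>w\<in>A. fst w \<in> cdom c \<longrightarrow> (\<forall>i j k. \<Gamma> w i j k = \<Gamma> w i k j)) \<and>
     (\<forall>\<Omega> V. open \<Omega> \<longrightarrow> \<Omega> \<subseteq> cdom c \<longrightarrow> admissible_field M A \<Omega> V \<longrightarrow>
        (\<forall>j k. \<forall>p\<in>\<Omega>. chern_connection M L \<Omega> V (coord_field M c j) (coord_field M c k) p =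
           (\<Sum>i\<in>UNIV. \<Gamma> (p, V p) i j k *\<^sub>R coord_field M c i p))))"

text \<open>\<open>P\<^sub>v(X,Y,Z)\<close> for \<open>v, X, Y, Z\<close> tangent at \<open>p\<close>, given by its components in each chart.\<close>

definition chern_tensor ::
    "('m::topological_space, 'n::finite) chart set \<Rightarrow> ('m \<times> ('m, 'n) tvec) set \<Rightarrow>
     ('m \<times> ('m, 'n) tvec \<Rightarrow> real) \<Rightarrow> 'm \<Rightarrow> ('m, 'n) tvec \<Rightarrow>
     ('m, 'n) tvec \<Rightarrow> ('m, 'n) tvec \<Rightarrow> ('m, 'n) tvec \<Rightarrow> ('m, 'n) tvec" where
  "chern_tensor M A L p v X Y Z = at_chart M p (\<lambda>c. \<chi> i.
     \<Sum>j\<in>UNIV. \<Sum>k\<in>UNIV. \<Sum>l\<in>UNIV. X c $ j * Y c $ k * Z c $ l *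
       deriv (\<lambda>h. christoffel M A L c (p, v + h *\<^sub>R coord_field M c l p) i j k) 0)"


section \<open>Curves and two parameter maps\<close>

text \<open>
  Smoothness on \<open>[a,b]\<close> means existence of a smooth extension to a larger open interval. Derivatives
  are taken within the parameter interval \<open>I\<close>, hence are one-sided at its end points.
\<close>

definition smooth_curve ::
    "('m::topological_space, 'n::finite) chart set \<Rightarrow> real \<Rightarrow> real \<Rightarrow> (real \<Rightarrow> 'm) \<Rightarrow> bool" where
  "smooth_curve M a b \<gamma> \<longleftrightarrow> (\<exists>a' b' \<gamma>'. a' < a \<and> b < b' \<and>
     smooth_map M {a'<..<b'} \<gamma>' \<and> (\<forall>t\<in>{a..b}. \<gamma>' t = \<gamma> t))"

definition smooth_field_on_curve ::
    "('m::topological_space, 'n::finite) chart set \<Rightarrow> real \<Rightarrow> real \<Rightarrow> (real \<Rightarrow> 'm) \<Rightarrow>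
     (real \<Rightarrow> ('m, 'n) tvec) \<Rightarrow> bool" where
  "smooth_field_on_curve M a b \<gamma> U \<longleftrightarrow> (\<exists>a' b' \<gamma>' U'. a' < a \<and> b < b' \<and>
     smooth_map M {a'<..<b'} \<gamma>' \<and> smooth_field_along M {a'<..<b'} \<gamma>' U' \<and>
     (\<forall>t\<in>{a..b}. \<gamma>' t = \<gamma> t \<and> U' t = U t))"

definition velocity ::
    "('m, 'n::finite) chart set \<Rightarrow> real set \<Rightarrow> (real \<Rightarrow> 'm) \<Rightarrow> real \<Rightarrow> ('m, 'n) tvec" where
  "velocity M I \<gamma> t =
     at_chart M (\<gamma> t) (\<lambda>c. vector_derivative (\<lambda>\<tau>. cmap c (\<gamma> \<tau>)) (at t within I))"

definition embedded_curve ::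
    "('m::topological_space, 'n::finite) chart set \<Rightarrow> real \<Rightarrow> real \<Rightarrow> (real \<Rightarrow> 'm) \<Rightarrow> bool" where
  "embedded_curve M a b \<gamma> \<longleftrightarrow> smooth_curve M a b \<gamma> \<and>
     (\<forall>t\<in>{a..b}. velocity M {a..b} \<gamma> t \<noteq> 0) \<and>
     (\<exists>g. homeomorphism {a..b} (\<gamma> ` {a..b}) \<gamma> g)"

definition admissible_curve ::
    "('m::topological_space, 'n::finite) chart set \<Rightarrow> ('m \<times> ('m, 'n) tvec) set \<Rightarrow>
     real \<Rightarrow> real \<Rightarrow> (real \<Rightarrow> 'm) \<Rightarrow> bool" where
  "admissible_curve M A a b \<gamma> \<longleftrightarrow> (\<forall>t\<in>{a..b}. (\<gamma> t, velocity M {a..b} \<gamma> t) \<in> A)"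

text \<open>\<open>D\<^sub>\<gamma>\<^sup>T X\<close> for a curve with parameter interval \<open>I\<close>, by components in each chart.\<close>

definition cov_deriv ::
    "('m::topological_space, 'n::finite) chart set \<Rightarrow> ('m \<times> ('m, 'n) tvec) set \<Rightarrow>
     ('m \<times> ('m, 'n) tvec \<Rightarrow> real) \<Rightarrow> real set \<Rightarrow> (real \<Rightarrow> 'm) \<Rightarrow>
     (real \<Rightarrow> ('m, 'n) tvec) \<Rightarrow> (real \<Rightarrow> ('m, 'n) tvec) \<Rightarrow> real \<Rightarrow> ('m, 'n) tvec" where
  "cov_deriv M A L I \<gamma> T X t = at_chart M (\<gamma> t) (\<lambda>c.
     vector_derivative (\<lambda>\<tau>. X \<tau> c) (at t within I) +
     (\<chi> i. \<Sum>j\<in>UNIV. \<Sum>k\<in>UNIV.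
        X t c $ j * velocity M I \<gamma> t c $ k * christoffel M A L c (\<gamma> t, T t) i j k))"

definition two_param_map ::
    "('m::topological_space, 'n::finite) chart set \<Rightarrow> real \<Rightarrow> real \<Rightarrow> real \<Rightarrow>
     (real \<times> real \<Rightarrow> 'm) \<Rightarrow> bool" where
  "two_param_map M a b \<epsilon> \<Lambda> \<longleftrightarrow> (\<exists>a' b' \<Lambda>'. a' < a \<and> b < b' \<and>
     smooth_map M ({a'<..<b'} \<times> {-\<epsilon><..<\<epsilon>}) \<Lambda>' \<and>
     (\<forall>x\<in>{a..b} \<times> {-\<epsilon><..<\<epsilon>}. \<Lambda>' x = \<Lambda> x))"

definition smooth_field_on_two_param ::
    "('m::topological_space, 'n::finite) chart set \<Rightarrow> real \<Rightarrow> real \<Rightarrow> real \<Rightarrow>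
     (real \<times> real \<Rightarrow> 'm) \<Rightarrow> (real \<times> real \<Rightarrow> ('m, 'n) tvec) \<Rightarrow> bool" where
  "smooth_field_on_two_param M a b \<epsilon> \<Lambda> W \<longleftrightarrow> (\<exists>a' b' \<Lambda>' W'. a' < a \<and> b < b' \<and>
     smooth_map M ({a'<..<b'} \<times> {-\<epsilon><..<\<epsilon>}) \<Lambda>' \<and>
     smooth_field_along M ({a'<..<b'} \<times> {-\<epsilon><..<\<epsilon>}) \<Lambda>' W' \<and>
     (\<forall>x\<in>{a..b} \<times> {-\<epsilon><..<\<epsilon>}. \<Lambda>' x = \<Lambda> x \<and> W' x = W x))"

definition partial_t ::
    "('m, 'n::finite) chart set \<Rightarrow> real \<Rightarrow> real \<Rightarrow> (real \<times> real \<Rightarrow> 'm) \<Rightarrow>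
     real \<times> real \<Rightarrow> ('m, 'n) tvec" where
  "partial_t M a b \<Lambda> = (\<lambda>(t, s). velocity M {a..b} (\<lambda>\<tau>. \<Lambda> (\<tau>, s)) t)"

definition partial_s ::
    "('m, 'n::finite) chart set \<Rightarrow> real \<Rightarrow> (real \<times> real \<Rightarrow> 'm) \<Rightarrow>
     real \<times> real \<Rightarrow> ('m, 'n) tvec" where
  "partial_s M \<epsilon> \<Lambda> = (\<lambda>(t, s). velocity M {-\<epsilon><..<\<epsilon>} (\<lambda>\<sigma>. \<Lambda> (t, \<sigma>)) s)"

definition admissible_two_param ::
    "('m::topological_space, 'n::finite) chart set \<Rightarrow> ('m \<times> ('m, 'n) tvec) set \<Rightarrow>
     real \<Rightarrow> real \<Rightarrow> real \<Rightarrow> (real \<times> real \<Rightarrow> 'm) \<Rightarrow> bool" where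
  "admissible_two_param M A a b \<epsilon> \<Lambda> \<longleftrightarrow> two_param_map M a b \<epsilon> \<Lambda> \<and>
     (\<forall>x\<in>{a..b} \<times> {-\<epsilon><..<\<epsilon>}. (\<Lambda> x, partial_t M a b \<Lambda> x) \<in> A)"

text \<open>The covariant derivatives along \<open>\<gamma>\<^sub>s\<close> and \<open>\<beta>\<^sub>t\<close>, both with reference vector \<open>\<Lambda>\<^sub>t\<close>.\<close>

definition cov_deriv_t ::
    "('m::topological_space, 'n::finite) chart set \<Rightarrow> ('m \<times> ('m, 'n) tvec) set \<Rightarrow>
     ('m \<times> ('m, 'n) tvec \<Rightarrow> real) \<Rightarrow> real \<Rightarrow> real \<Rightarrow> (real \<times> real \<Rightarrow> 'm) \<Rightarrow>
     (real \<times> real \<Rightarrow> ('m, 'n) tvec) \<Rightarrow> real \<times> real \<Rightarrow> ('m, 'n) tvec" where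
  "cov_deriv_t M A L a b \<Lambda> W = (\<lambda>(t, s). cov_deriv M A L {a..b}
     (\<lambda>\<tau>. \<Lambda> (\<tau>, s)) (\<lambda>\<tau>. partial_t M a b \<Lambda> (\<tau>, s)) (\<lambda>\<tau>. W (\<tau>, s)) t)"

definition cov_deriv_s ::
    "('m::topological_space, 'n::finite) chart set \<Rightarrow> ('m \<times> ('m, 'n) tvec) set \<Rightarrow>
     ('m \<times> ('m, 'n) tvec \<Rightarrow> real) \<Rightarrow> real \<Rightarrow> real \<Rightarrow> real \<Rightarrow> (real \<times> real \<Rightarrow> 'm) \<Rightarrow>
     (real \<times> real \<Rightarrow> ('m, 'n) tvec) \<Rightarrow> real \<times> real \<Rightarrow> ('m, 'n) tvec" where
  "cov_deriv_s M A L a b \<epsilon> \<Lambda> W = (\<lambda>(t, s). cov_deriv M A L {-\<epsilon><..<\<epsilon>}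
     (\<lambda>\<sigma>. \<Lambda> (t, \<sigma>)) (\<lambda>\<sigma>. partial_t M a b \<Lambda> (t, \<sigma>)) (\<lambda>\<sigma>. W (t, \<sigma>)) s)"

definition curv_two_param ::
    "('m::topological_space, 'n::finite) chart set \<Rightarrow> ('m \<times> ('m, 'n) tvec) set \<Rightarrow>
     ('m \<times> ('m, 'n) tvec \<Rightarrow> real) \<Rightarrow> real \<Rightarrow> real \<Rightarrow> real \<Rightarrow> (real \<times> real \<Rightarrow> 'm) \<Rightarrow>
     (real \<times> real \<Rightarrow> ('m, 'n) tvec) \<Rightarrow> real \<times> real \<Rightarrow> ('m, 'n) tvec" where
  "curv_two_param M A L a b \<epsilon> \<Lambda> W x =
     cov_deriv_t M A L a b \<Lambda> (cov_deriv_s M A L a b \<epsilon> \<Lambda> W) x -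
     cov_deriv_s M A L a b \<epsilon> \<Lambda> (cov_deriv_t M A L a b \<Lambda> W) x"

text \<open>
  \<open>R\<^sup>\<gamma>(\<gamma>', U)W\<close>, as a vector field along \<open>\<gamma>\<close>; only its values on \<open>[a,b]\<close> are meaningful. The choice
  of \<open>\<Lambda>\<close> and of the extension of \<open>W\<close> is made by \<open>SOME\<close>.
\<close>

definition curv_curve ::
    "('m::topological_space, 'n::finite) chart set \<Rightarrow> ('m \<times> ('m, 'n) tvec) set \<Rightarrow>
     ('m \<times> ('m, 'n) tvec \<Rightarrow> real) \<Rightarrow> real \<Rightarrow> real \<Rightarrow> (real \<Rightarrow> 'm) \<Rightarrow>
     (real \<Rightarrow> ('m, 'n) tvec) \<Rightarrow> (real \<Rightarrow> ('m, 'n) tvec) \<Rightarrow> real \<Rightarrow> ('m, 'n) tvec" where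
  "curv_curve M A L a b \<gamma> U W = (SOME r. \<exists>\<epsilon> \<Lambda> W'. \<epsilon> > 0 \<and>
     admissible_two_param M A a b \<epsilon> \<Lambda> \<and>
     (\<forall>t\<in>{a..b}. \<Lambda> (t, 0) = \<gamma> t \<and> partial_s M \<epsilon> \<Lambda> (t, 0) = U t) \<and>
     smooth_field_on_two_param M a b \<epsilon> \<Lambda> W' \<and>
     (\<forall>t\<in>{a..b}. W' (t, 0) = W t) \<and>
     r = (\<lambda>t. curv_two_param M A L a b \<epsilon> \<Lambda> W' (t, 0)))"

end

theory Submission
  imports Defs
begin

text \<open>
  In a chart, the Koszul formula for the Chern connection contains the Cartan tensor only through
  derivatives in the direction of the reference vector. Since the Cartan tensor vanishes on that
  vector, the formula can be solved in three steps, which yields uniqueness and smooth symbols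
  \<open>\<Gamma>(x, y)\<close>, and, by pointwise uniqueness, independence of the chart.

  For an arbitrary variation \<open>\<Lambda>\<close> with \<open>\<Lambda>\<^sub>t = V\<close>, \<open>\<Lambda>\<^sub>s = U\<close> along \<open>\<gamma>\<close> both curvatures are then computed
  in coordinates. They differ only in the vertical derivative of \<open>\<Gamma>\<close> in the \<open>s\<close>-direction: in
  \<open>R\<^sup>\<Lambda>\<close> the reference vector moves with velocity \<open>\<partial>\<^sub>s\<Lambda>\<^sub>t = \<partial>\<^sub>t\<Lambda>\<^sub>s = DU(V)\<close>, in \<open>R\<^sup>V\<close> with velocity \<open>DV(U)\<close>. The
  difference of the two is the bracket \<open>[U, V]\<close> in the argument of the Chern tensor.

  A variation with given \<open>\<Lambda>\<^sub>s\<close> along \<open>\<gamma>\<close> exists because straight-line variations in charts can be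
  glued along \<open>[a, b]\<close> by convex combinations.
\<close>

section \<open>Calculus of smooth functions\<close>

text \<open>\<open>chern_connection\<close>, \<open>christoffel\<close> and
  \<open>curv_curve\<close> are Hilbert choices, so nothing can be read off from them before the
  property that they choose by is known to be satisfiable; each needs a witness and a uniqueness
  statement. An operator with the Chern properties takes fields, not vectors at a point, and is
  arbitrary off the smooth fields; hence uniqueness is proved for its values at one point on smooth
  fields. The Chern tensor differentiates \<Gamma> along the fibre, so \<Gamma> must be a smooth
  function on the chart image of \<open>A\<close> and not just a family indexed by reference fields;
  this is why the Koszul formula is solved explicitly.

  No two variations are compared: for whichever variation and extension of \<open>W\<close> the
  choice yields, the curvature is evaluated to an expression in \<open>V\<close>, \<open>U'\<close>
  and \<open>W'\<close> alone. The definitions differentiate within [a, b], one-sidedly at the end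
  points; since a < b these derivatives are unique and equal the two-sided ones of any smooth
  extension.\<close>

abbreviation DD :: "('a::real_normed_vector \<Rightarrow> 'b::real_normed_vector) \<Rightarrow> 'a \<Rightarrow> 'a \<Rightarrow> 'b" where
  "DD f x \<equiv> frechet_derivative f (at x)"

lemma DD_I: "(f has_derivative f') (at x) \<Longrightarrow> DD f x = f'"
  using frechet_derivative_at by metis

lemma DD_works: "f differentiable (at x) \<Longrightarrow> (f has_derivative DD f x) (at x)"
  using frechet_derivative_works by blast

lemma DD_cong:
  assumes "open S" "x \<in> S" "\<And>y. y \<in> S \<Longrightarrow> f y = g y"
  shows "DD f x = DD g x"
proof -
  have "(f has_derivative F) (at x) \<longleftrightarrow> (g has_derivative F) (at x)" for F
    using assms has_derivative_transform_within_open[of f F x UNIV S g]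
      has_derivative_transform_within_open[of g F x UNIV S f] by metis
  then show ?thesis by (simp add: frechet_derivative_def)
qed

lemma differentiable_cong:
  assumes "open S" "x \<in> S" "\<And>y. y \<in> S \<Longrightarrow> f y = g y" "f differentiable (at x)"
  shows "g differentiable (at x)"
  using assms has_derivative_transform_within_open[of f _ x UNIV S g]
  unfolding differentiable_def by metis

section \<open>Functions of class C^k: locality and closure properties\<close>

lemma Ck_on_cong:
  assumes "open S" "\<And>x. x \<in> S \<Longrightarrow> f x = g x" "Ck_on k S f"
  shows "Ck_on k S g"
  using assms(2,3)
proof (induction k arbitrary: f g)
  case 0
  then show ?case using continuous_on_cong by force
next
  case (Suc k)
  have "g differentiable at x" if "x \<in> S" for x
    using differentiable_cong[OF \<open>open S\<close> that] Suc.prems that by auto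
  moreover have "Ck_on k S (\<lambda>x. DD g x h)" for h
  proof (rule Suc.IH[of "\<lambda>x. DD f x h"])
    show "DD f x h = DD g x h" if "x \<in> S" for x
      using DD_cong[OF \<open>open S\<close> that] Suc.prems by metis
    show "Ck_on k S (\<lambda>x. DD f x h)" using Suc.prems by simp
  qed
  ultimately show ?case by simp
qed

lemma Ck_on_subset: "Ck_on k S f \<Longrightarrow> T \<subseteq> S \<Longrightarrow> Ck_on k T f"
  by (induction k arbitrary: f) (auto intro: continuous_on_subset)

lemma Ck_on_SucD: "Ck_on (Suc k) S f \<Longrightarrow> Ck_on k S f"
proof (induction k arbitrary: f)
  case 0
  then have "f differentiable_on S"
    by (auto simp: differentiable_on_def intro: differentiable_at_withinI)
  then show ?case by (simp add: differentiable_imp_continuous_on)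
next
  case (Suc k)
  then show ?case by simp
qed

text \<open>The neighbourhoods \<open>T\<close> may stick out of \<open>S\<close>: the derivatives
  in \<open>Ck_on\<close> are taken in the full space at the points of \<open>S\<close>, and
  continuity at the bottom of the recursion follows from continuity at each point.\<close>

lemma Ck_on_local:
  assumes "\<And>x. x \<in> S \<Longrightarrow> \<exists>T. open T \<and> x \<in> T \<and> Ck_on k T f"
  shows "Ck_on k S f"
  using assms
proof (induction k arbitrary: f)
  case 0
  show ?case
    unfolding Ck_on.simps
  proof (rule continuous_at_imp_continuous_on, rule ballI)
    fix x assume "x \<in> S"
    then obtain T where "open T" "x \<in> T" "continuous_on T f" using 0[of x] by auto
    then show "isCont f x" using continuous_on_eq_continuous_at by blast
  qed
next
  case (Suc k)
  have "f differentiable (at x)" if x: "x \<in> S" for x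
  proof -
    obtain T where "x \<in> T" "Ck_on (Suc k) T f" using Suc.prems[OF x] by blast
    then show ?thesis by simp
  qed
  moreover have "Ck_on k S (\<lambda>x. DD f x h)" for h
  proof (rule Suc.IH)
    fix x assume x: "x \<in> S"
    obtain T where "open T" "x \<in> T" "Ck_on (Suc k) T f" using Suc.prems[OF x] by blast
    then show "\<exists>T. open T \<and> x \<in> T \<and> Ck_on k T (\<lambda>x. DD f x h)" by auto
  qed
  ultimately show ?case by simp
qed

lemma Ck_on_const: "Ck_on k S (\<lambda>x. c)"
  by (induction k arbitrary: c) auto

lemma Ck_on_linear: "bounded_linear f \<Longrightarrow> Ck_on k S f"
proof (induction k)
  case 0
  then show ?case by (simp add: linear_continuous_on)
next
  case (Suc k)
  have "(f has_derivative f) (at x)" for x by (rule bounded_linear_imp_has_derivative[OF Suc.prems])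
  then have "f differentiable (at x)" "DD f x = f" for x
    by (auto simp: differentiable_def dest: DD_I)
  then show ?case by (simp add: Ck_on_const)
qed

lemma Ck_on_add: "open S \<Longrightarrow> Ck_on k S f \<Longrightarrow> Ck_on k S g \<Longrightarrow> Ck_on k S (\<lambda>x. f x + g x)"
proof (induction k arbitrary: f g)
  case 0
  then show ?case by (simp add: continuous_on_add)
next
  case (Suc k)
  have *: "((\<lambda>x. f x + g x) has_derivative (\<lambda>h. DD f x h + DD g x h)) (at x)" if "x \<in> S" for x
    using Suc.prems that by (intro has_derivative_add DD_works) auto
  have "Ck_on k S (\<lambda>x. DD (\<lambda>x. f x + g x) x h)" for h
    by (rule Ck_on_cong[OF \<open>open S\<close>, of "\<lambda>x. DD f x h + DD g x h"])
      (use DD_I[OF *] Suc in auto)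
  then show ?case using * by (auto simp: differentiable_def)
qed

text \<open>Each summand of the product rule has one undifferentiated factor, which is needed at the
  lower order \<open>k\<close> only (\<open>Ck_on_SucD\<close>); so the induction runs over all
  pairs of functions at once.\<close>

lemma Ck_on_bilinear:
  assumes "bounded_bilinear B" "open S"
  shows "Ck_on k S f \<Longrightarrow> Ck_on k S g \<Longrightarrow> Ck_on k S (\<lambda>x. B (f x) (g x))"
proof (induction k arbitrary: f g)
  case 0
  then show ?case by (simp add: bounded_bilinear.continuous_on[OF assms(1)])
next
  case (Suc k)
  have *: "((\<lambda>x. B (f x) (g x)) has_derivative (\<lambda>h. B (f x) (DD g x h) + B (DD f x h) (g x))) (at x)"
    if "x \<in> S" for x
    using Suc.prems that by (intro bounded_bilinear.FDERIV[OF assms(1)] DD_works) auto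
  have "Ck_on k S (\<lambda>x. B (f x) (DD g x h) + B (DD f x h) (g x))" for h
    using Suc.prems Ck_on_SucD[OF Suc.prems(1)] Ck_on_SucD[OF Suc.prems(2)]
    by (intro Ck_on_add Suc.IH \<open>open S\<close>) auto
  then have "Ck_on k S (\<lambda>x. DD (\<lambda>x. B (f x) (g x)) x h)" for h
    by (rule Ck_on_cong[OF \<open>open S\<close>, rotated])
      (use DD_I[OF *] in auto)
  then show ?case using * by (auto simp: differentiable_def)
qed

lemma Ck_on_linear_comp:
  assumes "bounded_linear B" "open S"
  shows "Ck_on k S f \<Longrightarrow> Ck_on k S (\<lambda>x. B (f x))"
proof (induction k arbitrary: f)
  case 0
  then show ?case by (simp add: bounded_linear.continuous_on[OF assms(1)])
next
  case (Suc k)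
  have *: "((\<lambda>x. B (f x)) has_derivative (\<lambda>h. B (DD f x h))) (at x)" if "x \<in> S" for x
    using Suc.prems that by (intro bounded_linear.has_derivative[OF assms(1)] DD_works) auto
  have "Ck_on k S (\<lambda>x. DD (\<lambda>x. B (f x)) x h)" for h
    by (rule Ck_on_cong[OF \<open>open S\<close>, of "\<lambda>x. B (DD f x h)"])
      (use DD_I[OF *] Suc in auto)
  then show ?case using * by (auto simp: differentiable_def)
qed

lemma Ck_on_sum:
  assumes "open S" "finite I" "\<And>i. i \<in> I \<Longrightarrow> Ck_on k S (f i)"
  shows "Ck_on k S (\<lambda>x. \<Sum>i\<in>I. f i x)"
  using assms(2,3)
  by (induction I rule: finite_induct) (auto simp: Ck_on_const intro!: Ck_on_add assms(1))

lemma DD_basis_expansion: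
  fixes f :: "'a::euclidean_space \<Rightarrow> 'b::real_normed_vector"
  assumes "f differentiable (at x)"
  shows "DD f x h = (\<Sum>b\<in>Basis. (h \<bullet> b) *\<^sub>R DD f x b)"
proof -
  have "linear (DD f x)" using assms linear_frechet_derivative by blast
  then show ?thesis
    by (subst euclidean_representation[of h, symmetric]) (simp add: linear_sum linear_cmul)
qed

lemma DD_comp:
  assumes "f differentiable (at (g x))" "g differentiable (at x)"
  shows "DD (\<lambda>x. f (g x)) x h = DD f (g x) (DD g x h)"
    and "(\<lambda>x. f (g x)) differentiable (at x)"
proof -
  have "((\<lambda>x. f (g x)) has_derivative (\<lambda>h. DD f (g x) (DD g x h))) (at x)"
    by (rule has_derivative_compose[OF DD_works[OF assms(2)] DD_works[OF assms(1)]])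
  then show "DD (\<lambda>x. f (g x)) x h = DD f (g x) (DD g x h)"
    and "(\<lambda>x. f (g x)) differentiable (at x)"
    by (auto simp: differentiable_def dest: DD_I)
qed

text \<open>The chain rule produces \<open>DD f (g x) (DD g x h)\<close>, whose direction moves with
  \<open>x\<close>, while \<open>Ck_on\<close> controls derivatives in fixed directions only.
  Expanding the direction in the basis leaves products of order \<open>k\<close>, with the induction
  hypothesis applied to the functions \<open>DD f _ b\<close>.\<close>

lemma Ck_on_comp:
  fixes g :: "'a::euclidean_space \<Rightarrow> 'b::euclidean_space"
  assumes "open S" "open T" "\<And>x. x \<in> S \<Longrightarrow> g x \<in> T"
  shows "Ck_on k T f \<Longrightarrow> Ck_on k S g \<Longrightarrow> Ck_on k S (\<lambda>x. f (g x))"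
proof (induction k arbitrary: f)
  case 0
  then show ?case using assms(3) by (auto intro: continuous_on_compose2)
next
  case (Suc k)
  have d: "f differentiable (at (g x))" "g differentiable (at x)" if "x \<in> S" for x
    using Suc.prems assms(3) that by auto
  have "Ck_on k S (\<lambda>x. \<Sum>b\<in>Basis. (DD g x h \<bullet> b) *\<^sub>R DD f (g x) b)" for h
  proof (intro Ck_on_sum Ck_on_bilinear[OF bounded_bilinear_scaleR] \<open>open S\<close>)
    show "Ck_on k S (\<lambda>x. DD f (g x) b)" for b
      using Suc Ck_on_SucD[OF Suc.prems(2)] by auto
    show "Ck_on k S (\<lambda>x. DD g x h \<bullet> b)" for b
      using Suc.prems by (intro Ck_on_linear_comp[OF bounded_linear_inner_left] \<open>open S\<close>) simp
  qed simp
  then have "Ck_on k S (\<lambda>x. DD (\<lambda>x. f (g x)) x h)" for h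
    by (rule Ck_on_cong[OF \<open>open S\<close>, rotated])
       (use d in \<open>simp add: DD_comp(1) DD_basis_expansion[of f, symmetric]\<close>)
  then show ?case using d DD_comp(2)[of f g] by auto
qed

text \<open>The derivative of 1/f is a product of the derivative of f with two factors 1/f, so the
  induction hypothesis for 1/f itself at order \<open>k\<close> gives order
  \<open>Suc k\<close>.\<close>

lemma Ck_on_inverse:
  fixes f :: "'a::euclidean_space \<Rightarrow> real"
  assumes "open S" "\<And>x. x \<in> S \<Longrightarrow> f x \<noteq> 0"
  shows "Ck_on k S f \<Longrightarrow> Ck_on k S (\<lambda>x. inverse (f x))"
proof (induction k)
  case 0
  then show ?case using assms by (auto intro!: continuous_on_inverse)
next
  case (Suc k)
  have *: "((\<lambda>x. inverse (f x)) has_derivative (\<lambda>h. - (inverse (f x) * DD f x h * inverse (f x)))) (at x)"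
    if "x \<in> S" for x
    using Suc.prems that by (intro Deriv.has_derivative_inverse DD_works) (auto simp: assms)
  note mult = Ck_on_bilinear[OF bounded_bilinear_mult \<open>open S\<close>]
  have "Ck_on k S (\<lambda>x. - (inverse (f x) * DD f x h * inverse (f x)))" for h
    using Suc.prems Ck_on_SucD[OF Suc.prems]
    by (intro Ck_on_linear_comp[OF bounded_linear_minus[OF bounded_linear_ident] \<open>open S\<close>] mult Suc.IH) auto
  then have "Ck_on k S (\<lambda>x. DD (\<lambda>x. inverse (f x)) x h)" for h
    by (rule Ck_on_cong[OF \<open>open S\<close>, rotated]) (use DD_I[OF *] in auto)
  then show ?case using * by (auto simp: differentiable_def)
qed


section \<open>Smooth functions and their calculus\<close>

lemma smooth_on_cong:
  "smooth_on S f \<Longrightarrow> open S \<Longrightarrow> (\<And>x. x \<in> S \<Longrightarrow> f x = g x) \<Longrightarrow> smooth_on S g"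
  unfolding smooth_on_def using Ck_on_cong by blast

lemma smooth_on_subset: "smooth_on S f \<Longrightarrow> T \<subseteq> S \<Longrightarrow> smooth_on T f"
  unfolding smooth_on_def using Ck_on_subset by blast

lemma smooth_on_local:
  assumes "\<And>x. x \<in> S \<Longrightarrow> \<exists>T. open T \<and> x \<in> T \<and> smooth_on T f"
  shows "smooth_on S f"
  using assms Ck_on_local unfolding smooth_on_def by metis

lemma smooth_on_local_eq:
  assumes "\<And>x. x \<in> S \<Longrightarrow> \<exists>T g. open T \<and> x \<in> T \<and> smooth_on T g \<and> (\<forall>y\<in>T. f y = g y)"
  shows "smooth_on S f"
proof (rule smooth_on_local)
  fix x assume "x \<in> S"
  then obtain T g where "open T" "x \<in> T" "smooth_on T g" "\<forall>y\<in>T. f y = g y" using assms by blast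
  then show "\<exists>T. open T \<and> x \<in> T \<and> smooth_on T f"
    by (intro exI[of _ T]) (auto intro: smooth_on_cong[of T g f])
qed

lemma smooth_on_const [simp]: "smooth_on S (\<lambda>x. c)"
  unfolding smooth_on_def using Ck_on_const by blast

lemma smooth_on_linear: "bounded_linear f \<Longrightarrow> smooth_on S f"
  unfolding smooth_on_def using Ck_on_linear by blast

lemma smooth_on_id [simp]: "smooth_on S (\<lambda>x. x)"
  by (rule smooth_on_linear[OF bounded_linear_ident])

lemma smooth_on_fst: "smooth_on S fst" and smooth_on_snd: "smooth_on S snd"
  by (auto intro!: smooth_on_linear bounded_linear_fst bounded_linear_snd)

lemma smooth_on_add: "open S \<Longrightarrow> smooth_on S f \<Longrightarrow> smooth_on S g \<Longrightarrow> smooth_on S (\<lambda>x. f x + g x)"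
  unfolding smooth_on_def using Ck_on_add by blast

lemma smooth_on_bilinear:
  "bounded_bilinear B \<Longrightarrow> open S \<Longrightarrow> smooth_on S f \<Longrightarrow> smooth_on S g \<Longrightarrow> smooth_on S (\<lambda>x. B (f x) (g x))"
  unfolding smooth_on_def using Ck_on_bilinear by blast

lemmas smooth_on_scaleR = smooth_on_bilinear[OF bounded_bilinear_scaleR]
lemmas smooth_on_mult = smooth_on_bilinear[OF bounded_bilinear_mult]
lemmas smooth_on_inner = smooth_on_bilinear[OF bounded_bilinear_inner]

lemma smooth_on_linear_comp:
  "bounded_linear B \<Longrightarrow> open S \<Longrightarrow> smooth_on S f \<Longrightarrow> smooth_on S (\<lambda>x. B (f x))"
  unfolding smooth_on_def using Ck_on_linear_comp by blast

lemmas smooth_on_minus = smooth_on_linear_comp[OF bounded_linear_minus[OF bounded_linear_ident]]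

lemma smooth_on_diff:
  "open S \<Longrightarrow> smooth_on S f \<Longrightarrow> smooth_on S g \<Longrightarrow> smooth_on S (\<lambda>x. f x - g x)"
  using smooth_on_add[of S f "\<lambda>x. - g x"] smooth_on_minus[of S g] by simp

lemma smooth_on_sum:
  "open S \<Longrightarrow> finite I \<Longrightarrow> (\<And>i. i \<in> I \<Longrightarrow> smooth_on S (f i)) \<Longrightarrow> smooth_on S (\<lambda>x. \<Sum>i\<in>I. f i x)"
  unfolding smooth_on_def by (simp add: Ck_on_sum)

lemma smooth_on_prod:
  fixes f :: "'i \<Rightarrow> 'a::euclidean_space \<Rightarrow> real"
  assumes "open S" "finite I" "\<And>i. i \<in> I \<Longrightarrow> smooth_on S (f i)"
  shows "smooth_on S (\<lambda>x. \<Prod>i\<in>I. f i x)"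
  using assms(2,3)
  by (induction I rule: finite_induct) (auto intro!: smooth_on_mult assms(1))

lemma smooth_on_inverse:
  fixes f :: "'a::euclidean_space \<Rightarrow> real"
  shows "open S \<Longrightarrow> (\<And>x. x \<in> S \<Longrightarrow> f x \<noteq> 0) \<Longrightarrow> smooth_on S f \<Longrightarrow> smooth_on S (\<lambda>x. inverse (f x))"
  unfolding smooth_on_def using Ck_on_inverse by blast

lemma smooth_on_divide:
  fixes f :: "'a::euclidean_space \<Rightarrow> real"
  shows "open S \<Longrightarrow> (\<And>x. x \<in> S \<Longrightarrow> g x \<noteq> 0) \<Longrightarrow> smooth_on S f \<Longrightarrow> smooth_on S g \<Longrightarrow>
    smooth_on S (\<lambda>x. f x / g x)"
  by (simp add: divide_inverse smooth_on_mult smooth_on_inverse)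

lemma smooth_on_comp:
  fixes g :: "'a::euclidean_space \<Rightarrow> 'b::euclidean_space"
  shows "open S \<Longrightarrow> open T \<Longrightarrow> (\<And>x. x \<in> S \<Longrightarrow> g x \<in> T) \<Longrightarrow> smooth_on T f \<Longrightarrow> smooth_on S g \<Longrightarrow>
    smooth_on S (\<lambda>x. f (g x))"
  unfolding smooth_on_def using Ck_on_comp by blast

lemma smooth_on_Pair:
  assumes "open S" "smooth_on S f" "smooth_on S g"
  shows "smooth_on S (\<lambda>x. (f x, g x))"
proof -
  have "smooth_on S (\<lambda>x. (f x, 0) + (0, g x))"
    using assms by (intro smooth_on_add smooth_on_linear_comp[of "\<lambda>x. (x, 0)"]
        smooth_on_linear_comp[of "\<lambda>x. (0, x)"] bounded_linear_Pair bounded_linear_ident bounded_linear_zero)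
  then show ?thesis by simp
qed

lemma smooth_on_vec:
  fixes f :: "'a::euclidean_space \<Rightarrow> real ^ 'n"
  assumes "open S" "\<And>i. smooth_on S (\<lambda>x. f x $ i)"
  shows "smooth_on S f"
proof -
  have "smooth_on S (\<lambda>x. \<Sum>i\<in>UNIV. (f x $ i) *\<^sub>R axis i (1::real))"
    using assms by (intro smooth_on_sum smooth_on_scaleR) auto
  moreover have "(\<Sum>i\<in>UNIV. (f x $ i) *\<^sub>R axis i 1) = f x" for x
    using basis_expansion[of "f x"] by (simp add: scalar_mult_eq_scaleR)
  ultimately show ?thesis by (simp only:)
qed

lemma smooth_on_vec_nth: "open S \<Longrightarrow> smooth_on S f \<Longrightarrow> smooth_on S (\<lambda>x. f x $ i)"
  by (rule smooth_on_linear_comp[OF bounded_linear_vec_nth])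

lemma smooth_on_differentiable: "smooth_on S f \<Longrightarrow> x \<in> S \<Longrightarrow> f differentiable (at x)"
  unfolding smooth_on_def using Ck_on.simps(2) by blast

lemma smooth_on_continuous: "smooth_on S f \<Longrightarrow> continuous_on S f"
  unfolding smooth_on_def using Ck_on.simps(1) by blast

lemma smooth_on_has_derivative: "smooth_on S f \<Longrightarrow> x \<in> S \<Longrightarrow> (f has_derivative DD f x) (at x)"
  by (simp add: DD_works smooth_on_differentiable)

lemma smooth_on_DD: "smooth_on S f \<Longrightarrow> smooth_on S (\<lambda>x. DD f x h)"
  unfolding smooth_on_def using Ck_on.simps(2) by blast

lemma linear_DD: "smooth_on S f \<Longrightarrow> x \<in> S \<Longrightarrow> linear (DD f x)"
  by (simp add: linear_frechet_derivative smooth_on_differentiable)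

text \<open>Basis expansion turns \<open>f x (h x)\<close> into finitely many products. This is
  needed for derivatives, \<open>g\<close>, \<open>C\<close> and \<Gamma>, which are a priori smooth
  for fixed vector arguments only.\<close>

lemma smooth_on_linear_family:
  fixes f :: "'a::euclidean_space \<Rightarrow> 'c::euclidean_space \<Rightarrow> 'b::real_normed_vector"
  assumes "open S" "\<And>x. x \<in> S \<Longrightarrow> linear (f x)" "\<And>h. smooth_on S (\<lambda>x. f x h)" "smooth_on S h"
  shows "smooth_on S (\<lambda>x. f x (h x))"
proof -
  have "smooth_on S (\<lambda>x. \<Sum>b\<in>Basis. (h x \<bullet> b) *\<^sub>R f x b)"
    using assms by (intro smooth_on_sum smooth_on_scaleR smooth_on_inner) auto
  moreover have "(\<Sum>b\<in>Basis. (h x \<bullet> b) *\<^sub>R f x b) = f x (h x)" if "x \<in> S" for x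
    using assms(2)[OF that]
    by (subst (2) euclidean_representation[of "h x", symmetric]) (simp add: linear_sum linear_cmul)
  ultimately show ?thesis using smooth_on_cong[OF _ assms(1)] by fastforce
qed

lemma smooth_on_DD_var:
  "open S \<Longrightarrow> smooth_on S f \<Longrightarrow> smooth_on S h \<Longrightarrow> smooth_on S (\<lambda>x. DD f x (h x))"
  by (rule smooth_on_linear_family) (auto intro: linear_DD smooth_on_DD)

text \<open>Product rule for evaluation, with the vector \<open>h x\<close> frozen in the first
  summand. Smoothness is asked for each fixed vector, so no norm on a space of linear maps
  enters.\<close>

lemma DD_linear_family:
  fixes f :: "'a::euclidean_space \<Rightarrow> 'c::euclidean_space \<Rightarrow> 'b::real_normed_vector"
  assumes "open S" "\<And>x. x \<in> S \<Longrightarrow> linear (f x)" "\<And>h. smooth_on S (\<lambda>x. f x h)" "smooth_on S h" "x \<in> S"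
  shows "DD (\<lambda>x. f x (h x)) x v = DD (\<lambda>y. f y (h x)) x v + f x (DD h x v)"
proof -
  have E: "f x u = (\<Sum>b\<in>Basis. (u \<bullet> b) *\<^sub>R f x b)" if "x \<in> S" for x u
    using assms(2)[OF that]
    by (subst euclidean_representation[of u, symmetric]) (simp add: linear_sum linear_cmul)
  have d: "((\<lambda>x. f x b) has_derivative DD (\<lambda>y. f y b) x) (at x)" for b
    using assms(3,5) smooth_on_has_derivative by blast
  have dh: "((\<lambda>x. h x) has_derivative DD h x) (at x)" using assms(4,5) smooth_on_has_derivative by blast
  have "DD (\<lambda>x. f x (h x)) x = DD (\<lambda>x. \<Sum>b\<in>Basis. (h x \<bullet> b) *\<^sub>R f x b) x"
    using E by (intro DD_cong[OF assms(1,5)]) simp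
  also have "\<dots> = (\<lambda>v. \<Sum>b\<in>Basis. (h x \<bullet> b) *\<^sub>R DD (\<lambda>y. f y b) x v + (DD h x v \<bullet> b) *\<^sub>R f x b)"
    by (rule DD_I, intro has_derivative_sum has_derivative_scaleR d) (rule has_derivative_inner_left[OF dh])
  finally have 1: "DD (\<lambda>x. f x (h x)) x v =
      (\<Sum>b\<in>Basis. (h x \<bullet> b) *\<^sub>R DD (\<lambda>y. f y b) x v + (DD h x v \<bullet> b) *\<^sub>R f x b)" by simp
  have "DD (\<lambda>y. f y (h x)) x = DD (\<lambda>y. \<Sum>b\<in>Basis. (h x \<bullet> b) *\<^sub>R f y b) x"
    using E by (intro DD_cong[OF assms(1,5)]) simp
  also have "\<dots> = (\<lambda>v. \<Sum>b\<in>Basis. (h x \<bullet> b) *\<^sub>R DD (\<lambda>y. f y b) x v)"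
    by (rule DD_I, intro has_derivative_sum has_derivative_scaleR_right d)
  finally have "DD (\<lambda>y. f y (h x)) x v = (\<Sum>b\<in>Basis. (h x \<bullet> b) *\<^sub>R DD (\<lambda>y. f y b) x v)" by simp
  then show ?thesis by (simp add: 1 sum.distrib E[OF assms(5), of "DD h x v"])
qed

lemma DD_Pair:
  assumes "f differentiable (at x)" "g differentiable (at x)"
  shows "DD (\<lambda>x. (f x, g x)) x h = (DD f x h, DD g x h)"
  using DD_I[OF has_derivative_Pair[OF DD_works[OF assms(1)] DD_works[OF assms(2)]]] by simp

lemma DD_comp_curve:
  fixes f :: "'a::real_normed_vector \<Rightarrow> 'b::real_normed_vector"
  assumes "f differentiable (at (g t))" "(g has_vector_derivative g') (at t)"
  shows "((\<lambda>t. f (g t)) has_vector_derivative DD f (g t) g') (at t)"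
proof -
  have "linear (DD f (g t))" using assms(1) linear_frechet_derivative by blast
  then show ?thesis
    using has_derivative_compose[OF assms(2)[unfolded has_vector_derivative_def] DD_works[OF assms(1)]]
    by (simp add: has_vector_derivative_def linear_cmul)
qed

lemma pair_has_vector_derivative:
  fixes s t :: real
  shows "((\<lambda>\<tau>. (\<tau>, s)) has_vector_derivative (1, 0)) (at t)"
    and "((\<lambda>\<sigma>. (t, \<sigma>)) has_vector_derivative (0, 1)) (at s)"
  by (auto intro!: derivative_eq_intros simp: has_vector_derivative_def)

lemma line_has_vector_derivative: "((\<lambda>t. x + t *\<^sub>R h) has_vector_derivative h) (at t)"
  by (auto intro!: derivative_eq_intros simp: has_vector_derivative_def)

lemma deriv_along_line:
  fixes f :: "'a::real_normed_vector \<Rightarrow> real"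
  assumes "f differentiable (at (x + t *\<^sub>R h))"
  shows "((\<lambda>t. f (x + t *\<^sub>R h)) has_real_derivative DD f (x + t *\<^sub>R h) h) (at t)"
  using DD_comp_curve[OF assms line_has_vector_derivative]
  by (simp add: has_real_derivative_iff_has_vector_derivative)

lemma deriv_line_0:
  fixes f :: "'a::real_normed_vector \<Rightarrow> real"
  assumes "f differentiable (at x)"
  shows "deriv (\<lambda>t. f (x + t *\<^sub>R h)) 0 = DD f x h"
  using deriv_along_line[of f x 0 h] assms by (simp add: DERIV_imp_deriv)

text \<open>Both second derivatives are limits of \<open>\<Delta>(h) / h\<^sup>2\<close>, where \<open>\<Delta>(h)\<close> is the second difference.\<close>

lemma second_difference_mvt:
  fixes f :: "'a::euclidean_space \<Rightarrow> real"
  assumes "smooth_on (ball x e) f" "0 < h" "h * (norm u + norm v) < e"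
  shows "\<exists>y. dist x y \<le> h * (norm u + norm v) \<and>
    f (x + h *\<^sub>R u + h *\<^sub>R v) - f (x + h *\<^sub>R u) - f (x + h *\<^sub>R v) + f x = h\<^sup>2 * DD (\<lambda>z. DD f z u) y v"
proof -
  have inb: "dist x (x + s *\<^sub>R u + t *\<^sub>R v) \<le> h * (norm u + norm v)" if "0 \<le> s" "s \<le> h" "0 \<le> t" "t \<le> h" for s t
  proof -
    have "dist x (x + s *\<^sub>R u + t *\<^sub>R v) = norm (s *\<^sub>R u + t *\<^sub>R v)"
      by (metis ab_semigroup_add_class.add_ac(1) dist_add_cancel dist_norm_class.dist_norm add.right_neutral norm_minus_cancel diff_0)
    also have "\<dots> \<le> s * norm u + t * norm v" using norm_triangle_ineq[of "s *\<^sub>R u" "t *\<^sub>R v"] that by simp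
    also have "\<dots> \<le> h * norm u + h * norm v" using that by (intro add_mono mult_right_mono) auto
    finally show ?thesis by (simp add: algebra_simps)
  qed
  then have inb': "x + s *\<^sub>R u + t *\<^sub>R v \<in> ball x e" if "0 \<le> s" "s \<le> h" "0 \<le> t" "t \<le> h" for s t
    using that assms(3) by (meson le_less_trans mem_ball)
  \<comment> \<open>The second difference is \<open>G h - G 0\<close>, where \<open>G s\<close> is
    the increment across the edge in direction \<open>v\<close>. The mean value theorem in
    \<open>s\<close>, and then in \<open>t\<close> for the function \<open>H\<close>, yields the
    intermediate point.\<close>
  define G where "G s = f (x + h *\<^sub>R v + s *\<^sub>R u) - f (x + s *\<^sub>R u)" for s
  have dG: "(G has_real_derivative (DD f (x + h *\<^sub>R v + s *\<^sub>R u) u - DD f (x + s *\<^sub>R u) u)) (at s)"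
    if "0 \<le> s" "s \<le> h" for s
    unfolding G_def
    using inb'[OF that, of 0] inb'[OF that, of h] \<open>0 < h\<close>
    by (intro DERIV_diff deriv_along_line smooth_on_differentiable[OF assms(1)])
       (auto simp: algebra_simps)
  obtain s where s: "0 < s" "s < h" "G h - G 0 = h * (DD f (x + h *\<^sub>R v + s *\<^sub>R u) u - DD f (x + s *\<^sub>R u) u)"
    using MVT2[OF \<open>0 < h\<close> dG] by auto
  define H where "H t = DD f (x + s *\<^sub>R u + t *\<^sub>R v) u" for t
  have dH: "(H has_real_derivative DD (\<lambda>z. DD f z u) (x + s *\<^sub>R u + t *\<^sub>R v) v) (at t)"
    if "0 \<le> t" "t \<le> h" for t
    unfolding H_def
    using inb'[of s, OF _ _ that] s
    by (intro deriv_along_line smooth_on_differentiable[OF smooth_on_DD[OF assms(1)]]) auto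
  obtain t where t: "0 < t" "t < h" "H h - H 0 = h * DD (\<lambda>z. DD f z u) (x + s *\<^sub>R u + t *\<^sub>R v) v"
    using MVT2[OF \<open>0 < h\<close> dH] by auto
  have "G h - G 0 = h * (H h - H 0)" by (simp add: s(3) H_def algebra_simps)
  then have "G h - G 0 = h\<^sup>2 * DD (\<lambda>z. DD f z u) (x + s *\<^sub>R u + t *\<^sub>R v) v"
    by (simp add: t(3) power2_eq_square)
  then show ?thesis
    using inb[of s t] s t
    by (intro exI[of _ "x + s *\<^sub>R u + t *\<^sub>R v"]) (auto simp: G_def algebra_simps)
qed

text \<open>The second difference is symmetric in \<open>u\<close> and \<open>v\<close>, so its two
  mean value forms give points \<open>y n\<close> and \<open>z n\<close> tending to \<open>x\<close>
  with \<open>P (y n) = Q (z n)\<close>; continuity carries the equality to the limit.\<close>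

lemma DD_symmetric_real:
  fixes f :: "'a::euclidean_space \<Rightarrow> real"
  assumes "open S" "x \<in> S" "smooth_on S f"
  shows "DD (\<lambda>z. DD f z u) x v = DD (\<lambda>z. DD f z v) x u"
proof -
  define P where "P = (\<lambda>y. DD (\<lambda>z. DD f z u) y v)"
  define Q where "Q = (\<lambda>y. DD (\<lambda>z. DD f z v) y u)"
  obtain e where e: "e > 0" "ball x e \<subseteq> S" using assms open_contains_ball by blast
  have sm: "smooth_on (ball x e) f" using assms(3) e(2) smooth_on_subset by blast
  have cont: "isCont P x" "isCont Q x"
    unfolding P_def Q_def
    using smooth_on_continuous[OF smooth_on_DD[OF smooth_on_DD[OF assms(3)]]]
      assms(1,2) continuous_on_eq_continuous_at by blast+
  \<comment> \<open>Step sizes tending to 0 with \<open>h n * (norm u + norm v) < e\<close>, so that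
    all parallelograms stay in the ball. The \<open>+ 1\<close> keeps the denominator positive when
    \<open>u\<close> and \<open>v\<close> vanish.\<close>
  define h where "h n = e / (2 * (norm u + norm v + 1)) / real (Suc n)" for n
  define c where "c = norm u + norm v"
  have c: "0 \<le> c" "0 < c + 1" by (auto simp: c_def add_nonneg_nonneg intro: add_nonneg_pos)
  have h: "h n = (e / (2 * (c + 1))) / real (Suc n)" for n by (simp add: h_def c_def)
  have h0: "h n > 0" for n using e c by (simp add: h)
  have hc: "h n * c < e" for n
  proof -
    have "e * c < e * (2 * (c + 1) * real (Suc n))"
    proof (rule mult_strict_left_mono[OF _ e(1)])
      define X where "X = (c + 1) * real (Suc n)"
      have "(c + 1) * 1 \<le> X" unfolding X_def using c by (intro mult_left_mono) auto
      then have "c < 2 * X" using c(1) by simp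
      then show "c < 2 * (c + 1) * real (Suc n)" by (simp only: X_def mult.assoc)
    qed
    then show ?thesis using c by (simp add: h divide_simps)
  qed
  have hlim: "h \<longlonglongrightarrow> 0"
    unfolding h using LIMSEQ_Suc[OF lim_const_over_n[of "e / (2 * (c + 1))"]] by simp
  have "\<exists>y z. dist x y \<le> h n * c \<and> dist x z \<le> h n * c \<and> P y = Q z" for n
  proof -
    obtain y where y: "dist x y \<le> h n * c"
      "f (x + h n *\<^sub>R u + h n *\<^sub>R v) - f (x + h n *\<^sub>R u) - f (x + h n *\<^sub>R v) + f x = (h n)\<^sup>2 * P y"
      using second_difference_mvt[OF sm h0, of n u v] hc unfolding P_def c_def by metis
    obtain z where z: "dist x z \<le> h n * c"
      "f (x + h n *\<^sub>R v + h n *\<^sub>R u) - f (x + h n *\<^sub>R v) - f (x + h n *\<^sub>R u) + f x = (h n)\<^sup>2 * Q z"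
      using second_difference_mvt[OF sm h0, of n v u] hc unfolding Q_def c_def by (metis add.commute)
    have "(h n)\<^sup>2 * P y = (h n)\<^sup>2 * Q z"
      using y(2) z(2) by (simp add: algebra_simps)
    then have "P y = Q z" using h0[of n] by simp
    then show ?thesis using y(1) z(1) by blast
  qed
  then obtain y z where yz: "\<And>n. dist x (y n) \<le> h n * c" "\<And>n. dist x (z n) \<le> h n * c" "\<And>n. P (y n) = Q (z n)"
    by metis
  have lim0: "(\<lambda>n. h n * c) \<longlonglongrightarrow> 0" using tendsto_mult_left_zero[OF hlim] by blast
  have "y \<longlonglongrightarrow> x" "z \<longlonglongrightarrow> x"
    by (auto intro!: metric_tendsto_imp_tendsto[OF lim0] always_eventually yz
        simp: dist_commute[of _ x] yz order_trans[OF yz(1) abs_ge_self] order_trans[OF yz(2) abs_ge_self])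
  then have "(\<lambda>n. P (y n)) \<longlonglongrightarrow> P x" "(\<lambda>n. Q (z n)) \<longlonglongrightarrow> Q x"
    using cont isCont_tendsto_compose by blast+
  then have "P x = Q x" using yz(3) LIMSEQ_unique by auto
  then show ?thesis by (simp add: P_def Q_def)
qed

lemma DD_inner:
  assumes "f differentiable (at x)" shows "DD (\<lambda>z. f z \<bullet> b) x v = DD f x v \<bullet> b"
  using DD_I[OF has_derivative_inner_left[OF DD_works[OF assms]]] by simp

lemma DD_symmetric:
  fixes f :: "'a::euclidean_space \<Rightarrow> 'b::euclidean_space"
  assumes "open S" "x \<in> S" "smooth_on S f"
  shows "DD (\<lambda>z. DD f z u) x v = DD (\<lambda>z. DD f z v) x u"
proof (rule euclidean_eqI)
  fix b :: 'b assume "b \<in> Basis"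
  have sm: "smooth_on S (\<lambda>z. f z \<bullet> b)" using assms by (intro smooth_on_inner) auto
  have *: "DD (\<lambda>z. DD f z u) x v \<bullet> b = DD (\<lambda>z. DD (\<lambda>z. f z \<bullet> b) z u) x v" for u v
  proof -
    have "DD (\<lambda>z. DD f z u) x v \<bullet> b = DD (\<lambda>z. DD f z u \<bullet> b) x v"
      using DD_inner smooth_on_differentiable[OF smooth_on_DD[OF assms(3)] assms(2)] by metis
    also have "DD (\<lambda>z. DD f z u \<bullet> b) x = DD (\<lambda>z. DD (\<lambda>z. f z \<bullet> b) z u) x"
      using smooth_on_differentiable[OF assms(3)]
      by (intro DD_cong[OF assms(1,2)]) (simp add: DD_inner)
    finally show ?thesis .
  qed
  show "DD (\<lambda>z. DD f z u) x v \<bullet> b = DD (\<lambda>z. DD f z v) x u \<bullet> b"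
    unfolding * by (rule DD_symmetric_real[OF assms(1,2) sm])
qed

text \<open>This is how \<open>g\<close> and \<Gamma> occur along fields and along two parameter
  maps: the base point and both arguments move with the parameter.\<close>

lemma smooth_on_bilinear_family:
  fixes F :: "'z::euclidean_space \<Rightarrow> 'c::euclidean_space \<Rightarrow> 'd::euclidean_space \<Rightarrow> 'b::real_normed_vector"
    and f :: "'a::euclidean_space \<Rightarrow> 'z"
  assumes "open Z" "\<And>z w. z \<in> Z \<Longrightarrow> linear (\<lambda>u. F z u w)" "\<And>z u. z \<in> Z \<Longrightarrow> linear (F z u)"
    "\<And>u w. smooth_on Z (\<lambda>z. F z u w)"
    and "open S" "\<And>x. x \<in> S \<Longrightarrow> f x \<in> Z" "smooth_on S f" "smooth_on S u" "smooth_on S v"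
  shows "smooth_on S (\<lambda>x. F (f x) (u x) (v x))"
proof (rule smooth_on_linear_family[OF assms(5) _ _ assms(9)])
  show "linear (F (f x) (u x))" if "x \<in> S" for x using assms(3,6) that by blast
  show "smooth_on S (\<lambda>x. F (f x) (u x) h)" for h
  proof (rule smooth_on_linear_family[OF assms(5) _ _ assms(8)])
    show "linear (\<lambda>u. F (f x) u h)" if "x \<in> S" for x using assms(2,6) that by blast
    show "smooth_on S (\<lambda>x. F (f x) k h)" for k
      by (rule smooth_on_comp[OF assms(5,1,6,4,7)])
  qed
qed

text \<open>Product rule in three terms: the base point moves with frozen arguments, then each
  argument moves. The first summand is the source of the curvature terms in which the symbols
  themselves are differentiated.\<close>

lemma DD_bilinear_family:
  fixes F :: "'z::euclidean_space \<Rightarrow> 'c::euclidean_space \<Rightarrow> 'd::euclidean_space \<Rightarrow> 'b::real_normed_vector"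
    and f :: "'a::euclidean_space \<Rightarrow> 'z"
  assumes "open Z" "\<And>z w. z \<in> Z \<Longrightarrow> linear (\<lambda>u. F z u w)" "\<And>z u. z \<in> Z \<Longrightarrow> linear (F z u)"
    "\<And>u w. smooth_on Z (\<lambda>z. F z u w)"
    and "open S" "\<And>x. x \<in> S \<Longrightarrow> f x \<in> Z" "smooth_on S f" "smooth_on S u" "smooth_on S v" "x \<in> S"
  shows "DD (\<lambda>x. F (f x) (u x) (v x)) x h = DD (\<lambda>z. F z (u x) (v x)) (f x) (DD f x h)
    + F (f x) (DD u x h) (v x) + F (f x) (u x) (DD v x h)"
proof -
  have sm: "smooth_on S (\<lambda>x. F (f x) (u' x) (v' x))" if "smooth_on S u'" "smooth_on S v'" for u' v'
    by (rule smooth_on_bilinear_family[OF assms(1) _ _ assms(4,5) _ assms(7) that]) (use assms(2,3,6) in blast)+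
  have "DD (\<lambda>x. F (f x) (u x) (v x)) x h = DD (\<lambda>y. F (f y) (u y) (v x)) x h + F (f x) (u x) (DD v x h)"
    by (rule DD_linear_family[OF assms(5) _ sm[OF assms(8) smooth_on_const] assms(9,10)])
      (use assms(3,6) in blast)
  also have "DD (\<lambda>y. F (f y) (u y) (v x)) x h = DD (\<lambda>y. F (f y) (u x) (v x)) x h + F (f x) (DD u x h) (v x)"
    by (rule DD_linear_family[where f = "\<lambda>y w. F (f y) w (v x)", OF assms(5) _ sm[OF smooth_on_const smooth_on_const] assms(8,10)])
      (use assms(2,6) in blast)
  also have "DD (\<lambda>y. F (f y) (u x) (v x)) x h = DD (\<lambda>z. F z (u x) (v x)) (f x) (DD f x h)"
    by (rule DD_comp(1)[of "\<lambda>z. F z (u x) (v x)" f, OF smooth_on_differentiable[OF assms(4) assms(6)[OF assms(10)]]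
          smooth_on_differentiable[OF assms(7,10)]])
  finally show ?thesis by simp
qed

section \<open>Bump functions\<close>

text \<open>For \<open>p = 1\<close> this is the usual function exp(-1/x), flat at 0. The factor
  p(1/x) makes the family closed under differentiation, so that smoothness becomes a single
  induction.\<close>

definition flat :: "real poly \<Rightarrow> real \<Rightarrow> real" where
  "flat p x = (if x > 0 then poly p (1 / x) * exp (- 1 / x) else 0)"

lemma poly_times_exp_tendsto_0: "((\<lambda>y. poly p y * exp (- y)) \<longlongrightarrow> (0::real)) at_top"
proof -
  have "((\<lambda>y. \<Sum>i\<le>degree p. coeff p i * (y ^ i / exp y)) \<longlongrightarrow> (\<Sum>i\<le>degree p. coeff p i * 0)) at_top"
    by (intro tendsto_sum tendsto_mult tendsto_const tendsto_power_div_exp_0)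
  moreover have "(\<Sum>i\<le>degree p. coeff p i * (y ^ i / exp y)) = poly p y * exp (- y)" for y
    by (simp add: poly_altdef sum_distrib_right exp_minus divide_inverse mult.assoc)
  ultimately show ?thesis by simp
qed

lemma flat_tendsto_0: "(flat p \<longlongrightarrow> 0) (at 0)"
proof -
  have "((\<lambda>x. poly p (1 / x) * exp (- (1 / x))) \<longlongrightarrow> 0) (at_right 0)"
    using filterlim_compose[OF poly_times_exp_tendsto_0 filterlim_inverse_at_top_right]
    by (simp add: inverse_eq_divide)
  then have "(flat p \<longlongrightarrow> 0) (at_right 0)"
    by (rule Lim_transform_eventually) (auto simp: flat_def eventually_at_filter)
  moreover have "(flat p \<longlongrightarrow> 0) (at_left 0)"
    by (rule tendsto_eventually) (auto simp: flat_def eventually_at_filter)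
  ultimately show ?thesis by (simp add: filterlim_split_at)
qed

text \<open>With y = 1/x one has dy/dx = -y^2, so p(y) exp(-y) has derivative y^2 (p - p')(y)
  exp(-y); \<open>[:0, 0, 1:]\<close> is the polynomial y^2.\<close>

lemma flat_has_derivative:
  "(flat p has_real_derivative flat ([:0, 0, 1:] * (p - pderiv p)) x) (at x)"
proof -
  consider "x > 0" | "x < 0" | "x = 0" by linarith
  then show ?thesis
  proof cases
    case 1
    have "((\<lambda>x. poly p (1 / x) * exp (- 1 / x)) has_real_derivative
        flat ([:0, 0, 1:] * (p - pderiv p)) x) (at x)"
      using 1 by (auto intro!: derivative_eq_intros DERIV_chain2[OF poly_DERIV]
          simp: flat_def field_simps power2_eq_square)
    then show ?thesis
      by (rule DERIV_cong_ev[OF refl _ refl, THEN iffD1, rotated])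
        (use 1 in \<open>auto simp: flat_def intro!: eventually_mono[OF eventually_gt_at_top] 
            exI[of _ "{0<..}"] simp: eventually_nhds\<close>)
  next
    case 2
    have "((\<lambda>x. 0) has_real_derivative flat ([:0, 0, 1:] * (p - pderiv p)) x) (at x)"
      using 2 by (auto simp: flat_def)
    then show ?thesis
      by (rule DERIV_cong_ev[OF refl _ refl, THEN iffD1, rotated])
        (use 2 in \<open>auto simp: flat_def intro!: exI[of _ "{..<0}"] simp: eventually_nhds\<close>)
  next
    case 3
    \<comment> \<open>The difference quotient at 0 is \<open>flat (pCons 0 p)\<close>: dividing by h
      multiplies the polynomial in 1/h by its variable.\<close>
    have "((\<lambda>h. (flat p (0 + h) - flat p 0) / h) \<longlongrightarrow> 0) (at 0)"
      by (rule Lim_transform_eventually[OF flat_tendsto_0[of "pCons 0 p"]])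
        (auto simp: flat_def eventually_at_filter)
    then show ?thesis using 3 by (simp add: DERIV_def flat_def)
  qed
qed

lemma smooth_on_flat: "smooth_on S (flat p)"
proof -
  have "Ck_on k UNIV (flat p)" for k
  proof (induction k arbitrary: p)
    case 0
    then show ?case
      using flat_has_derivative by (auto intro!: continuous_at_imp_continuous_on DERIV_isCont)
  next
    case (Suc k)
    define q where "q = [:0, 0, 1:] * (p - pderiv p)"
    have d: "(flat p has_derivative (\<lambda>h. flat q x * h)) (at x)" for x
      using flat_has_derivative[of p x] by (simp add: has_field_derivative_def q_def)
    have "DD (flat p) x h = h * flat q x" for x h
      using DD_I[OF d[of x]] by (simp add: mult.commute)
    moreover have "Ck_on k UNIV (\<lambda>x. h * flat q x)" for h
      by (rule Ck_on_linear_comp[OF bounded_linear_mult_right open_UNIV Suc.IH])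
    moreover have "flat p differentiable (at x)" for x
      using d differentiable_def by blast
    ultimately show ?case by simp
  qed
  then show ?thesis by (auto simp: smooth_on_def intro: Ck_on_subset)
qed

definition psi :: "real \<Rightarrow> real" where "psi = flat 1"

lemma psi_pos: "x > 0 \<Longrightarrow> psi x > 0" and psi_zero: "x \<le> 0 \<Longrightarrow> psi x = 0" and psi_nonneg: "psi x \<ge> 0"
  by (auto simp: psi_def flat_def)

lemma smooth_on_psi_comp: "open S \<Longrightarrow> smooth_on S f \<Longrightarrow> smooth_on S (\<lambda>x. psi (f x))"
  using smooth_on_comp[of S UNIV f psi] smooth_on_flat by (simp add: psi_def)

lemma ex_smooth_bump:
  fixes x0 :: "'a::euclidean_space"
  assumes "r > 0"
  shows "\<exists>\<beta> :: 'a \<Rightarrow> real. smooth_on UNIV \<beta> \<and> \<beta> x0 = 1 \<and> (\<forall>x. x \<notin> cball x0 r \<longrightarrow> \<beta> x = 0)"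
proof (intro exI conjI allI impI)
  let ?\<beta> = "\<lambda>x. psi (r\<^sup>2 - (x - x0) \<bullet> (x - x0)) * (1 / psi (r\<^sup>2))"
  show "smooth_on UNIV ?\<beta>"
    by (intro smooth_on_mult smooth_on_psi_comp smooth_on_diff smooth_on_inner) auto
  show "?\<beta> x0 = 1" using assms psi_pos[of "r\<^sup>2"] by simp
  show "?\<beta> x = 0" if "x \<notin> cball x0 r" for x
  proof -
    have "r < norm (x - x0)" using that by (simp add: dist_norm norm_minus_commute)
    then have "r\<^sup>2 < (norm (x - x0))\<^sup>2" using assms by (intro power_strict_mono) auto
    then show ?thesis by (simp add: psi_zero dot_square_norm)
  qed
qed

text \<open>Since t1 < t2, at every t one of t - t1 and t2 - t is positive, so the denominator never
  vanishes. The function supplies the weights for gluing variations.\<close>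

lemma ex_smooth_step:
  fixes t1 t2 :: real
  assumes "t1 < t2"
  shows "\<exists>\<sigma> :: real \<Rightarrow> real. smooth_on UNIV \<sigma> \<and> (\<forall>t\<le>t1. \<sigma> t = 0) \<and> (\<forall>t\<ge>t2. \<sigma> t = 1)"
proof (intro exI conjI allI impI)
  let ?\<sigma> = "\<lambda>t. psi (t - t1) / (psi (t - t1) + psi (t2 - t))"
  have pos: "psi (t - t1) + psi (t2 - t) > 0" for t
  proof (cases "t > t1")
    case True
    then show ?thesis using psi_pos[of "t - t1"] psi_nonneg[of "t2 - t"] by (intro add_pos_nonneg) auto
  next
    case False
    then show ?thesis using assms psi_pos[of "t2 - t"] psi_nonneg[of "t - t1"] by (intro add_nonneg_pos) auto
  qed
  then show "smooth_on UNIV ?\<sigma>"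
    by (intro smooth_on_divide smooth_on_add smooth_on_psi_comp smooth_on_diff) (auto simp: less_imp_neq[symmetric])
  show "?\<sigma> t = 0" if "t \<le> t1" for t using that by (simp add: psi_zero)
  show "?\<sigma> t = 1" if "t \<ge> t2" for t using that pos[of t] by (simp add: psi_zero)
qed

section \<open>Charts and tangent vectors\<close>

text \<open>Charts are pairs; the simplifier would otherwise split quantified charts into domain and
  map, and facts stated with \<open>cdom c\<close> and \<open>cmap c\<close> would no longer
  match.\<close>

declare split_paired_All [simp del] split_paired_Ex [simp del]

locale smooth_mfd =
  fixes M :: "('m::{t2_space,second_countable_topology}, 'n::finite) chart set"
  assumes mfd: "smooth_manifold M"
begin

abbreviation cim :: "('m, 'n) chart \<Rightarrow> (real ^ 'n) set" where "cim c \<equiv> cmap c ` cdom c"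

abbreviation tr :: "('m, 'n) chart \<Rightarrow> ('m, 'n) chart \<Rightarrow> real ^ 'n \<Rightarrow> real ^ 'n" where
  "tr c d \<equiv> cmap d \<circ> cinv c"

definition dtr :: "('m, 'n) chart \<Rightarrow> ('m, 'n) chart \<Rightarrow> 'm \<Rightarrow> real ^ 'n \<Rightarrow> real ^ 'n" where
  "dtr c d p = DD (tr c d) (cmap c p)"

abbreviation TS :: "'m \<Rightarrow> ('m, 'n) tvec set" where "TS p \<equiv> tangent_space M p"

definition rep :: "('m, 'n) chart \<Rightarrow> ('m \<Rightarrow> ('m, 'n) tvec) \<Rightarrow> real ^ 'n \<Rightarrow> real ^ 'n" where
  "rep c X x = X (cinv c x) c"

lemma ex_chart: "\<exists>c\<in>M. p \<in> cdom c"
  using mfd unfolding smooth_manifold_def by blast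

lemma open_cdom: "c \<in> M \<Longrightarrow> open (cdom c)" and open_cim: "c \<in> M \<Longrightarrow> open (cim c)"
  and homeo: "c \<in> M \<Longrightarrow> homeomorphism (cdom c) (cim c) (cmap c) (cinv c)"
  using mfd unfolding smooth_manifold_def by auto

lemma cinv_cmap: "c \<in> M \<Longrightarrow> p \<in> cdom c \<Longrightarrow> cinv c (cmap c p) = p"
  using homeo homeomorphism_apply1 by blast

lemma cmap_cinv: "c \<in> M \<Longrightarrow> x \<in> cim c \<Longrightarrow> cmap c (cinv c x) = x"
  using homeo homeomorphism_apply2 by blast

lemma cinv_cdom: "c \<in> M \<Longrightarrow> x \<in> cim c \<Longrightarrow> cinv c x \<in> cdom c"
  by (auto simp: cinv_cmap)

lemma cinv_mem: "c \<in> M \<Longrightarrow> x \<in> cmap c ` (\<Omega> \<inter> cdom c) \<Longrightarrow> cinv c x \<in> \<Omega> \<inter> cdom c"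
  by (auto simp: cinv_cmap)

lemma continuous_on_cmap: "c \<in> M \<Longrightarrow> continuous_on (cdom c) (cmap c)"
  and continuous_on_cinv: "c \<in> M \<Longrightarrow> continuous_on (cim c) (cinv c)"
  using homeo unfolding homeomorphism_def by auto

lemma open_cmap_image:
  assumes "c \<in> M" "open U" shows "open (cmap c ` (U \<inter> cdom c))"
proof -
  have "cmap c ` (U \<inter> cdom c) = cim c \<inter> cinv c -` U"
    using assms(1) by (auto simp: cinv_cmap)
  then show ?thesis
    using continuous_on_open_vimage[OF open_cim, of c "cinv c"] continuous_on_cinv assms
    by (metis Int_commute)
qed

lemma open_tr_dom: "c \<in> M \<Longrightarrow> d \<in> M \<Longrightarrow> open (cmap c ` (cdom c \<inter> cdom d))"
  using open_cmap_image[of c "cdom d"] open_cdom by (simp add: Int_commute)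

lemma smooth_on_tr: "c \<in> M \<Longrightarrow> d \<in> M \<Longrightarrow> smooth_on (cmap c ` (cdom c \<inter> cdom d)) (tr c d)"
  using mfd unfolding smooth_manifold_def by blast

lemma tr_differentiable:
  "c \<in> M \<Longrightarrow> d \<in> M \<Longrightarrow> p \<in> cdom c \<Longrightarrow> p \<in> cdom d \<Longrightarrow> tr c d differentiable (at (cmap c p))"
  by (rule smooth_on_differentiable[OF smooth_on_tr]) auto

lemma tr_cmap: "c \<in> M \<Longrightarrow> p \<in> cdom c \<Longrightarrow> tr c d (cmap c p) = cmap d p"
  by (simp add: cinv_cmap)

lemma linear_dtr: "c \<in> M \<Longrightarrow> d \<in> M \<Longrightarrow> p \<in> cdom c \<Longrightarrow> p \<in> cdom d \<Longrightarrow> linear (dtr c d p)"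
  unfolding dtr_def by (rule linear_frechet_derivative[OF tr_differentiable])

text \<open>Cocycle identity, from the chain rule for coordinate changes. It makes
  \<open>coord_vec\<close> a tangent vector and, with \<open>dtr_id\<close>, makes
  \<open>dtr d c p\<close> inverse to \<open>dtr c d p\<close>.\<close>

lemma dtr_comp:
  assumes "c \<in> M" "d \<in> M" "e \<in> M" "p \<in> cdom c" "p \<in> cdom d" "p \<in> cdom e"
  shows "dtr d e p (dtr c d p y) = dtr c e p y"
proof -
  let ?O = "cmap c ` ((cdom d \<inter> cdom e) \<inter> cdom c)"
  have E: "tr c d (cmap c p) = cmap d p" by (rule tr_cmap[OF assms(1,4)])
  have 1: "DD (tr c e) (cmap c p) = DD (\<lambda>x. tr d e (tr c d x)) (cmap c p)"
  proof (rule DD_cong)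
    show "open ?O" using assms by (intro open_cmap_image open_Int open_cdom)
    show "tr c e x = tr d e (tr c d x)" if "x \<in> ?O" for x
      using that assms by (auto simp: cinv_cmap)
  qed (use assms in auto)
  have 2: "DD (\<lambda>x. tr d e (tr c d x)) (cmap c p) y = DD (tr d e) (tr c d (cmap c p)) (DD (tr c d) (cmap c p) y)"
    by (rule DD_comp(1)) (unfold E, rule tr_differentiable[OF assms(2,3,5,6)], rule tr_differentiable[OF assms(1,2,4,5)])
  show ?thesis using trans[OF fun_cong[OF 1] 2] unfolding dtr_def E by (rule sym)
qed

lemma dtr_id:
  assumes "c \<in> M" "p \<in> cdom c" shows "dtr c c p y = y"
proof -
  have "DD (tr c c) (cmap c p) = DD (\<lambda>x. x) (cmap c p)"
    using assms by (intro DD_cong[OF open_cim[OF assms(1)]]) (auto simp: cinv_cmap)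
  then show ?thesis by (simp add: dtr_def)
qed

lemma at_chart_apply: "at_chart M p F c = (if c \<in> M \<and> p \<in> cdom c then F c else 0)"
  by (simp add: at_chart_def)

lemma coord_vec_apply: "coord_vec M c p y d = (if d \<in> M \<and> p \<in> cdom d then dtr c d p y else 0)"
  by (simp add: coord_vec_def at_chart_def dtr_def)

lemma coord_vec_same: "c \<in> M \<Longrightarrow> p \<in> cdom c \<Longrightarrow> coord_vec M c p y c = y"
  by (simp add: coord_vec_apply dtr_id)

lemma tangent_space_iff:
  "v \<in> TS p \<longleftrightarrow> (\<forall>c\<in>M. \<forall>d\<in>M. p \<in> cdom c \<inter> cdom d \<longrightarrow> v d = dtr c d p (v c)) \<and>
     (\<forall>c. \<not> (c \<in> M \<and> p \<in> cdom c) \<longrightarrow> v c = 0)"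
  by (simp add: tangent_space_def dtr_def)

lemma tangent_dtr:
  assumes "v \<in> TS p" "c \<in> M" "d \<in> M" "p \<in> cdom c" "p \<in> cdom d"
  shows "v d = dtr c d p (v c)"
  using bspec[OF bspec[OF conjunct1[OF assms(1)[unfolded tangent_space_iff]] assms(2)] assms(3)]
  by (rule mp) (rule IntI[OF assms(4,5)])

lemma tangent_spaceI:
  assumes "\<And>c d. c \<in> M \<Longrightarrow> d \<in> M \<Longrightarrow> p \<in> cdom c \<Longrightarrow> p \<in> cdom d \<Longrightarrow> v d = dtr c d p (v c)"
    and "\<And>c. \<not> (c \<in> M \<and> p \<in> cdom c) \<Longrightarrow> v c = 0"
  shows "v \<in> TS p"
  unfolding tangent_space_iff
  by (intro conjI ballI allI impI) (erule IntE, rule assms(1), assumption+, rule assms(2))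

lemma tangent_out: "v \<in> TS p \<Longrightarrow> \<not> (c \<in> M \<and> p \<in> cdom c) \<Longrightarrow> v c = 0"
  unfolding tangent_space_iff by (drule conjunct2, drule spec, erule mp)

lemma coord_vec_tangent:
  assumes "c \<in> M" "p \<in> cdom c" shows "coord_vec M c p y \<in> TS p"
  by (rule tangent_spaceI) (use assms in \<open>auto simp: coord_vec_apply dtr_comp\<close>)

lemma coord_vec_self:
  assumes "v \<in> TS p" "c \<in> M" "p \<in> cdom c" shows "coord_vec M c p (v c) = v"
proof
  show "coord_vec M c p (v c) d = v d" for d
    using tangent_dtr[OF assms(1,2) _ assms(3), of d] tangent_out[OF assms(1), of d]
    by (auto simp: coord_vec_apply)
qed

lemma tangent_eqI: "v \<in> TS p \<Longrightarrow> w \<in> TS p \<Longrightarrow> c \<in> M \<Longrightarrow> p \<in> cdom c \<Longrightarrow> v c = w c \<Longrightarrow> v = w"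
  by (metis coord_vec_self)

text \<open>Brackets, covariant derivatives and velocities are given by one formula per chart. The
  transformation law out of a single chart is what turns such a family into a tangent
  vector.\<close>

lemma at_chart_tangentI:
  assumes "c \<in> M" "p \<in> cdom c" "\<And>d. d \<in> M \<Longrightarrow> p \<in> cdom d \<Longrightarrow> F d = dtr c d p (F c)"
  shows "at_chart M p F = coord_vec M c p (F c)"
proof
  fix d
  show "at_chart M p F d = coord_vec M c p (F c) d"
    unfolding at_chart_apply coord_vec_apply by (rule if_cong[OF refl _ refl]) (rule assms(3); simp)
qed

lemma tangent_add:
  assumes "v \<in> TS p" "w \<in> TS p" shows "v + w \<in> TS p"
proof (rule tangent_spaceI)
  fix c d assume cd: "c \<in> M" "d \<in> M" "p \<in> cdom c" "p \<in> cdom d"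
  show "(v + w) d = dtr c d p ((v + w) c)"
    unfolding plus_fun_apply linear_add[OF linear_dtr[OF cd]]
    by (rule arg_cong2[of _ _ _ _ plus, OF tangent_dtr[OF assms(1) cd] tangent_dtr[OF assms(2) cd]])
next
  fix c assume "\<not> (c \<in> M \<and> p \<in> cdom c)"
  then show "(v + w) c = 0"
    using tangent_out[OF assms(1)] tangent_out[OF assms(2)] by simp
qed

lemma tangent_scaleR:
  assumes "v \<in> TS p" shows "r *\<^sub>R v \<in> TS p"
proof (rule tangent_spaceI)
  fix c d assume cd: "c \<in> M" "d \<in> M" "p \<in> cdom c" "p \<in> cdom d"
  show "(r *\<^sub>R v) d = dtr c d p ((r *\<^sub>R v) c)"
    unfolding scaleR_fun_apply linear_cmul[OF linear_dtr[OF cd]]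
    by (rule arg_cong[of _ _ "scaleR r", OF tangent_dtr[OF assms(1) cd]])
next
  fix c assume "\<not> (c \<in> M \<and> p \<in> cdom c)"
  then show "(r *\<^sub>R v) c = 0" using tangent_out[OF assms(1)] by simp
qed

lemma tangent_diff: "v \<in> TS p \<Longrightarrow> w \<in> TS p \<Longrightarrow> v - w \<in> TS p"
  using tangent_add[of v p "(-1) *\<^sub>R w"] tangent_scaleR[of w p "-1"] by simp

lemma tangent_zero: "0 \<in> TS p"
proof (rule tangent_spaceI)
  show "0 d = dtr c d p (0 c)" if "c \<in> M" "d \<in> M" "p \<in> cdom c" "p \<in> cdom d" for c d
    using linear_0[OF linear_dtr[OF that]] by simp
qed simp

lemma tangent_sum: "(\<And>i. i \<in> I \<Longrightarrow> v i \<in> TS p) \<Longrightarrow> (\<Sum>i\<in>I. v i) \<in> TS p"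
  by (induction I rule: infinite_finite_induct) (auto intro: tangent_add tangent_zero)

subsection \<open>Vector fields\<close>

lemma smooth_field_tangent: "smooth_field M \<Omega> X \<Longrightarrow> p \<in> \<Omega> \<Longrightarrow> X p \<in> TS p"
  by (simp add: smooth_field_def)

lemma smooth_on_rep: "smooth_field M \<Omega> X \<Longrightarrow> c \<in> M \<Longrightarrow> smooth_on (cmap c ` (\<Omega> \<inter> cdom c)) (rep c X)"
  by (simp add: smooth_field_def rep_def[abs_def])

lemma rep_cmap: "c \<in> M \<Longrightarrow> p \<in> cdom c \<Longrightarrow> rep c X (cmap c p) = X p c"
  by (simp add: rep_def cinv_cmap)

lemma smooth_fieldI:
  "(\<And>p. p \<in> \<Omega> \<Longrightarrow> X p \<in> TS p) \<Longrightarrow> (\<And>c. c \<in> M \<Longrightarrow> smooth_on (cmap c ` (\<Omega> \<inter> cdom c)) (rep c X)) \<Longrightarrow>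
    smooth_field M \<Omega> X"
  by (simp add: smooth_field_def rep_def[abs_def])

lemma smooth_field_subset: "smooth_field M \<Omega> X \<Longrightarrow> \<Omega>' \<subseteq> \<Omega> \<Longrightarrow> smooth_field M \<Omega>' X"
  unfolding smooth_field_def by (meson image_mono Int_mono order_refl smooth_on_subset subsetD)

lemma smooth_field_cong:
  assumes "smooth_field M \<Omega> X" "open \<Omega>" "\<And>p. p \<in> \<Omega> \<Longrightarrow> X p = Y p"
  shows "smooth_field M \<Omega> Y"
proof (rule smooth_fieldI)
  show "Y p \<in> TS p" if "p \<in> \<Omega>" for p using assms that smooth_field_tangent by metis
  show "smooth_on (cmap c ` (\<Omega> \<inter> cdom c)) (rep c Y)" if "c \<in> M" for c
    by (rule smooth_on_cong[OF smooth_on_rep[OF assms(1) that] open_cmap_image[OF that assms(2)]])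
      (use assms(3) cinv_mem[OF that] in \<open>auto simp: rep_def\<close>)
qed

lemma smooth_field_add:
  assumes "smooth_field M \<Omega> X" "smooth_field M \<Omega> Y" "open \<Omega>"
  shows "smooth_field M \<Omega> (X + Y)"
  using smooth_on_add[OF open_cmap_image smooth_on_rep smooth_on_rep] assms
  by (intro smooth_fieldI) (auto intro!: tangent_add simp: smooth_field_tangent rep_def[abs_def])

lemma coord_vec_const_smooth_aux:
  assumes "c \<in> M" "d \<in> M"
  shows "smooth_on (cmap d ` (cdom c \<inter> cdom d)) (\<lambda>x. coord_vec M c (cinv d x) y d)"
proof -
  have O: "open (cmap d ` (cdom c \<inter> cdom d))" using assms open_cmap_image open_cdom by blast
  have "smooth_on (cmap d ` (cdom c \<inter> cdom d)) (\<lambda>x. DD (tr c d) (tr d c x) y)"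
    by (rule smooth_on_comp[OF O open_tr_dom[OF assms] _ smooth_on_DD[OF smooth_on_tr[OF assms]]])
      (use assms smooth_on_tr[of d c] in \<open>auto simp: cinv_cmap Int_commute o_def\<close>)
  then show ?thesis
    by (rule smooth_on_cong[OF _ O]) (use assms in \<open>auto simp: coord_vec_apply dtr_def cinv_cmap\<close>)
qed

lemma coord_vec_smooth_field:
  assumes "c \<in> M" "\<Omega> \<subseteq> cdom c" "open \<Omega>"
  shows "smooth_field M \<Omega> (\<lambda>q. coord_vec M c q y)"
proof (rule smooth_fieldI)
  show "coord_vec M c p y \<in> TS p" if "p \<in> \<Omega>" for p using assms that coord_vec_tangent by blast
  show "smooth_on (cmap d ` (\<Omega> \<inter> cdom d)) (rep d (\<lambda>q. coord_vec M c q y))" if "d \<in> M" for d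
    unfolding rep_def
    by (rule smooth_on_subset[OF coord_vec_const_smooth_aux]) (use assms that in auto)
qed

text \<open>The axioms of a connection quantify over fields, so to use them for vectors at
  \<open>p\<close> every tangent vector must be the value of a field. A field with constant
  components in a chart is cut off by a bump function.\<close>

lemma ex_smooth_field:
  assumes "v \<in> TS p"
  obtains Z where "smooth_field M UNIV Z" "Z p = v"
proof -
  obtain c where c: "c \<in> M" "p \<in> cdom c" using ex_chart by blast
  obtain r where r: "r > 0" "cball (cmap c p) r \<subseteq> cim c"
    using open_contains_cball[of "cim c"] open_cim c by blast
  obtain \<beta> :: "real ^ 'n \<Rightarrow> real" where \<beta>: "smooth_on UNIV \<beta>" "\<beta> (cmap c p) = 1" "\<And>x. x \<notin> cball (cmap c p) r \<Longrightarrow> \<beta> x = 0"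
    using ex_smooth_bump[OF r(1), of "cmap c p"] by blast
  define Z where "Z q = (if q \<in> cdom c then \<beta> (cmap c q) *\<^sub>R coord_vec M c q (v c) else 0)" for q
  define K where "K = cinv c ` cball (cmap c p) r"
  have "compact K"
    unfolding K_def
    by (rule compact_continuous_image[OF continuous_on_subset[OF continuous_on_cinv[OF c(1)] r(2)] compact_cball])
  \<comment> \<open>Compact sets are closed because the manifold is Hausdorff. Off \<open>K\<close>
    the field vanishes, so near a point outside the domain of \<open>c\<close> it is smooth as the
    zero field.\<close>
  then have K: "closed K" by (rule compact_imp_closed)
  have ZK: "Z q = 0" if "q \<notin> K" for q
  proof -
    have "cmap c q \<notin> cball (cmap c p) r" if "q \<in> cdom c"
      using \<open>q \<notin> K\<close> cinv_cmap[OF c(1) that] unfolding K_def by (metis image_eqI)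
    then show ?thesis using \<beta>(3) by (auto simp: Z_def)
  qed
  have "smooth_field M UNIV Z"
  proof (rule smooth_fieldI)
    show "Z q \<in> TS q" for q
      by (simp add: Z_def c coord_vec_tangent tangent_scaleR tangent_zero)
    fix d assume d: "d \<in> M"
    show "smooth_on (cmap d ` (UNIV \<inter> cdom d)) (rep d Z)"
    proof (rule smooth_on_local_eq)
      fix x assume "x \<in> cmap d ` (UNIV \<inter> cdom d)"
      then obtain q where q: "q \<in> cdom d" "x = cmap d q" by auto
      show "\<exists>T g. open T \<and> x \<in> T \<and> smooth_on T g \<and> (\<forall>y\<in>T. rep d Z y = g y)"
      proof (cases "q \<in> cdom c")
        case True
        let ?T = "cmap d ` (cdom c \<inter> cdom d)"
        have T: "open ?T" using open_cmap_image[OF d open_cdom[OF c(1)]] by simp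
        have "smooth_on ?T (\<lambda>x. \<beta> (tr d c x) *\<^sub>R coord_vec M c (cinv d x) (v c) d)"
          using smooth_on_tr[of d c] c d
          by (intro smooth_on_scaleR T coord_vec_const_smooth_aux smooth_on_comp[OF T open_UNIV _ \<beta>(1)])
            (auto simp: Int_commute o_def)
        moreover have "\<forall>y\<in>?T. rep d Z y = \<beta> (tr d c y) *\<^sub>R coord_vec M c (cinv d y) (v c) d"
          using d by (auto simp: rep_def Z_def cinv_cmap)
        ultimately show ?thesis using T True q by blast
      next
        case False
        let ?T = "cmap d ` (- K \<inter> cdom d)"
        have "open ?T" using open_cmap_image[OF d] K by blast
        moreover have "x \<in> ?T"
        proof -
          have "q \<notin> K" using False r(2) cinv_cdom[OF c(1)] unfolding K_def by auto
          then show ?thesis using q by auto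
        qed
        moreover have "\<forall>y\<in>?T. rep d Z y = 0" using d ZK by (auto simp: rep_def cinv_cmap)
        ultimately show ?thesis by (intro exI[of _ ?T] exI[of _ "\<lambda>x. 0"]) auto
      qed
    qed
  qed
  moreover have "Z p = v" using c \<beta>(2) coord_vec_self[OF assms] by (simp add: Z_def)
  ultimately show thesis using that by blast
qed

subsection \<open>Derivatives of functions and Lie brackets\<close>

lemma fun_chart_change:
  assumes "c \<in> M" "d \<in> M" "p \<in> cdom c" "p \<in> cdom d" "(f \<circ> cinv c) differentiable (at (cmap c p))"
  shows "(f \<circ> cinv d) differentiable (at (cmap d p))"
    and "DD (f \<circ> cinv d) (cmap d p) (dtr c d p y) = DD (f \<circ> cinv c) (cmap c p) y"
proof -
  have O: "open (cmap d ` (cdom c \<inter> cdom d))" using assms open_cmap_image open_cdom by blast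
  have df: "(f \<circ> cinv c) differentiable (at (tr d c (cmap d p)))"
    using assms by (simp add: tr_cmap[unfolded o_def])
  note dt = tr_differentiable[OF assms(2,1,4,3)]
  have d1: "(\<lambda>x. (f \<circ> cinv c) (tr d c x)) differentiable (at (cmap d p))" by (rule DD_comp(2)[OF df dt])
  have eq: "(f \<circ> cinv c) (tr d c x) = (f \<circ> cinv d) x" if "x \<in> cmap d ` (cdom c \<inter> cdom d)" for x
    using that assms by (auto simp: cinv_cmap)
  have p: "cmap d p \<in> cmap d ` (cdom c \<inter> cdom d)" using assms by blast
  show "(f \<circ> cinv d) differentiable (at (cmap d p))"
    by (rule differentiable_cong[OF O p eq d1])
  have "DD (f \<circ> cinv d) (cmap d p) = DD (\<lambda>x. (f \<circ> cinv c) (tr d c x)) (cmap d p)"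
    by (rule DD_cong[OF O p, symmetric]) (rule eq)
  then have "DD (f \<circ> cinv d) (cmap d p) (dtr c d p y) = DD (\<lambda>x. (f \<circ> cinv c) (tr d c x)) (cmap d p) (dtr c d p y)"
    by (rule fun_cong)
  also have "\<dots> = DD (f \<circ> cinv c) (tr d c (cmap d p)) (DD (tr d c) (cmap d p) (dtr c d p y))"
    by (rule DD_comp(1)[OF df dt])
  also have "\<dots> = DD (f \<circ> cinv c) (cmap c p) (dtr d c p (dtr c d p y))"
    unfolding dtr_def tr_cmap[OF assms(2,4)] ..
  finally have "DD (f \<circ> cinv d) (cmap d p) (dtr c d p y) = DD (f \<circ> cinv c) (cmap c p) (dtr d c p (dtr c d p y))" .
  then show "DD (f \<circ> cinv d) (cmap d p) (dtr c d p y) = DD (f \<circ> cinv c) (cmap c p) y"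
    using assms by (simp add: dtr_comp dtr_id)
qed

lemma vec_deriv_chart:
  assumes "c \<in> M" "p \<in> cdom c" "v \<in> TS p" "(f \<circ> cinv c) differentiable (at (cmap c p))"
  shows "vec_deriv M p v f = DD (f \<circ> cinv c) (cmap c p) (v c)"
proof -
  define d where "d = (SOME c. c \<in> M \<and> p \<in> cdom c)"
  have d: "d \<in> M" "p \<in> cdom d" unfolding d_def using someI_ex[of "\<lambda>c. c \<in> M \<and> p \<in> cdom c"] assms by blast+
  have "vec_deriv M p v f = DD (f \<circ> cinv d) (cmap d p) (v d)"
    by (simp add: vec_deriv_def d_def Let_def)
  also have "v d = dtr c d p (v c)" using tangent_dtr assms d by blast
  also have "DD (f \<circ> cinv d) (cmap d p) (dtr c d p (v c)) = DD (f \<circ> cinv c) (cmap c p) (v c)"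
    using fun_chart_change assms d by blast
  finally show ?thesis .
qed

definition bracket :: "('m, 'n) chart \<Rightarrow> ('m \<Rightarrow> ('m, 'n) tvec) \<Rightarrow> ('m \<Rightarrow> ('m, 'n) tvec) \<Rightarrow> 'm \<Rightarrow> real ^ 'n" where
  "bracket c X Y p = DD (rep c Y) (cmap c p) (X p c) - DD (rep c X) (cmap c p) (Y p c)"

lemma lie_bracket_coord: "lie_bracket M X Y p = at_chart M p (\<lambda>c. bracket c X Y p)"
  by (simp add: lie_bracket_def bracket_def rep_def[abs_def])

lemma rep_transform:
  assumes "smooth_field M \<Omega> X" "c \<in> M" "d \<in> M" "x \<in> cmap c ` (\<Omega> \<inter> cdom c \<inter> cdom d)"
  shows "rep d X (tr c d x) = DD (tr c d) x (rep c X x)"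
proof -
  obtain p where p: "p \<in> \<Omega>" "p \<in> cdom c" "p \<in> cdom d" "x = cmap c p" using assms by auto
  then show ?thesis
    using assms tangent_dtr[OF smooth_field_tangent[OF assms(1)], of p c d]
    by (simp add: rep_def cinv_cmap dtr_def)
qed

text \<open>The transformation law \<open>rep_transform\<close> is differentiated along the chart
  change. Besides the tensorial term there appears the second derivative of the transition
  map.\<close>

lemma DD_rep_transform:
  assumes "smooth_field M \<Omega> X" "open \<Omega>" "c \<in> M" "d \<in> M" "p \<in> \<Omega>" "p \<in> cdom c" "p \<in> cdom d"
  shows "DD (rep d X) (cmap d p) (dtr c d p y) =
    DD (\<lambda>x. DD (tr c d) x (X p c)) (cmap c p) y + dtr c d p (DD (rep c X) (cmap c p) y)"
proof -
  let ?O = "cmap c ` (\<Omega> \<inter> cdom c \<inter> cdom d)"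
  have O: "open ?O"
    using open_cmap_image[of c "\<Omega> \<inter> cdom d"] assms open_cdom by (simp add: Int_ac open_Int)
  have p: "cmap c p \<in> ?O" using assms by auto
  have "DD (rep d X) (cmap d p) (dtr c d p y) = DD (\<lambda>x. rep d X (tr c d x)) (cmap c p) y"
  proof -
    have "rep d X differentiable at (cmap d p)"
      by (rule smooth_on_differentiable[OF smooth_on_rep[OF assms(1,4)]]) (use assms in auto)
    then have "rep d X differentiable at (tr c d (cmap c p))"
      using tr_cmap[OF assms(3,6)] by simp
    from DD_comp(1)[OF this tr_differentiable[OF assms(3,4,6,7)], of y]
    show ?thesis using tr_cmap[OF assms(3,6)] by (simp add: dtr_def)
  qed
  also have "DD (\<lambda>x. rep d X (tr c d x)) (cmap c p) = DD (\<lambda>x. DD (tr c d) x (rep c X x)) (cmap c p)"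
    by (rule DD_cong[OF O p]) (rule rep_transform[OF assms(1,3,4)])
  also have "\<dots> y = DD (\<lambda>x. DD (tr c d) x (rep c X (cmap c p))) (cmap c p) y
      + DD (tr c d) (cmap c p) (DD (rep c X) (cmap c p) y)"
  proof (rule DD_linear_family[OF O _ _ _ p])
    have sm: "smooth_on ?O (tr c d)" by (rule smooth_on_subset[OF smooth_on_tr]) (use assms in auto)
    show "linear (DD (tr c d) x)" if "x \<in> ?O" for x using linear_DD[OF sm that] .
    show "smooth_on ?O (\<lambda>x. DD (tr c d) x h)" for h by (rule smooth_on_DD[OF sm])
    show "smooth_on ?O (rep c X)" by (rule smooth_on_subset[OF smooth_on_rep[OF assms(1,3)]]) auto
  qed
  finally show ?thesis using assms by (simp add: rep_cmap dtr_def)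
qed

text \<open>The second derivative of the transition map is symmetric in the two directions, so its
  contributions cancel in the difference.\<close>

lemma bracket_transform:
  assumes "smooth_field M \<Omega> X" "smooth_field M \<Omega> Y" "open \<Omega>" "c \<in> M" "d \<in> M" "p \<in> \<Omega>" "p \<in> cdom c" "p \<in> cdom d"
  shows "bracket d X Y p = dtr c d p (bracket c X Y p)"
proof -
  have eq: "X p d = dtr c d p (X p c)" "Y p d = dtr c d p (Y p c)"
    using assms tangent_dtr smooth_field_tangent by metis+
  have "DD (\<lambda>x. DD (tr c d) x (X p c)) (cmap c p) (Y p c) = DD (\<lambda>x. DD (tr c d) x (Y p c)) (cmap c p) (X p c)"
    using DD_symmetric[OF open_tr_dom _ smooth_on_tr] assms by blast
  then show ?thesis
    unfolding bracket_def eq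
    using DD_rep_transform[OF assms(1,3-)] DD_rep_transform[OF assms(2,3-)] linear_diff[OF linear_dtr] assms
    by simp
qed

lemma lie_bracket_chart:
  assumes "smooth_field M \<Omega> X" "smooth_field M \<Omega> Y" "open \<Omega>" "c \<in> M" "p \<in> \<Omega>" "p \<in> cdom c"
  shows "lie_bracket M X Y p = coord_vec M c p (bracket c X Y p)"
  unfolding lie_bracket_coord by (rule at_chart_tangentI) (use bracket_transform assms in blast)+

lemma smooth_on_bracket:
  assumes "smooth_field M \<Omega> X" "smooth_field M \<Omega> Y" "open \<Omega>" "c \<in> M"
  shows "smooth_on (cmap c ` (\<Omega> \<inter> cdom c)) (\<lambda>x. DD (rep c Y) x (rep c X x) - DD (rep c X) x (rep c Y x))"
  using assms by (intro smooth_on_diff smooth_on_DD_var smooth_on_rep open_cmap_image)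

lemma lie_bracket_smooth_field:
  assumes "smooth_field M \<Omega> X" "smooth_field M \<Omega> Y" "open \<Omega>"
  shows "smooth_field M \<Omega> (lie_bracket M X Y)"
proof (rule smooth_fieldI)
  show "lie_bracket M X Y p \<in> TS p" if "p \<in> \<Omega>" for p
    using lie_bracket_chart[OF assms] coord_vec_tangent ex_chart that by metis
  show "smooth_on (cmap c ` (\<Omega> \<inter> cdom c)) (rep c (lie_bracket M X Y))" if c: "c \<in> M" for c
    by (rule smooth_on_cong[OF smooth_on_bracket[OF assms c] open_cmap_image[OF c assms(3)]])
      (use c in \<open>auto simp: rep_def[of c "lie_bracket M X Y"] rep_cmap cinv_cmap lie_bracket_coord at_chart_apply bracket_def\<close>)
qed

end

section \<open>The Chern symbols of a Lagrangian in coordinates\<close>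

type_synonym 'n phase = "(real ^ 'n) \<times> (real ^ 'n)"

definition lg :: "('n phase \<Rightarrow> real) \<Rightarrow> 'n phase \<Rightarrow> real ^ 'n \<Rightarrow> real ^ 'n \<Rightarrow> real" where
  "lg l z u w = 1/2 * DD (\<lambda>z. DD l z (0, w)) z (0, u)"

definition lC :: "('n phase \<Rightarrow> real) \<Rightarrow> 'n phase \<Rightarrow>
    real ^ 'n \<Rightarrow> real ^ 'n \<Rightarrow> real ^ 'n \<Rightarrow> real" where
  "lC l z u v w = 1/4 * DD (\<lambda>z. DD (\<lambda>z. DD l z (0, w)) z (0, v)) z (0, u)"

text \<open>The horizontal derivative of \<open>g\<close>: the rate of change of
  \<open>lg l z v w\<close> when the base point moves in direction \<open>u\<close> and the
  components of the reference vector stay fixed.\<close>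

definition lB :: "('n phase \<Rightarrow> real) \<Rightarrow> 'n phase \<Rightarrow>
    real ^ 'n \<Rightarrow> real ^ 'n \<Rightarrow> real ^ 'n \<Rightarrow> real" where
  "lB l z u v w = 1/2 * DD (\<lambda>z. DD (\<lambda>z. DD l z (0, w)) z (0, v)) z (u, 0)"

text \<open>Cramer's rule for \<open>g\<^sub>z(\<cdot>, x) = \<alpha>\<close>, which makes the smooth dependence on \<open>z\<close> evident.\<close>

definition sharp :: "('n phase \<Rightarrow> real) \<Rightarrow> 'n phase \<Rightarrow>
    (real ^ 'n \<Rightarrow> real) \<Rightarrow> real ^ 'n" where
  "sharp l z \<alpha> = (\<chi> k. det (\<chi> i j. if j = k then \<alpha> (axis i 1) else lg l z (axis i 1) (axis j 1)) /
     det (\<chi> i j. lg l z (axis i 1) (axis j 1)))"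

text \<open>The Koszul combination. Half of it would be the Christoffel symbol of the first kind if
  \<open>g\<close> did not depend on the direction.\<close>

definition lK :: "('n phase \<Rightarrow> real) \<Rightarrow> 'n phase \<Rightarrow>
    real ^ 'n \<Rightarrow> real ^ 'n \<Rightarrow> real ^ 'n \<Rightarrow> real" where
  "lK l z u v w = lB l z u v w + lB l z v w u - lB l z w u v"

text \<open>
  With \<open>y\<close> the direction of \<open>z\<close>, the Koszul formula contains the Cartan tensor only through
  \<open>\<Gamma>(\<cdot>, y)\<close>. Since \<open>C(y, \<cdot>, \<cdot>) = 0\<close>, it first yields \<open>\<Gamma>(y, y)\<close>, then \<open>\<Gamma>(\<cdot>, y)\<close>, and finally \<open>\<Gamma>\<close>.
\<close>

definition spray :: "('n phase \<Rightarrow> real) \<Rightarrow> 'n phase \<Rightarrow> real ^ 'n" where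
  "spray l z = sharp l z (\<lambda>w. lK l z (snd z) (snd z) w / 2)"

definition nonlin :: "('n phase \<Rightarrow> real) \<Rightarrow> 'n phase \<Rightarrow> real ^ 'n \<Rightarrow> real ^ 'n" where
  "nonlin l z u = sharp l z (\<lambda>w. lK l z u (snd z) w / 2 - lC l z (spray l z) w u)"

definition lGam :: "('n phase \<Rightarrow> real) \<Rightarrow> 'n phase \<Rightarrow>
    real ^ 'n \<Rightarrow> real ^ 'n \<Rightarrow> real ^ 'n" where
  "lGam l z u v = sharp l z (\<lambda>w. lK l z u v w / 2 - lC l z (nonlin l z u) v w
     - lC l z (nonlin l z v) w u + lC l z (nonlin l z w) u v)"

text \<open>What one chart sees of a pseudo-Finsler structure. The symbols, their smoothness and the
  algebra behind their uniqueness are treated on this open subset of phase space, away from the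
  manifold.\<close>

locale lagrangian =
  fixes Z :: "'n::finite phase set" and l :: "'n phase \<Rightarrow> real"
  assumes open_Z: "open Z" and smooth_l: "smooth_on Z l"
    and conic: "(x, y) \<in> Z \<Longrightarrow> r > 0 \<Longrightarrow> (x, r *\<^sub>R y) \<in> Z"
    and homogeneous: "(x, y) \<in> Z \<Longrightarrow> r > 0 \<Longrightarrow> l (x, r *\<^sub>R y) = r\<^sup>2 * l (x, y)"
    and nondegenerate: "z \<in> Z \<Longrightarrow> (\<And>w. lg l z u w = 0) \<Longrightarrow> u = 0"
begin

abbreviation "g \<equiv> lg l"
abbreviation "C \<equiv> lC l"
abbreviation "B \<equiv> lB l"
abbreviation "K \<equiv> lK l"
abbreviation "\<Gamma> \<equiv> lGam l"

section \<open>Smoothness, symmetry and multilinearity of the coordinate tensors\<close>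

lemma smooth_D2: "smooth_on Z (\<lambda>z. DD (\<lambda>z. DD l z h) z k)"
  and smooth_D3: "smooth_on Z (\<lambda>z. DD (\<lambda>z. DD (\<lambda>z. DD l z h) z k) z m)"
  by (intro smooth_on_DD smooth_l)+

lemma smooth_g: "smooth_on Z (\<lambda>z. g z u w)"
  and smooth_C: "smooth_on Z (\<lambda>z. C z u v w)"
  and smooth_B: "smooth_on Z (\<lambda>z. B z u v w)"
  unfolding lg_def lC_def lB_def
  by (intro smooth_on_mult open_Z smooth_on_const smooth_D2 smooth_D3)+

lemma smooth_K: "smooth_on Z (\<lambda>z. K z u v w)"
  unfolding lK_def by (intro smooth_on_diff smooth_on_add open_Z smooth_B)

lemma linear_pair0: "linear (\<lambda>u. (0, u))" and linear_pair1: "linear (\<lambda>u. (u, 0))"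
  by (auto intro!: linearI)

lemma D2_sym: "z \<in> Z \<Longrightarrow> DD (\<lambda>z. DD l z h) z k = DD (\<lambda>z. DD l z k) z h"
  by (rule DD_symmetric[OF open_Z _ smooth_l])

lemma D3_sym1: "z \<in> Z \<Longrightarrow> DD (\<lambda>z. DD (\<lambda>z. DD l z h) z k) z m = DD (\<lambda>z. DD (\<lambda>z. DD l z h) z m) z k"
  by (rule DD_symmetric[OF open_Z _ smooth_on_DD[OF smooth_l]])

lemma D3_sym2: "z \<in> Z \<Longrightarrow> DD (\<lambda>z. DD (\<lambda>z. DD l z h) z k) z m = DD (\<lambda>z. DD (\<lambda>z. DD l z k) z h) z m"
  by (rule fun_cong[OF DD_cong[OF open_Z]]) (auto intro: D2_sym)

lemma g_sym: "z \<in> Z \<Longrightarrow> g z u w = g z w u"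
  unfolding lg_def using D2_sym by simp

lemma C_sym12: "z \<in> Z \<Longrightarrow> C z u v w = C z v u w"
  unfolding lC_def using D3_sym1 by simp

lemma C_sym23: "z \<in> Z \<Longrightarrow> C z u v w = C z u w v"
  unfolding lC_def using D3_sym2[of z "(0, w)" "(0, v)"] by simp

lemma B_sym23: "z \<in> Z \<Longrightarrow> B z u v w = B z u w v"
  unfolding lB_def using D3_sym2[of z "(0, w)" "(0, v)"] by simp

lemma linear_g1: "z \<in> Z \<Longrightarrow> linear (\<lambda>u. g z u w)"
  unfolding lg_def
  using linear_compose[OF linear_pair0 linear_DD[OF smooth_on_DD[OF smooth_l]]]
  by (intro linear_compose_scale_right[where 'b = real, unfolded real_scaleR_def]) (simp add: o_def)

lemma linear_g2: "z \<in> Z \<Longrightarrow> linear (g z u)"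
  using linear_g1[of z u] g_sym[of z u] by presburger

lemma linear_C1: "z \<in> Z \<Longrightarrow> linear (\<lambda>u. C z u v w)"
  unfolding lC_def
  using linear_compose[OF linear_pair0 linear_DD[OF smooth_D2]]
  by (intro linear_compose_scale_right[where 'b = real, unfolded real_scaleR_def]) (simp add: o_def)

lemma linear_C2: "z \<in> Z \<Longrightarrow> linear (\<lambda>v. C z u v w)"
  using linear_C1[of z u w] C_sym12[of z u _ w] by presburger

lemma linear_C3: "z \<in> Z \<Longrightarrow> linear (C z u v)"
  using linear_C2[of z u v] C_sym23[of z u v] by presburger

lemma linear_B1: "z \<in> Z \<Longrightarrow> linear (\<lambda>u. B z u v w)"
  unfolding lB_def
  using linear_compose[OF linear_pair1 linear_DD[OF smooth_D2]]
  by (intro linear_compose_scale_right[where 'b = real, unfolded real_scaleR_def]) (simp add: o_def)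

lemma linear_B2:
  assumes z: "z \<in> Z" shows "linear (\<lambda>v. B z u v w)"
  unfolding lB_def D3_sym1[OF z, of "(0, w)" _ "(u, 0)"]
  using linear_compose[OF linear_pair0 linear_DD[OF smooth_D2[of "(0, w)" "(u, 0)"] z]]
  by (intro linear_compose_scale_right[where 'b = real, unfolded real_scaleR_def]) (simp add: o_def)

lemma linear_B3: "z \<in> Z \<Longrightarrow> linear (B z u v)"
  using linear_B2[of z u v] B_sym23[of z u v] by presburger

lemmas multilinear =
  linear_add[OF linear_g1] linear_add[OF linear_g2] linear_cmul[OF linear_g1] linear_cmul[OF linear_g2]
  linear_diff[OF linear_g1] linear_diff[OF linear_g2]
  linear_add[OF linear_C1] linear_add[OF linear_C2] linear_add[OF linear_C3]
  linear_cmul[OF linear_C1] linear_cmul[OF linear_C2] linear_cmul[OF linear_C3]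
  linear_add[OF linear_B1] linear_add[OF linear_B2] linear_add[OF linear_B3]
  linear_cmul[OF linear_B1] linear_cmul[OF linear_B2] linear_cmul[OF linear_B3]

lemma linear_K1: "z \<in> Z \<Longrightarrow> linear (\<lambda>u. K z u v w)"
  and linear_K2: "z \<in> Z \<Longrightarrow> linear (\<lambda>v. K z u v w)"
  and linear_K3: "z \<in> Z \<Longrightarrow> linear (K z u v)"
  by (auto intro!: linearI simp: lK_def multilinear algebra_simps)

text \<open>A direction of phase space splits into a horizontal and a vertical part. Since
  \<open>g\<close> is half a second vertical derivative and \<open>C\<close> a quarter of a third
  one, the vertical part contributes twice \<open>C\<close>.\<close>

lemma DD_g:
  assumes "z \<in> Z"
  shows "DD (\<lambda>z. g z v w) z (h, k) = B z h v w + 2 * C z k v w"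
proof -
  have "((\<lambda>z. g z v w) has_derivative (\<lambda>h. 1/2 * DD (\<lambda>z. DD (\<lambda>z. DD l z (0, w)) z (0, v)) z h)) (at z)"
    unfolding lg_def by (intro has_derivative_mult_right smooth_on_has_derivative[OF smooth_D2 assms])
  moreover have "DD (\<lambda>z. DD (\<lambda>z. DD l z (0, w)) z (0, v)) z (h, k) =
      DD (\<lambda>z. DD (\<lambda>z. DD l z (0, w)) z (0, v)) z (h, 0) + DD (\<lambda>z. DD (\<lambda>z. DD l z (0, w)) z (0, v)) z (0, k)"
    using linear_add[OF linear_DD[OF smooth_D2 assms], of _ _ "(h, 0)" "(0, k)"] by simp
  ultimately show ?thesis by (simp add: DD_I lB_def lC_def)
qed

lemma g_eqI: "z \<in> Z \<Longrightarrow> (\<And>w. g z u w = g z v w) \<Longrightarrow> u = v"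
  using nondegenerate[of z "u - v"] by (simp add: multilinear)

text \<open>By the chain rule a vertical derivative of f(x, r y) brings out a factor r, so
  differentiation lowers the degree of homogeneity by one. Two applications take \<open>l\<close>,
  of degree 2, to \<open>g\<close>, of degree 0.\<close>

lemma DD_homogeneous:
  assumes "smooth_on Z f" "\<And>x y. (x, y) \<in> Z \<Longrightarrow> f (x, r *\<^sub>R y) = k * f (x, y)" "(x, y) \<in> Z" "r > 0"
  shows "r * DD f (x, r *\<^sub>R y) (0, b) = k * DD f (x, y) (0, b)"
proof -
  define m where "m z = (fst z, r *\<^sub>R snd z)" for z :: "'n phase"
  have m: "bounded_linear m"
    unfolding m_def
    by (intro bounded_linear_Pair bounded_linear_fst bounded_linear_compose[OF bounded_linear_scaleR_right] bounded_linear_snd)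
  then have dm: "m differentiable (at z)" "DD m z = m" for z
    using bounded_linear_imp_has_derivative[OF m, of "at z"] by (auto simp: differentiable_def dest: DD_I)
  have mz: "m (x, y) \<in> Z" using conic assms(3,4) by (simp add: m_def)
  have "DD (\<lambda>z. f (m z)) (x, y) (0, b) = DD f (m (x, y)) (m (0, b))"
    using DD_comp(1)[OF smooth_on_differentiable[OF assms(1) mz] dm(1)] dm(2) by metis
  also have "\<dots> = r * DD f (x, r *\<^sub>R y) (0, b)"
    using linear_cmul[OF linear_DD[OF assms(1) mz], of r "(0, b)"] by (simp add: m_def)
  finally have "r * DD f (x, r *\<^sub>R y) (0, b) = DD (\<lambda>z. f (m z)) (x, y) (0, b)" by simp
  also have "DD (\<lambda>z. f (m z)) (x, y) = DD (\<lambda>z. k * f z) (x, y)"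
    using assms(2) by (intro DD_cong[OF open_Z assms(3)]) (auto simp: m_def)
  also have "\<dots> = (\<lambda>h. k * DD f (x, y) h)"
    by (intro DD_I has_derivative_mult_right smooth_on_has_derivative[OF assms(1,3)])
  finally show ?thesis .
qed

lemma g_homogeneous:
  assumes "(x, y) \<in> Z" "r > 0" shows "g (x, r *\<^sub>R y) u w = g (x, y) u w"
proof -
  have 1: "DD l (x, r *\<^sub>R y) (0, w) = r * DD l (x, y) (0, w)" if "(x, y) \<in> Z" for x y
    using DD_homogeneous[OF smooth_l homogeneous that] assms(2) by (auto simp: power2_eq_square)
  have "r * DD (\<lambda>z. DD l z (0, w)) (x, r *\<^sub>R y) (0, u) = r * DD (\<lambda>z. DD l z (0, w)) (x, y) (0, u)"
    by (rule DD_homogeneous[OF smooth_on_DD[OF smooth_l] 1 assms])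
  then show ?thesis using assms(2) by (simp add: lg_def)
qed

text \<open>Euler's relation in degree 0: \<open>g\<close> is constant on the ray through the
  direction of \<open>z\<close>, and by \<open>DD_g\<close> its derivative along this ray is twice
  the Cartan tensor.\<close>

lemma C_direction:
  assumes "z \<in> Z" shows "C z (snd z) v w = 0"
proof -
  obtain x y where z: "z = (x, y)" by (cases z)
  have "((\<lambda>t. g (z + t *\<^sub>R (0, y)) v w) has_real_derivative DD (\<lambda>z. g z v w) z (0, y)) (at 0)"
    using deriv_along_line[of "\<lambda>z. g z v w" z 0 "(0, y)"] smooth_on_differentiable[OF smooth_g assms]
    by (simp add: zero_prod_def[symmetric])
  moreover have "((\<lambda>t. g (z + t *\<^sub>R (0, y)) v w) has_real_derivative 0) (at 0)"
  proof (rule DERIV_cong_ev[OF refl _ refl, THEN iffD2])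
    show "((\<lambda>t. g z v w) has_real_derivative 0) (at 0)" by simp
    have "g (z + t *\<^sub>R (0, y)) v w = g z v w" if "t > -1" for t
      using g_homogeneous[of x y "1 + t" v w] that assms by (simp add: z scaleR_add_left)
    then show "\<forall>\<^sub>F t in nhds 0. g (z + t *\<^sub>R (0, y)) v w = g z v w"
      by (auto simp: eventually_nhds intro!: exI[of _ "{-1<..}"])
  qed
  ultimately have "DD (\<lambda>z. g z v w) z (0, y) = 0" using DERIV_unique by blast
  then show ?thesis using DD_g[OF assms, of v w 0 y] linear_0[OF linear_B1[OF assms]] by (simp add: z)
qed

lemma C_direction': "z \<in> Z \<Longrightarrow> C z u (snd z) w = 0" "z \<in> Z \<Longrightarrow> C z u w (snd z) = 0"
  using C_direction C_sym12 C_sym23 by metis+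

section \<open>Inverting the fundamental tensor\<close>

lemma axis_expansion: "(x :: real ^ 'n) = (\<Sum>i\<in>UNIV. (x $ i) *\<^sub>R axis i 1)"
  using basis_expansion[of x] by (simp add: scalar_mult_eq_scaleR)

lemma g_expansion: "z \<in> Z \<Longrightarrow> g z v x = (\<Sum>j\<in>UNIV. x $ j * g z v (axis j 1))"
  by (subst axis_expansion[of x]) (simp add: linear_sum[OF linear_g2] linear_cmul[OF linear_g2])

lemma gram_mult:
  assumes "z \<in> Z" shows "((\<chi> i j. g z (axis i 1) (axis j 1)) *v x) $ i = g z (axis i 1) x"
  unfolding g_expansion[OF assms, of _ x] by (simp add: matrix_vector_mult_def mult.commute)

text \<open>A kernel vector of the Gram matrix is \<open>g\<close>-orthogonal to the basis, hence to
  every vector, and so vanishes by nondegeneracy.\<close>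

lemma gram_det:
  assumes z: "z \<in> Z" shows "det (\<chi> i j. g z (axis i 1) (axis j 1)) \<noteq> 0"
proof -
  have "x = 0" if "(\<chi> i j. g z (axis i 1) (axis j 1)) *v x = 0" for x
  proof (rule nondegenerate[OF z])
    fix w
    have "g z x w = (\<Sum>i\<in>UNIV. w $ i * g z (axis i 1) x)"
      unfolding g_sym[OF z, of _ x] by (rule g_expansion[OF z])
    also have "\<dots> = 0" using that gram_mult[OF z, of x] by simp
    finally show "g z x w = 0" .
  qed
  then show ?thesis
    unfolding invertible_det_nz[symmetric] invertible_left_inverse matrix_left_invertible_ker by blast
qed

lemma g_sharp:
  assumes z: "z \<in> Z" and \<alpha>: "linear \<alpha>"
  shows "g z (sharp l z \<alpha>) w = \<alpha> w"
proof -
  define G where "G = (\<chi> i j. g z (axis i 1) (axis j 1))"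
  have "sharp l z \<alpha> = (\<chi> k. det (\<chi> i j. if j = k then (\<chi> i. \<alpha> (axis i 1)) $ i else G $ i $ j) / det G)"
    by (simp add: sharp_def G_def cong: if_cong)
  then have "G *v sharp l z \<alpha> = (\<chi> i. \<alpha> (axis i 1))"
    using cramer[OF gram_det[OF z]] unfolding G_def by blast
  then have "g z (axis i 1) (sharp l z \<alpha>) = \<alpha> (axis i 1)" for i
    using gram_mult[OF z, of "sharp l z \<alpha>" i] by (simp add: G_def)
  then have "g z (sharp l z \<alpha>) w = (\<Sum>i\<in>UNIV. w $ i * \<alpha> (axis i 1))"
    using g_expansion[OF z, of "sharp l z \<alpha>" w] by (simp add: g_sym[OF z, of "sharp l z \<alpha>"])
  also have "\<dots> = \<alpha> w"
    by (subst (2) axis_expansion[of w]) (simp add: linear_sum[OF \<alpha>] linear_cmul[OF \<alpha>])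
  finally show ?thesis .
qed

lemma smooth_det:
  fixes M :: "'n phase \<Rightarrow> real ^ 'k ^ 'k"
  assumes "\<And>i j. smooth_on Z (\<lambda>z. M z $ i $ j)"
  shows "smooth_on Z (\<lambda>z. det (M z))"
  unfolding det_def by (intro smooth_on_sum smooth_on_mult smooth_on_prod open_Z assms smooth_on_const finite_permutations) auto

lemma smooth_sharp:
  assumes "\<And>w. smooth_on Z (\<lambda>z. \<alpha> z w)"
  shows "smooth_on Z (\<lambda>z. sharp l z (\<alpha> z))"
proof (rule smooth_on_vec[OF open_Z])
  fix k
  have "smooth_on Z (\<lambda>z. if j = k then \<alpha> z (axis i 1) else g z (axis i 1) (axis j 1))" for i j
    by (cases "j = k") (auto intro: assms smooth_g)
  then show "smooth_on Z (\<lambda>z. sharp l z (\<alpha> z) $ k)"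
    unfolding sharp_def
    by (simp, intro smooth_on_divide open_Z smooth_det) (auto simp: gram_det intro: smooth_g)
qed

section \<open>Algebraic properties and smoothness of the Chern symbols\<close>

lemma linear_spray_rhs: "z \<in> Z \<Longrightarrow> linear (\<lambda>w. K z u v w / 2)"
  by (auto intro!: linearI simp: linear_add[OF linear_K3] linear_cmul[OF linear_K3] field_simps)

lemma g_spray: "z \<in> Z \<Longrightarrow> g z (spray l z) w = K z (snd z) (snd z) w / 2"
  unfolding spray_def by (rule g_sharp[OF _ linear_spray_rhs])

lemma g_nonlin: "z \<in> Z \<Longrightarrow> g z (nonlin l z u) w = K z u (snd z) w / 2 - C z (spray l z) w u"
  unfolding nonlin_def
  by (rule g_sharp) (auto intro!: linearI simp: linear_add[OF linear_K3] linear_cmul[OF linear_K3] multilinear field_simps)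

text \<open>\<open>sharp\<close> is a quotient of determinants and hard to handle directly.
  Identities for \<open>nonlin\<close> and \<open>lGam\<close> are therefore tested against all
  \<open>w\<close> with \<open>g_eqI\<close>, after which \<open>g_sharp\<close> has replaced them
  by their defining right-hand sides.\<close>

lemma linear_nonlin: "z \<in> Z \<Longrightarrow> linear (nonlin l z)"
  by (rule linearI; rule g_eqI)
    (auto simp: g_nonlin multilinear linear_add[OF linear_K1] linear_cmul[OF linear_K1] field_simps)

lemma g_Gam:
  "z \<in> Z \<Longrightarrow> g z (\<Gamma> z u v) w = K z u v w / 2 - C z (nonlin l z u) v w
     - C z (nonlin l z v) w u + C z (nonlin l z w) u v"
  unfolding lGam_def
  by (rule g_sharp) (auto intro!: linearI simp: linear_add[OF linear_K3] linear_cmul[OF linear_K3]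
      linear_add[OF linear_nonlin] linear_cmul[OF linear_nonlin] multilinear field_simps)

lemma Gam_sym: "z \<in> Z \<Longrightarrow> \<Gamma> z u v = \<Gamma> z v u"
proof (rule g_eqI)
  fix w assume z: "z \<in> Z"
  have "K z u v w = K z v u w"
    unfolding lK_def using B_sym23[OF z, of u v w] B_sym23[OF z, of v u w] B_sym23[OF z, of w u v] by simp
  then show "g z (\<Gamma> z u v) w = g z (\<Gamma> z v u) w"
    unfolding g_Gam[OF z]
    using C_sym23[OF z, of _ v w] C_sym23[OF z, of _ w u] C_sym23[OF z, of _ u v] by simp
qed

lemma linear_Gam1: "z \<in> Z \<Longrightarrow> linear (\<lambda>u. \<Gamma> z u v)"
  by (rule linearI; rule g_eqI)
    (auto simp: g_Gam multilinear linear_add[OF linear_K1] linear_cmul[OF linear_K1]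
      linear_add[OF linear_nonlin] linear_cmul[OF linear_nonlin] field_simps)

lemma linear_Gam2: "z \<in> Z \<Longrightarrow> linear (\<Gamma> z u)"
  using linear_Gam1[of z u] Gam_sym[of z u] by presburger

text \<open>This closes the circle: the Cartan terms of \<open>lGam\<close> were written with
  \<open>nonlin\<close>, which turns out to be the symbol itself with the direction of
  \<open>z\<close> as second argument. So \<open>lGam\<close> solves the implicit Koszul
  formula.\<close>

lemma Gam_direction: "z \<in> Z \<Longrightarrow> \<Gamma> z u (snd z) = nonlin l z u"
proof (rule g_eqI)
  fix w assume z: "z \<in> Z"
  have "nonlin l z (snd z) = spray l z"
    by (rule g_eqI[OF z]) (simp add: g_nonlin g_spray z C_direction')
  then show "g z (\<Gamma> z u (snd z)) w = g z (nonlin l z u) w"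
    by (simp add: g_Gam g_nonlin z C_direction')
qed

text \<open>Adding the Koszul combinations with \<open>v\<close> and \<open>w\<close> exchanged
  gives \<open>2 * B\<close>; of the Cartan terms those with \<open>nonlin\<close> at
  \<open>v\<close> and at \<open>w\<close> cancel, and only the one at \<open>u\<close>
  stays.\<close>

lemma Gam_metric:
  assumes z: "z \<in> Z"
  shows "B z u v w = g z (\<Gamma> z u v) w + g z v (\<Gamma> z u w) + 2 * C z (\<Gamma> z u (snd z)) v w"
proof -
  have "K z u v w + K z u w v = 2 * B z u v w"
    unfolding lK_def using B_sym23[OF z, of u v w] B_sym23[OF z, of v u w] B_sym23[OF z, of w u v] by simp
  then show ?thesis
    unfolding g_sym[OF z, of v] g_Gam[OF z] Gam_direction[OF z]
    using C_sym23[OF z, of _ v w] C_sym23[OF z, of _ w u] C_sym23[OF z, of _ u v] by simp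
qed

lemma smooth_Gam: "smooth_on Z (\<lambda>z. \<Gamma> z u v)"
proof -
  have K2: "smooth_on Z (\<lambda>z. K z u (snd z) w)" for u w
    by (rule smooth_on_linear_family[OF open_Z linear_K2 smooth_K smooth_on_snd])
  have K1: "smooth_on Z (\<lambda>z. K z (snd z) (snd z) w)" for w
    by (rule smooth_on_linear_family[of Z "\<lambda>z u. K z u (snd z) w", OF open_Z linear_K1 K2 smooth_on_snd])
  have 1: "smooth_on Z (spray l)"
    unfolding spray_def
    by (rule smooth_sharp, intro smooth_on_divide open_Z smooth_on_const K1) simp
  have 2: "smooth_on Z (\<lambda>z. nonlin l z u)" for u
    unfolding nonlin_def
    by (rule smooth_sharp, intro smooth_on_divide smooth_on_diff open_Z smooth_on_const
        smooth_on_linear_family[OF open_Z linear_C1 smooth_C 1] K2) simp_all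
  show ?thesis
    unfolding lGam_def
    by (rule smooth_sharp, intro smooth_on_divide smooth_on_diff smooth_on_add open_Z smooth_on_const
        smooth_on_linear_family[OF open_Z linear_C1 smooth_C 2] smooth_K) auto
qed

lemmas smooth_Gam_comp = smooth_on_bilinear_family[of Z \<Gamma>, OF open_Z linear_Gam1 linear_Gam2 smooth_Gam]
lemmas DD_Gam_comp = DD_bilinear_family[of Z \<Gamma>, OF open_Z linear_Gam1 linear_Gam2 smooth_Gam]
lemmas smooth_g_comp = smooth_on_bilinear_family[of Z g, OF open_Z linear_g1 linear_g2 smooth_g]
lemmas DD_g_comp = DD_bilinear_family[of Z g, OF open_Z linear_g1 linear_g2 smooth_g]

text \<open>The difference \<open>S\<close> of two Chern connections vanishes, by the steps leading to \<open>lGam\<close>.\<close>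

lemma koszul_zero:
  assumes z: "z \<in> Z" and V: "V \<in> F" "ev V = snd z" and ev: "\<And>u. \<exists>X\<in>F. ev X = u"
    and sym: "\<And>X Y. X \<in> F \<Longrightarrow> Y \<in> F \<Longrightarrow> S X Y = S Y X"
    and met: "\<And>X Y W. X \<in> F \<Longrightarrow> Y \<in> F \<Longrightarrow> W \<in> F \<Longrightarrow>
      g z (S X Y) (ev W) + g z (ev Y) (S X W) + 2 * C z (S X V) (ev Y) (ev W) = 0"
    and XY: "X \<in> F" "Y \<in> F"
  shows "S X Y = 0"
proof -
  \<comment> \<open>Koszul: metricity for (X, Y, W) plus that for (Y, W, X) minus that for (W, X,
    Y), halved. \<open>S\<close> takes fields because it is not known to be tensorial;
    \<open>ev\<close> stands for evaluation at the point.\<close>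
  have k: "g z (S X Y) (ev W) + C z (S X V) (ev Y) (ev W) + C z (S Y V) (ev W) (ev X) = C z (S W V) (ev X) (ev Y)"
    if X: "X \<in> F" and Y: "Y \<in> F" and W: "W \<in> F" for X Y W
    using met[OF X Y W] met[OF Y W X] met[OF W X Y] sym[OF X Y] sym[OF X W] sym[OF Y W]
      g_sym[OF z, of "ev Y"] g_sym[OF z, of "ev X"] g_sym[OF z, of "ev W"] by simp
  have nd: "u = 0" if "\<And>W. W \<in> F \<Longrightarrow> g z u (ev W) = 0" for u
    by (rule nondegenerate[OF z]) (use that ev in metis)
  have C0: "C z 0 a b = 0" for a b using linear_0[OF linear_C1[OF z]] .
  have VV: "S V V = 0"
    by (rule nd) (use k[OF V(1) V(1)] in \<open>simp add: V(2) C_direction'[OF z]\<close>)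
  have XV: "S X V = 0" if "X \<in> F" for X
    by (rule nd) (use k[OF that V(1)] in \<open>simp add: VV V(2) C_direction'[OF z] C0\<close>)
  show ?thesis
    by (rule nd) (use k[OF XY] XV XY in \<open>simp add: C0\<close>)
qed

end

section \<open>The Chern connection\<close>

lemma eventually_line_in:
  fixes z a :: "'a::real_normed_vector"
  assumes "open S" "z \<in> S" shows "\<forall>\<^sub>F t in nhds (0::real). z + t *\<^sub>R a \<in> S"
proof -
  have "((\<lambda>t. z + t *\<^sub>R a) \<longlongrightarrow> z + 0 *\<^sub>R a) (nhds (0::real))"
    by (intro tendsto_intros filterlim_ident)
  then show ?thesis using topological_tendstoD assms by fastforce
qed

text \<open>The tensors are defined by iterated scalar derivatives along lines. The inner derivative
  becomes a \<open>DD\<close> only while the line stays in \<open>S\<close>, that is for t near 0,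
  which is enough for the outer derivative.\<close>

lemma deriv2_line:
  fixes l :: "'a::euclidean_space \<Rightarrow> real"
  assumes "open S" "smooth_on S l" "z \<in> S"
  shows "deriv (\<lambda>t. deriv (\<lambda>s. l (z + t *\<^sub>R a + s *\<^sub>R b)) 0) 0 = DD (\<lambda>z. DD l z b) z a"
proof -
  have "deriv (\<lambda>t. deriv (\<lambda>s. l (z + t *\<^sub>R a + s *\<^sub>R b)) 0) 0 = deriv (\<lambda>t. DD l (z + t *\<^sub>R a) b) 0"
    by (rule deriv_cong_ev[OF _ refl], rule eventually_mono[OF eventually_line_in[OF assms(1,3), of a]])
      (rule deriv_line_0, rule smooth_on_differentiable[OF assms(2)])
  also have "\<dots> = DD (\<lambda>z. DD l z b) z a"
    by (rule deriv_line_0[OF smooth_on_differentiable[OF smooth_on_DD[OF assms(2)] assms(3)]])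
  finally show ?thesis .
qed

lemma deriv3_line:
  fixes l :: "'a::euclidean_space \<Rightarrow> real"
  assumes "open S" "smooth_on S l" "z \<in> S"
  shows "deriv (\<lambda>r. deriv (\<lambda>t. deriv (\<lambda>s. l (z + r *\<^sub>R a + t *\<^sub>R b + s *\<^sub>R c)) 0) 0) 0 =
    DD (\<lambda>z. DD (\<lambda>z. DD l z c) z b) z a"
proof -
  have "deriv (\<lambda>r. deriv (\<lambda>t. deriv (\<lambda>s. l (z + r *\<^sub>R a + t *\<^sub>R b + s *\<^sub>R c)) 0) 0) 0 =
      deriv (\<lambda>r. DD (\<lambda>z. DD l z c) (z + r *\<^sub>R a) b) 0"
    by (rule deriv_cong_ev[OF _ refl], rule eventually_mono[OF eventually_line_in[OF assms(1,3), of a]])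
      (rule deriv2_line[OF assms(1,2)])
  also have "\<dots> = DD (\<lambda>z. DD (\<lambda>z. DD l z c) z b) z a"
    by (rule deriv_line_0[OF smooth_on_differentiable[OF smooth_on_DD[OF smooth_on_DD[OF assms(2)]] assms(3)]])
  finally show ?thesis .
qed

locale finsler =
  fixes M :: "('m::{t2_space,second_countable_topology}, 'n::finite) chart set"
    and A :: "('m \<times> ('m, 'n) tvec) set" and L :: "'m \<times> ('m, 'n) tvec \<Rightarrow> real"
  assumes finsler: "pseudo_finsler M A L"

sublocale finsler \<subseteq> smooth_mfd M
  using finsler by unfold_locales (simp add: pseudo_finsler_def)

context finsler
begin

section \<open>The pseudo-Finsler structure in a chart\<close>

definition lag_dom :: "('m, 'n) chart \<Rightarrow> 'n phase set" where
  "lag_dom c = tb_chart c ` {w \<in> A. fst w \<in> cdom c}"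

definition lag :: "('m, 'n) chart \<Rightarrow> 'n phase \<Rightarrow> real" where
  "lag c = L \<circ> tb_inv M c"

lemma tb_open_A: "tb_open M A" and tb_smooth_L: "tb_smooth M A L"
  using finsler by (simp_all add: pseudo_finsler_def)

lemma A_conic: "(p, v) \<in> A \<Longrightarrow> r > 0 \<Longrightarrow> (p, r *\<^sub>R v) \<in> A"
  and L_homogeneous: "(p, v) \<in> A \<Longrightarrow> r > 0 \<Longrightarrow> L (p, r *\<^sub>R v) = r\<^sup>2 * L (p, v)"
  and L_nondegenerate: "(p, v) \<in> A \<Longrightarrow> u \<in> TS p \<Longrightarrow> \<forall>w\<in>TS p. fund_tensor L p v u w = 0 \<Longrightarrow> u = 0"
proof -
  have 1: "\<forall>(p, v)\<in>A. \<forall>r>0. (p, r *\<^sub>R v) \<in> A"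
    using finsler unfolding pseudo_finsler_def by (elim conjE)
  have 2: "\<forall>(p, v)\<in>A. \<forall>r>0. L (p, r *\<^sub>R v) = r\<^sup>2 * L (p, v)"
    using finsler unfolding pseudo_finsler_def by (elim conjE)
  have 3: "\<forall>(p, v)\<in>A. \<forall>u\<in>TS p. (\<forall>w\<in>TS p. fund_tensor L p v u w = 0) \<longrightarrow> u = 0"
    using finsler unfolding pseudo_finsler_def by (elim conjE)
  show "(p, v) \<in> A \<Longrightarrow> r > 0 \<Longrightarrow> (p, r *\<^sub>R v) \<in> A" using bspec[OF 1, of "(p, v)"] by simp
  show "(p, v) \<in> A \<Longrightarrow> r > 0 \<Longrightarrow> L (p, r *\<^sub>R v) = r\<^sup>2 * L (p, v)" using bspec[OF 2, of "(p, v)"] by simp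
  show "(p, v) \<in> A \<Longrightarrow> u \<in> TS p \<Longrightarrow> \<forall>w\<in>TS p. fund_tensor L p v u w = 0 \<Longrightarrow> u = 0"
    using bspec[OF 3, of "(p, v)"] by simp
qed

lemma A_tangent:
  assumes "(p, v) \<in> A" shows "v \<in> TS p"
proof -
  have "A \<subseteq> tangent_bundle M" using tb_open_A unfolding tb_open_def by (rule conjunct1)
  then show ?thesis using assms unfolding tangent_bundle_def by (rule subsetD[THEN SigmaD2])
qed

lemma tb_inv_chart: "v \<in> TS p \<Longrightarrow> c \<in> M \<Longrightarrow> p \<in> cdom c \<Longrightarrow> tb_inv M c (cmap c p, v c) = (p, v)"
  by (simp add: tb_inv_def cinv_cmap coord_vec_self)

lemma lag_chart: "v \<in> TS p \<Longrightarrow> c \<in> M \<Longrightarrow> p \<in> cdom c \<Longrightarrow> lag c (cmap c p, v c) = L (p, v)"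
  by (simp add: lag_def tb_inv_chart)

lemma lag_dom_I: "(p, v) \<in> A \<Longrightarrow> p \<in> cdom c \<Longrightarrow> (cmap c p, v c) \<in> lag_dom c"
  unfolding lag_dom_def tb_chart_def by force

lemma lag_dom_E:
  assumes "z \<in> lag_dom c" obtains p v where "(p, v) \<in> A" "p \<in> cdom c" "z = (cmap c p, v c)"
  using assms unfolding lag_dom_def tb_chart_def by auto

text \<open>A tangent vector is determined by its components in one chart, so membership in
  \<open>A\<close> can be tested in any chart around \<open>p\<close>. With
  \<open>open_lag_dom\<close> this makes admissibility an open condition in coordinates.\<close>

lemma lag_dom_iff:
  assumes "v \<in> TS p" "c \<in> M" "p \<in> cdom c" shows "(cmap c p, v c) \<in> lag_dom c \<longleftrightarrow> (p, v) \<in> A"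
proof
  assume "(cmap c p, v c) \<in> lag_dom c"
  then obtain q w where q: "(q, w) \<in> A" "q \<in> cdom c" "cmap c p = cmap c q" "v c = w c"
    by (rule lag_dom_E) simp
  have "p = q" using q(2,3) assms(2,3) cinv_cmap by metis
  moreover have "v = w" using tangent_eqI[OF assms(1) _ assms(2,3)] A_tangent q \<open>p = q\<close> by blast
  ultimately show "(p, v) \<in> A" using q by simp
qed (use lag_dom_I assms in blast)

lemma open_lag_dom: "c \<in> M \<Longrightarrow> open (lag_dom c)"
  using tb_open_A unfolding tb_open_def lag_dom_def by (drule_tac conjunct2) (rule bspec)

lemma smooth_lag: "c \<in> M \<Longrightarrow> smooth_on (lag_dom c) (lag c)"
  using tb_smooth_L unfolding tb_smooth_def lag_dom_def lag_def by (rule bspec)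

lemma fund_tensor_chart:
  assumes "c \<in> M" "p \<in> cdom c" "(p, v) \<in> A" "u \<in> TS p" "w \<in> TS p"
  shows "fund_tensor L p v u w = lg (lag c) (cmap c p, v c) (u c) (w c)"
proof -
  have "L (p, v + t *\<^sub>R u + s *\<^sub>R w) = lag c ((cmap c p, v c) + t *\<^sub>R (0, u c) + s *\<^sub>R (0, w c))" for t s
    using lag_chart[OF _ assms(1,2), of "v + t *\<^sub>R u + s *\<^sub>R w"] assms(3-5)
    by (simp add: tangent_add tangent_scaleR A_tangent)
  then show ?thesis
    by (simp add: fund_tensor_def lg_def deriv2_line[OF open_lag_dom smooth_lag lag_dom_I] assms del: scaleR_Pair add_Pair)
qed

lemma cartan_tensor_chart:
  assumes "c \<in> M" "p \<in> cdom c" "(p, v) \<in> A" "u \<in> TS p" "w \<in> TS p" "x \<in> TS p"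
  shows "cartan_tensor L p v u w x = lC (lag c) (cmap c p, v c) (u c) (w c) (x c)"
proof -
  have "L (p, v + r *\<^sub>R u + t *\<^sub>R w + s *\<^sub>R x) =
      lag c ((cmap c p, v c) + r *\<^sub>R (0, u c) + t *\<^sub>R (0, w c) + s *\<^sub>R (0, x c))" for r t s
    using lag_chart[OF _ assms(1,2), of "v + r *\<^sub>R u + t *\<^sub>R w + s *\<^sub>R x"] assms(3-6)
    by (simp add: tangent_add tangent_scaleR A_tangent)
  then show ?thesis
    by (simp add: cartan_tensor_def lC_def deriv3_line[OF open_lag_dom smooth_lag lag_dom_I] assms del: scaleR_Pair add_Pair)
qed

text \<open>Every coordinate vector is the component vector of a tangent vector, by
  \<open>coord_vec\<close>; so nondegeneracy on the tangent space carries over to the whole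
  coordinate space.\<close>

lemma lagrangian_chart: assumes c: "c \<in> M" shows "lagrangian (lag_dom c) (lag c)"
proof
  show "open (lag_dom c)" "smooth_on (lag_dom c) (lag c)" using open_lag_dom smooth_lag c by blast+
next
  fix x y and r :: real assume xy: "(x, y) \<in> lag_dom c" and r: "r > 0"
  obtain p v where p: "(p, v) \<in> A" "p \<in> cdom c" "x = cmap c p" "y = v c"
    by (rule lag_dom_E[OF xy]) simp
  have rA: "(p, r *\<^sub>R v) \<in> A" "L (p, r *\<^sub>R v) = r\<^sup>2 * L (p, v)"
    using A_conic L_homogeneous p(1) r by simp_all
  then show "(x, r *\<^sub>R y) \<in> lag_dom c" using lag_dom_I[OF rA(1) p(2)] p by simp
  show "lag c (x, r *\<^sub>R y) = r\<^sup>2 * lag c (x, y)"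
    using lag_chart[OF A_tangent[OF rA(1)] c p(2)] lag_chart[OF A_tangent[OF p(1)] c p(2)] rA(2) p by simp
next
  fix z u assume z: "z \<in> lag_dom c" and nd: "\<And>w. lg (lag c) z u w = 0"
  obtain p v where p: "(p, v) \<in> A" "p \<in> cdom c" "z = (cmap c p, v c)" by (rule lag_dom_E[OF z])
  let ?u = "coord_vec M c p u"
  have "fund_tensor L p v ?u w = 0" if "w \<in> TS p" for w
    using fund_tensor_chart[OF c p(2,1) coord_vec_tangent[OF c p(2)] that, of u] nd p(3)
    by (simp add: coord_vec_same[OF c p(2)])
  then have "?u = 0" using L_nondegenerate[OF p(1) coord_vec_tangent[OF c p(2)]] by simp
  then have "?u c = 0" by simp
  then show "u = 0" by (simp add: coord_vec_same[OF c p(2)])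
qed

definition nabla_coord :: "('m, 'n) chart \<Rightarrow> ('m \<Rightarrow> ('m, 'n) tvec) \<Rightarrow> ('m \<Rightarrow> ('m, 'n) tvec) \<Rightarrow> ('m \<Rightarrow> ('m, 'n) tvec) \<Rightarrow>
    'm \<Rightarrow> real ^ 'n" where
  "nabla_coord c V X Y p = DD (rep c Y) (cmap c p) (X p c) + lGam (lag c) (cmap c p, V p c) (X p c) (Y p c)"

text \<open>The components are prescribed chart by chart; that they fit together to a tangent vector
  is established in \<open>nabla_chart\<close>.\<close>

definition nabla :: "('m \<Rightarrow> ('m, 'n) tvec) \<Rightarrow> ('m, 'n) field_op" where
  "nabla V X Y p = at_chart M p (\<lambda>c. nabla_coord c V X Y p)"

end

section \<open>Existence and uniqueness of the connection of an admissible field\<close>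

locale finsler_field = finsler M A L
  for M :: "('m::{t2_space,second_countable_topology}, 'n::finite) chart set" and A L +
  fixes \<Omega> :: "'m set" and V :: "'m \<Rightarrow> ('m, 'n) tvec"
  assumes open_\<Omega>: "open \<Omega>" and adm: "admissible_field M A \<Omega> V"
begin

abbreviation sf :: "('m \<Rightarrow> ('m, 'n) tvec) \<Rightarrow> bool" where "sf X \<equiv> smooth_field M \<Omega> X"

lemma sfV: "sf V" and VA: "p \<in> \<Omega> \<Longrightarrow> (p, V p) \<in> A"
  using adm by (auto simp: admissible_field_def)

text \<open>The requirements on a connection at a single point, for an operator that returns just
  the value at \<open>p\<close>. This admits candidates built in one chart, so that the expressions
  of two charts can be compared by uniqueness.\<close>

definition chern_at :: "'m \<Rightarrow> (('m \<Rightarrow> ('m, 'n) tvec) \<Rightarrow> ('m \<Rightarrow> ('m, 'n) tvec) \<Rightarrow> ('m, 'n) tvec) \<Rightarrow> bool" where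
  "chern_at p N \<longleftrightarrow> (\<forall>X Y. sf X \<longrightarrow> sf Y \<longrightarrow> N X Y \<in> TS p \<and> N X Y - N Y X = lie_bracket M X Y p) \<and>
     (\<forall>X Y Z. sf X \<longrightarrow> sf Y \<longrightarrow> sf Z \<longrightarrow>
        vec_deriv M p (X p) (\<lambda>q. fund_tensor L q (V q) (Y q) (Z q)) =
          fund_tensor L p (V p) (N X Y) (Z p) + fund_tensor L p (V p) (Y p) (N X Z) +
          2 * cartan_tensor L p (V p) (N X V) (Y p) (Z p))"

lemma chern_at_tangent: "chern_at p N \<Longrightarrow> sf X \<Longrightarrow> sf Y \<Longrightarrow> N X Y \<in> TS p"
  and chern_at_torsion: "chern_at p N \<Longrightarrow> sf X \<Longrightarrow> sf Y \<Longrightarrow> N X Y - N Y X = lie_bracket M X Y p"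
  and chern_at_metric: "chern_at p N \<Longrightarrow> sf X \<Longrightarrow> sf Y \<Longrightarrow> sf Z \<Longrightarrow>
     vec_deriv M p (X p) (\<lambda>q. fund_tensor L q (V q) (Y q) (Z q)) =
       fund_tensor L p (V p) (N X Y) (Z p) + fund_tensor L p (V p) (Y p) (N X Z) +
       2 * cartan_tensor L p (V p) (N X V) (Y p) (Z p)"
  by (simp_all add: chern_at_def)

text \<open>In the difference of two candidates the bracket drops out of the torsion equation and
  the derivative of \<open>g\<close> out of the metric one. What is left are the homogeneous
  equations of \<open>koszul_zero\<close>, and \<open>ex_smooth_field\<close> provides fields with
  every value at \<open>p\<close>.\<close>

lemma chern_at_unique:
  assumes p: "p \<in> \<Omega>" and N: "chern_at p N" "chern_at p N'" and XY: "sf X" "sf Y"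
  shows "N X Y = N' X Y"
proof -
  obtain c where c: "c \<in> M" "p \<in> cdom c" using ex_chart by blast
  interpret lg: lagrangian "lag_dom c" "lag c" by (rule lagrangian_chart[OF c(1)])
  note pA = VA[OF p]
  have z: "(cmap c p, V p c) \<in> lag_dom c" by (rule lag_dom_I[OF pA c(2)])
  have tN: "N X Y \<in> TS p" "N' X Y \<in> TS p" if "sf X" "sf Y" for X Y
    using chern_at_tangent[OF N(1) that] chern_at_tangent[OF N(2) that] .
  have "N X Y c - N' X Y c = 0"
  proof (rule lg.koszul_zero[OF z, where F = "Collect sf" and ev = "\<lambda>X. X p c" and V = V
        and S = "\<lambda>X Y. N X Y c - N' X Y c"])
    show "\<exists>X\<in>Collect sf. X p c = u" for u
    proof -
      obtain X where "smooth_field M UNIV X" "X p = coord_vec M c p u"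
        using ex_smooth_field[OF coord_vec_tangent[OF c]] by blast
      then show ?thesis
        using smooth_field_subset[of UNIV X \<Omega>] by (intro bexI[of _ X]) (auto simp: coord_vec_same[OF c])
    qed
    show "N X Y c - N' X Y c = N Y X c - N' Y X c" if "X \<in> Collect sf" "Y \<in> Collect sf" for X Y
    proof -
      have "N X Y - N Y X = N' X Y - N' Y X"
        using chern_at_torsion[OF N(1)] chern_at_torsion[OF N(2)] that by simp
      from fun_cong[OF this, of c] show ?thesis by (simp add: algebra_simps)
    qed
    show "lg (lag c) (cmap c p, V p c) (N X Y c - N' X Y c) (W p c) +
       lg (lag c) (cmap c p, V p c) (Y p c) (N X W c - N' X W c) +
       2 * lC (lag c) (cmap c p, V p c) (N X V c - N' X V c) (Y p c) (W p c) = 0"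
      if "X \<in> Collect sf" "Y \<in> Collect sf" "W \<in> Collect sf" for X Y W
    proof -
      have f: "sf X" "sf Y" "sf W" using that by auto
      note t = smooth_field_tangent[OF f(2) p] smooth_field_tangent[OF f(3) p]
        tN[OF f(1,2)] tN[OF f(1,3)] tN[OF f(1) sfV]
      have "fund_tensor L p (V p) (N X Y) (W p) + fund_tensor L p (V p) (Y p) (N X W) +
          2 * cartan_tensor L p (V p) (N X V) (Y p) (W p) =
        fund_tensor L p (V p) (N' X Y) (W p) + fund_tensor L p (V p) (Y p) (N' X W) +
          2 * cartan_tensor L p (V p) (N' X V) (Y p) (W p)"
        using chern_at_metric[OF N(1) f] chern_at_metric[OF N(2) f] by (rule trans[OF sym])
      then show ?thesis
        by (simp add: fund_tensor_chart[OF c pA] cartan_tensor_chart[OF c pA] t lg.multilinear[OF z]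
            linear_diff[OF lg.linear_C1[OF z]])
    qed
  qed (use XY sfV in simp_all)
  then show ?thesis using tangent_eqI[OF tN[OF XY] c] by simp
qed

lemma chart_point:
  assumes "c \<in> M" "x \<in> cmap c ` (\<Omega> \<inter> cdom c)"
  shows "(x, rep c V x) \<in> lag_dom c"
proof -
  obtain p where "p \<in> \<Omega>" "p \<in> cdom c" "x = cmap c p" using assms(2) by auto
  then show ?thesis using lag_dom_I[OF VA, of p c] by (simp add: rep_cmap[OF assms(1)])
qed

lemma smooth_nabla_coord:
  assumes c: "c \<in> M" and XY: "sf X" "sf Y"
  shows "smooth_on (cmap c ` (\<Omega> \<inter> cdom c))
    (\<lambda>x. DD (rep c Y) x (rep c X x) + lGam (lag c) (x, rep c V x) (rep c X x) (rep c Y x))"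
proof -
  interpret lg: lagrangian "lag_dom c" "lag c" by (rule lagrangian_chart[OF c])
  note O = open_cmap_image[OF c open_\<Omega>]
  note r = smooth_on_rep[OF _ c]
  show ?thesis
    by (intro smooth_on_add O smooth_on_DD_var lg.smooth_Gam_comp chart_point[OF c] smooth_on_Pair
        smooth_on_id r XY sfV)
qed

text \<open>The derivative of \<open>g\<close> along \<open>X\<close> has a vertical part because
  the reference vector \<open>V\<close> varies. It gives twice \<open>C\<close> on the derivative of
  \<open>V\<close>, which joins the Cartan term of \<open>Gam_metric\<close> to form the covariant
  derivative of \<open>V\<close>.\<close>

lemma metric_nabla_coord:
  assumes c: "c \<in> M" "p \<in> cdom c" and p: "p \<in> \<Omega>" and XYZ: "sf X" "sf Y" "sf Z"
  defines "z \<equiv> (cmap c p, V p c)"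
  shows "vec_deriv M p (X p) (\<lambda>q. fund_tensor L q (V q) (Y q) (Z q)) =
     lg (lag c) z (nabla_coord c V X Y p) (Z p c) + lg (lag c) z (Y p c) (nabla_coord c V X Z p) +
     2 * lC (lag c) z (nabla_coord c V X V p) (Y p c) (Z p c)"
proof -
  interpret lg: lagrangian "lag_dom c" "lag c" by (rule lagrangian_chart[OF c(1)])
  have z: "z \<in> lag_dom c" unfolding z_def by (rule lag_dom_I[OF VA[OF p] c(2)])
  let ?O = "cmap c ` (\<Omega> \<inter> cdom c)"
  let ?h = "\<lambda>x. lg (lag c) (x, rep c V x) (rep c Y x) (rep c Z x)"
  let ?f = "(\<lambda>q. fund_tensor L q (V q) (Y q) (Z q)) \<circ> cinv c"
  note O = open_cmap_image[OF c(1) open_\<Omega>]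
  note r = smooth_on_rep[OF _ c(1)]
  note cp = chart_point[OF c(1)]
  have x: "cmap c p \<in> ?O" using p c by blast
  have sV: "smooth_on ?O (\<lambda>x. (x, rep c V x))" by (intro smooth_on_Pair O smooth_on_id r sfV)
  have h: "smooth_on ?O ?h"
    by (intro lg.smooth_g_comp O cp sV r XYZ)
  have eq: "?h x = ?f x" if "x \<in> ?O" for x
  proof -
    obtain q where q: "q \<in> \<Omega>" "q \<in> cdom c" "x = cmap c q" using \<open>x \<in> ?O\<close> by auto
    then show ?thesis
      using fund_tensor_chart[OF c(1) q(2) VA[OF q(1)]] smooth_field_tangent XYZ
      by (simp add: rep_cmap[OF c(1)] cinv_cmap[OF c(1)])
  qed
  have d: "?f differentiable (at (cmap c p))"
    by (rule differentiable_cong[OF O x eq smooth_on_differentiable[OF h x]])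
  have "vec_deriv M p (X p) (\<lambda>q. fund_tensor L q (V q) (Y q) (Z q)) = DD ?f (cmap c p) (X p c)"
    by (rule vec_deriv_chart[OF c smooth_field_tangent[OF XYZ(1) p] d])
  also have "DD ?f (cmap c p) = DD ?h (cmap c p)" by (rule DD_cong[OF O x eq, symmetric])
  also have "DD ?h (cmap c p) (X p c) = DD (\<lambda>z. lg (lag c) z (Y p c) (Z p c)) z (X p c, DD (rep c V) (cmap c p) (X p c))
     + lg (lag c) z (DD (rep c Y) (cmap c p) (X p c)) (Z p c) + lg (lag c) z (Y p c) (DD (rep c Z) (cmap c p) (X p c))"
  proof -
    have D: "DD ?h (cmap c p) (X p c) =
        DD (\<lambda>z. lg (lag c) z (rep c Y (cmap c p)) (rep c Z (cmap c p))) (cmap c p, rep c V (cmap c p))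
          (DD (\<lambda>x. (x, rep c V x)) (cmap c p) (X p c)) +
        lg (lag c) (cmap c p, rep c V (cmap c p)) (DD (rep c Y) (cmap c p) (X p c)) (rep c Z (cmap c p)) +
        lg (lag c) (cmap c p, rep c V (cmap c p)) (rep c Y (cmap c p)) (DD (rep c Z) (cmap c p) (X p c))"
      by (rule lg.DD_g_comp[where f = "\<lambda>x. (x, rep c V x)"])
        (assumption | rule O cp sV r[OF XYZ(2)] r[OF XYZ(3)] x)+
    have "DD (\<lambda>x. (x, rep c V x)) (cmap c p) (X p c) = (X p c, DD (rep c V) (cmap c p) (X p c))"
      using DD_Pair[of "\<lambda>x. x" "cmap c p" "rep c V" "X p c"] smooth_on_differentiable[OF r[OF sfV] x] by simp
    then show ?thesis
      using D by (simp add: rep_cmap[OF c] z_def)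
  qed
  also have "\<dots> = lg (lag c) z (nabla_coord c V X Y p) (Z p c) + lg (lag c) z (Y p c) (nabla_coord c V X Z p) +
     2 * lC (lag c) z (nabla_coord c V X V p) (Y p c) (Z p c)"
    using lg.Gam_metric[OF z, of "X p c" "Y p c" "Z p c"]
    by (simp add: nabla_coord_def lg.DD_g[OF z] lg.multilinear[OF z] z_def[symmetric]) (simp add: z_def)
  finally show ?thesis .
qed

lemma chern_at_nabla_coord:
  assumes c: "c \<in> M" "p \<in> cdom c" and p: "p \<in> \<Omega>"
  shows "chern_at p (\<lambda>X Y. coord_vec M c p (nabla_coord c V X Y p))"
proof -
  interpret lg: lagrangian "lag_dom c" "lag c" by (rule lagrangian_chart[OF c(1)])
  note pA = VA[OF p]
  have z: "(cmap c p, V p c) \<in> lag_dom c" by (rule lag_dom_I[OF pA c(2)])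
  note t = coord_vec_tangent[OF c]
  have "coord_vec M c p (nabla_coord c V X Y p) - coord_vec M c p (nabla_coord c V Y X p) = lie_bracket M X Y p"
    if "sf X" "sf Y" for X Y
  proof (rule tangent_eqI[OF tangent_diff[OF t t] _ c])
    show "lie_bracket M X Y p \<in> TS p"
      unfolding lie_bracket_chart[OF that open_\<Omega> c(1) p c(2)] by (rule t)
    show "(coord_vec M c p (nabla_coord c V X Y p) - coord_vec M c p (nabla_coord c V Y X p)) c = lie_bracket M X Y p c"
      unfolding lie_bracket_chart[OF that open_\<Omega> c(1) p c(2)]
      using lg.Gam_sym[OF z, of "X p c"] by (simp add: coord_vec_same[OF c] nabla_coord_def bracket_def)
  qed
  moreover have "vec_deriv M p (X p) (\<lambda>q. fund_tensor L q (V q) (Y q) (Z q)) =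
      fund_tensor L p (V p) (coord_vec M c p (nabla_coord c V X Y p)) (Z p) +
      fund_tensor L p (V p) (Y p) (coord_vec M c p (nabla_coord c V X Z p)) +
      2 * cartan_tensor L p (V p) (coord_vec M c p (nabla_coord c V X V p)) (Y p) (Z p)"
    if "sf X" "sf Y" "sf Z" for X Y Z
    using metric_nabla_coord[OF c p that] smooth_field_tangent[OF _ p] that
    by (simp add: fund_tensor_chart[OF c pA] cartan_tensor_chart[OF c pA] t coord_vec_same[OF c])
  ultimately show ?thesis unfolding chern_at_def by (simp add: t)
qed

text \<open>No transformation law of the symbols is computed: the expressions in \<open>c\<close>
  and in \<open>d\<close> both satisfy \<open>chern_at\<close> at \<open>p\<close>, hence
  agree.\<close>

lemma nabla_chart:
  assumes c: "c \<in> M" "p \<in> cdom c" and p: "p \<in> \<Omega>" and XY: "sf X" "sf Y"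
  shows "nabla V X Y p = coord_vec M c p (nabla_coord c V X Y p)"
  unfolding nabla_def
proof (rule at_chart_tangentI[OF c])
  fix d assume d: "d \<in> M" "p \<in> cdom d"
  have "coord_vec M c p (nabla_coord c V X Y p) = coord_vec M d p (nabla_coord d V X Y p)"
    by (rule chern_at_unique[OF p chern_at_nabla_coord[OF c p] chern_at_nabla_coord[OF d p] XY])
  from fun_cong[OF this, of d] show "nabla_coord d V X Y p = dtr c d p (nabla_coord c V X Y p)"
    using d by (simp add: coord_vec_apply dtr_id)
qed

lemma nabla_apply: "c \<in> M \<Longrightarrow> p \<in> cdom c \<Longrightarrow> nabla V X Y p c = nabla_coord c V X Y p"
  by (simp add: nabla_def at_chart_apply)

lemma nabla_tangent: "p \<in> \<Omega> \<Longrightarrow> sf X \<Longrightarrow> sf Y \<Longrightarrow> nabla V X Y p \<in> TS p"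
  using nabla_chart coord_vec_tangent ex_chart by metis

lemma chern_at_nabla: "p \<in> \<Omega> \<Longrightarrow> chern_at p (\<lambda>X Y. nabla V X Y p)"
proof -
  assume p: "p \<in> \<Omega>"
  obtain c where c: "c \<in> M" "p \<in> cdom c" using ex_chart by blast
  show ?thesis
    using chern_at_nabla_coord[OF c p] nabla_chart[OF c p] sfV unfolding chern_at_def by simp
qed

lemma rep_nabla:
  assumes "c \<in> M" "x \<in> cmap c ` (\<Omega> \<inter> cdom c)"
  shows "rep c (nabla V X Y) x = DD (rep c Y) x (rep c X x) + lGam (lag c) (x, rep c V x) (rep c X x) (rep c Y x)"
proof -
  obtain p where "p \<in> \<Omega>" "p \<in> cdom c" "x = cmap c p" using assms(2) by auto
  then show ?thesis by (simp add: rep_cmap[OF assms(1)] nabla_apply[OF assms(1)] nabla_coord_def)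
qed

lemma nabla_smooth:
  assumes "sf X" "sf Y" shows "sf (nabla V X Y)"
proof (rule smooth_fieldI)
  show "nabla V X Y p \<in> TS p" if "p \<in> \<Omega>" for p by (rule nabla_tangent[OF that assms])
  show "smooth_on (cmap c ` (\<Omega> \<inter> cdom c)) (rep c (nabla V X Y))" if "c \<in> M" for c
    by (rule smooth_on_cong[OF smooth_nabla_coord[OF that assms] open_cmap_image[OF that open_\<Omega>]])
      (simp add: rep_nabla[OF that])
qed

lemma smooth_fun_scaleR:
  assumes "smooth_fun M \<Omega> f" "sf X" shows "sf (\<lambda>q. f q *\<^sub>R X q)"
proof (rule smooth_fieldI)
  show "f p *\<^sub>R X p \<in> TS p" if "p \<in> \<Omega>" for p by (rule tangent_scaleR[OF smooth_field_tangent[OF assms(2) that]])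
  show "smooth_on (cmap c ` (\<Omega> \<inter> cdom c)) (rep c (\<lambda>q. f q *\<^sub>R X q))" if c: "c \<in> M" for c
  proof -
    have "smooth_on (cmap c ` (\<Omega> \<inter> cdom c)) (\<lambda>x. (f \<circ> cinv c) x *\<^sub>R rep c X x)"
      using assms(1) c unfolding smooth_fun_def
      by (intro smooth_on_scaleR open_cmap_image[OF c open_\<Omega>] smooth_on_rep[OF assms(2) c]) blast
    then show ?thesis by (simp add: rep_def[abs_def])
  qed
qed

lemma affine_nabla: "affine_connection M \<Omega> (nabla V)"
proof -
  have add1: "nabla V (X + X') Y p = nabla V X Y p + nabla V X' Y p"
    and add2: "nabla V Y (X + X') p = nabla V Y X p + nabla V Y X' p"
    if f: "sf X" "sf X'" "sf Y" and p: "p \<in> \<Omega>" for X X' Y p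
  proof -
    obtain c where c: "c \<in> M" "p \<in> cdom c" using ex_chart by blast
    interpret lg: lagrangian "lag_dom c" "lag c" by (rule lagrangian_chart[OF c(1)])
    have z: "(cmap c p, V p c) \<in> lag_dom c" by (rule lag_dom_I[OF VA[OF p] c(2)])
    note fa = smooth_field_add[OF f(1,2) open_\<Omega>]
    have x: "cmap c p \<in> cmap c ` (\<Omega> \<inter> cdom c)" using p c by blast
    note dr = smooth_on_has_derivative[OF smooth_on_rep[OF _ c(1)] x]
    have l: "linear (DD (rep c Y) (cmap c p))" by (rule linear_DD[OF smooth_on_rep[OF f(3) c(1)] x])
    have r: "rep c (X + X') = (\<lambda>x. rep c X x + rep c X' x)" by (simp add: rep_def fun_eq_iff)
    have D: "DD (rep c (X + X')) (cmap c p) = (\<lambda>h. DD (rep c X) (cmap c p) h + DD (rep c X') (cmap c p) h)"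
      unfolding r by (rule DD_I[OF has_derivative_add[OF dr[OF f(1)] dr[OF f(2)]]])
    show "nabla V (X + X') Y p = nabla V X Y p + nabla V X' Y p"
      by (rule tangent_eqI[OF _ _ c])
        (auto intro!: nabla_tangent tangent_add p f fa
          simp: nabla_apply[OF c] nabla_coord_def linear_add[OF l] linear_add[OF lg.linear_Gam1[OF z]])
    show "nabla V Y (X + X') p = nabla V Y X p + nabla V Y X' p"
      by (rule tangent_eqI[OF _ _ c])
        (auto intro!: nabla_tangent tangent_add p f fa
          simp: nabla_apply[OF c] nabla_coord_def D linear_add[OF lg.linear_Gam2[OF z]])
  qed
  have scale1: "nabla V (\<lambda>q. f q *\<^sub>R X q) Y p = f p *\<^sub>R nabla V X Y p"
    and scale2: "nabla V X (\<lambda>q. f q *\<^sub>R Y q) p = vec_deriv M p (X p) f *\<^sub>R Y p + f p *\<^sub>R nabla V X Y p"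
    if f: "smooth_fun M \<Omega> f" and XY: "sf X" "sf Y" and p: "p \<in> \<Omega>" for f X Y p
  proof -
    obtain c where c: "c \<in> M" "p \<in> cdom c" using ex_chart by blast
    interpret lg: lagrangian "lag_dom c" "lag c" by (rule lagrangian_chart[OF c(1)])
    have z: "(cmap c p, V p c) \<in> lag_dom c" by (rule lag_dom_I[OF VA[OF p] c(2)])
    have x: "cmap c p \<in> cmap c ` (\<Omega> \<inter> cdom c)" using p c by blast
    have l: "linear (DD (rep c Y) (cmap c p))" by (rule linear_DD[OF smooth_on_rep[OF XY(2) c(1)] x])
    have sf: "smooth_on (cmap c ` (\<Omega> \<inter> cdom c)) (f \<circ> cinv c)"
      using f c unfolding smooth_fun_def by blast
    have r: "rep c (\<lambda>q. f q *\<^sub>R Y q) = (\<lambda>x. (f \<circ> cinv c) x *\<^sub>R rep c Y x)" by (simp add: rep_def fun_eq_iff)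
    have D: "DD (rep c (\<lambda>q. f q *\<^sub>R Y q)) (cmap c p) h =
        f p *\<^sub>R DD (rep c Y) (cmap c p) h + DD (f \<circ> cinv c) (cmap c p) h *\<^sub>R Y p c" for h
      using DD_I[OF has_derivative_scaleR[OF smooth_on_has_derivative[OF sf x]
            smooth_on_has_derivative[OF smooth_on_rep[OF XY(2) c(1)] x]]]
      unfolding r by (simp add: cinv_cmap[OF c] rep_cmap[OF c])
    have vd: "vec_deriv M p (X p) f = DD (f \<circ> cinv c) (cmap c p) (X p c)"
      by (rule vec_deriv_chart[OF c smooth_field_tangent[OF XY(1) p] smooth_on_differentiable[OF sf x]])
    show "nabla V (\<lambda>q. f q *\<^sub>R X q) Y p = f p *\<^sub>R nabla V X Y p"
    proof (rule tangent_eqI[OF _ _ c])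
      show "nabla V (\<lambda>q. f q *\<^sub>R X q) Y p \<in> TS p" "f p *\<^sub>R nabla V X Y p \<in> TS p"
        by (intro nabla_tangent tangent_scaleR smooth_fun_scaleR p XY f)+
    qed (simp add: nabla_apply[OF c] nabla_coord_def linear_cmul[OF l] linear_cmul[OF lg.linear_Gam1[OF z]] scaleR_add_right)
    show "nabla V X (\<lambda>q. f q *\<^sub>R Y q) p = vec_deriv M p (X p) f *\<^sub>R Y p + f p *\<^sub>R nabla V X Y p"
    proof (rule tangent_eqI[OF _ _ c])
      show "nabla V X (\<lambda>q. f q *\<^sub>R Y q) p \<in> TS p"
        by (intro nabla_tangent smooth_fun_scaleR p XY f)
      show "vec_deriv M p (X p) f *\<^sub>R Y p + f p *\<^sub>R nabla V X Y p \<in> TS p"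
        by (intro tangent_add tangent_scaleR nabla_tangent smooth_field_tangent[OF XY(2) p] p XY)
    qed (simp add: nabla_apply[OF c] nabla_coord_def D vd linear_cmul[OF lg.linear_Gam2[OF z]] scaleR_add_right)
  qed
  show ?thesis
    unfolding affine_connection_def by (simp add: nabla_smooth add1 add2 scale1 scale2)
qed

text \<open>\<open>nabla\<close> shows that there is something to choose, and whatever is chosen
  satisfies \<open>chern_at\<close> at each point of \<Omega>.\<close>

lemma chern_connection_eq:
  assumes "p \<in> \<Omega>" "sf X" "sf Y"
  shows "chern_connection M L \<Omega> V X Y p = nabla V X Y p"
proof -
  let ?N = "chern_connection M L \<Omega> V"
  define P where "P N \<longleftrightarrow> affine_connection M \<Omega> N \<and> torsion_free M \<Omega> N \<and> almost_metric M L \<Omega> V N" for N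
  have "torsion_free M \<Omega> (nabla V)"
    unfolding torsion_free_def using chern_at_torsion[OF chern_at_nabla] by simp
  moreover have "almost_metric M L \<Omega> V (nabla V)"
    unfolding almost_metric_def using chern_at_metric[OF chern_at_nabla] by simp
  ultimately have "P (nabla V)" unfolding P_def using affine_nabla by simp
  then have N: "affine_connection M \<Omega> ?N" "torsion_free M \<Omega> ?N" "almost_metric M L \<Omega> V ?N"
    using someI[of P "nabla V"] unfolding chern_connection_def P_def by simp_all
  have "sf (?N X Y)" if "sf X" "sf Y" for X Y
    using N(1) that unfolding affine_connection_def by simp
  from smooth_field_tangent[OF this assms(1)] have "chern_at p (\<lambda>X Y. ?N X Y p)"
    using N(2,3) assms(1) unfolding chern_at_def torsion_free_def almost_metric_def by simp
  then show ?thesis using chern_at_unique[OF assms(1) _ chern_at_nabla[OF assms(1)] assms(2,3)] by blast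
qed

end

section \<open>Identification of the Christoffel symbols\<close>

context finsler
begin

lemma coord_field_smooth: "c \<in> M \<Longrightarrow> open \<Omega> \<Longrightarrow> \<Omega> \<subseteq> cdom c \<Longrightarrow> smooth_field M \<Omega> (coord_field M c j)"
  unfolding coord_field_def by (rule coord_vec_smooth_field)

lemma chern_coord_field:
  assumes c: "c \<in> M" and \<Omega>: "open \<Omega>" "\<Omega> \<subseteq> cdom c" and V: "admissible_field M A \<Omega> V" and p: "p \<in> \<Omega>"
  shows "chern_connection M L \<Omega> V (coord_field M c j) (coord_field M c k) p =
    coord_vec M c p (lGam (lag c) (cmap c p, V p c) (axis j 1) (axis k 1))"
proof -
  interpret finsler_field M A L \<Omega> V by unfold_locales (use \<Omega> V in auto)
  have pc: "p \<in> cdom c" using p \<Omega> by blast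
  note f = coord_field_smooth[OF c \<Omega>]
  have "DD (rep c (coord_field M c k)) (cmap c p) = DD (\<lambda>x. axis k 1) (cmap c p)"
    by (rule DD_cong[OF open_cim[OF c]])
      (use pc cinv_cdom[OF c] in \<open>auto simp: rep_def coord_field_def coord_vec_same[OF c]\<close>)
  then have "nabla_coord c V (coord_field M c j) (coord_field M c k) p =
      lGam (lag c) (cmap c p, V p c) (axis j 1) (axis k 1)"
    by (simp add: nabla_coord_def coord_field_def coord_vec_same[OF c pc])
  then show ?thesis
    using chern_connection_eq[OF p f f] nabla_chart[OF c pc p f f] by simp
qed

lemma coord_vec_sum:
  assumes c: "c \<in> M" "p \<in> cdom c"
  shows "coord_vec M c p y = (\<Sum>i\<in>UNIV. (y $ i) *\<^sub>R coord_field M c i p)"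
proof (rule tangent_eqI[OF coord_vec_tangent[OF c] tangent_sum c])
  show "(y $ i) *\<^sub>R coord_field M c i p \<in> TS p" for i
    unfolding coord_field_def by (intro tangent_scaleR coord_vec_tangent c)
  have "(\<Sum>i\<in>I. (y $ i) *\<^sub>R coord_field M c i p) c = (\<Sum>i\<in>I. (y $ i) *\<^sub>R axis i 1)" for I
    by (induction I rule: infinite_finite_induct) (auto simp: coord_field_def coord_vec_same[OF c])
  then show "coord_vec M c p y c = (\<Sum>i\<in>UNIV. (y $ i) *\<^sub>R coord_field M c i p) c"
    using basis_expansion[of y] by (simp add: coord_vec_same[OF c] scalar_mult_eq_scaleR)
qed

text \<open>Extend \<open>v\<close> with constant components in the chart and restrict to the points
  where the extension stays in \<open>A\<close>. They form an open set, which may be smaller than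
  the chart domain.\<close>

lemma ex_admissible_field:
  assumes "c \<in> M" "p \<in> cdom c" "(p, v) \<in> A"
  obtains \<Omega> V where "open \<Omega>" "\<Omega> \<subseteq> cdom c" "p \<in> \<Omega>" "admissible_field M A \<Omega> V" "V p = v"
proof -
  let ?T = "cim c \<inter> (\<lambda>x. (x, v c)) -` lag_dom c"
  let ?\<Omega> = "cdom c \<inter> cmap c -` ?T" and ?V = "\<lambda>q. coord_vec M c q (v c)"
  have "continuous_on (cim c) (\<lambda>x. (x, v c))" by (intro continuous_intros)
  then have T: "open ?T" by (rule continuous_open_preimage[OF _ open_cim[OF assms(1)] open_lag_dom[OF assms(1)]])
  have O: "open ?\<Omega>"
    by (rule continuous_open_preimage[OF continuous_on_cmap[OF assms(1)] open_cdom[OF assms(1)] T])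
  have "(q, ?V q) \<in> A" if "q \<in> ?\<Omega>" for q
    using that lag_dom_iff[OF coord_vec_tangent[OF assms(1)] assms(1), of q "v c"]
    by (simp add: coord_vec_same[OF assms(1)])
  then have "admissible_field M A ?\<Omega> ?V"
    unfolding admissible_field_def using coord_vec_smooth_field[OF assms(1) _ O] by blast
  moreover have "p \<in> ?\<Omega>" using assms lag_dom_I[OF assms(3,2)] by auto
  moreover have "?V p = v" using coord_vec_self[OF A_tangent[OF assms(3)] assms(1,2)] .
  ultimately show thesis using that[of ?\<Omega> ?V] O by blast
qed

text \<open>\<open>lGam\<close> is a witness for the choice. Conversely the defining property fixes
  the symbols at each vector of \<open>A\<close>, because that vector is a value of an admissible
  field and the coordinate fields form a basis.\<close>

lemma christoffel_eq:
  assumes c: "c \<in> M" "p \<in> cdom c" and v: "(p, v) \<in> A"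
  shows "christoffel M A L c (p, v) i j k = lGam (lag c) (cmap c p, v c) (axis j 1) (axis k 1) $ i"
proof -
  interpret lg: lagrangian "lag_dom c" "lag c" by (rule lagrangian_chart[OF c(1)])
  define P where "P \<Gamma> \<longleftrightarrow> (\<forall>w\<in>A. fst w \<in> cdom c \<longrightarrow> (\<forall>i j k. \<Gamma> w i j k = \<Gamma> w i k j)) \<and>
     (\<forall>\<Omega> V. open \<Omega> \<longrightarrow> \<Omega> \<subseteq> cdom c \<longrightarrow> admissible_field M A \<Omega> V \<longrightarrow>
        (\<forall>j k. \<forall>p\<in>\<Omega>. chern_connection M L \<Omega> V (coord_field M c j) (coord_field M c k) p =
           (\<Sum>i\<in>UNIV. \<Gamma> (p, V p) i j k *\<^sub>R coord_field M c i p)))" for \<Gamma> :: "_ \<Rightarrow> 'n \<Rightarrow> 'n \<Rightarrow> 'n \<Rightarrow> real"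
  define G where "G w i j k = lGam (lag c) (tb_chart c w) (axis j 1) (axis k 1) $ i" for w i j k
  have "P G"
    unfolding P_def
  proof (intro conjI ballI allI impI)
    fix w i j k assume "w \<in> A" "fst w \<in> cdom c"
    then have "tb_chart c w \<in> lag_dom c" unfolding lag_dom_def by blast
    then show "G w i j k = G w i k j" unfolding G_def using lg.Gam_sym by metis
  next
    fix \<Omega> V j k p assume H: "open \<Omega>" "\<Omega> \<subseteq> cdom c" "admissible_field M A \<Omega> V" "p \<in> \<Omega>"
    show "chern_connection M L \<Omega> V (coord_field M c j) (coord_field M c k) p =
           (\<Sum>i\<in>UNIV. G (p, V p) i j k *\<^sub>R coord_field M c i p)"
      unfolding chern_coord_field[OF c(1) H] using H coord_vec_sum[OF c(1), of p]
      by (auto simp: G_def tb_chart_def)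
  qed
  then have P: "P (christoffel M A L c)"
    unfolding christoffel_def P_def[symmetric] by (rule someI[of P])
  obtain \<Omega> V where V: "open \<Omega>" "\<Omega> \<subseteq> cdom c" "p \<in> \<Omega>" "admissible_field M A \<Omega> V" "V p = v"
    by (rule ex_admissible_field[OF c v])
  have "(\<Sum>i\<in>UNIV. christoffel M A L c (p, v) i j k *\<^sub>R coord_field M c i p) =
      coord_vec M c p (lGam (lag c) (cmap c p, v c) (axis j 1) (axis k 1))"
    using P[unfolded P_def, THEN conjunct2, rule_format, OF V(1,2,4,3), of j k]
      chern_coord_field[OF c(1) V(1,2,4,3), of j k] V(5) by simp
  also have "(\<Sum>i\<in>UNIV. christoffel M A L c (p, v) i j k *\<^sub>R coord_field M c i p) =
      coord_vec M c p (\<chi> i. christoffel M A L c (p, v) i j k)"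
    using coord_vec_sum[OF c, of "\<chi> i. christoffel M A L c (p, v) i j k"] by simp
  finally have "(\<chi> i. christoffel M A L c (p, v) i j k) = lGam (lag c) (cmap c p, v c) (axis j 1) (axis k 1)"
    using coord_vec_same[OF c] by metis
  then show ?thesis by (metis vec_lambda_beta)
qed

end

section \<open>Curvature in a chart\<close>

text \<open>Bridge between a function \<open>G\<close> given on the parameter interval and a smooth
  extension \<open>F\<close> of it: agreement at the interval points near \<open>t\<close> suffices,
  also when \<open>t\<close> is an end point.\<close>

lemma vector_derivative_within_eqI:
  assumes "(F has_vector_derivative D) (at t)" "at t within S \<noteq> bot" "open T" "t \<in> T" "t \<in> S"
    "\<And>\<tau>. \<tau> \<in> T \<Longrightarrow> \<tau> \<in> S \<Longrightarrow> G \<tau> = F \<tau>"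
  shows "vector_derivative G (at t within S) = D"
proof (rule vector_derivative_within[OF assms(2)])
  have "\<forall>\<^sub>F \<tau> in nhds t. \<tau> \<in> S \<longrightarrow> F \<tau> = G \<tau>"
    unfolding eventually_nhds using assms(3,4,6) by (intro exI[of _ T]) auto
  then show "(G has_vector_derivative D) (at t within S)"
    by (rule has_vector_derivative_cong_ev[THEN iffD1, OF _ _ has_vector_derivative_at_within[OF assms(1)]])
      (use assms(4,5,6) in simp)
qed

lemma vector_derivative_within_cong:
  assumes "t \<in> S" "\<And>\<tau>. \<tau> \<in> S \<Longrightarrow> f \<tau> = g \<tau>"
  shows "vector_derivative f (at t within S) = vector_derivative g (at t within S)"
proof -
  have "(f has_vector_derivative D) (at t within S) \<longleftrightarrow> (g has_vector_derivative D) (at t within S)" for D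
    by (rule has_vector_derivative_cong_ev) (use assms in auto)
  then show ?thesis by (simp add: vector_derivative_def)
qed

lemma at_within_Icc_neq_bot: "(a::real) < b \<Longrightarrow> t \<in> {a..b} \<Longrightarrow> at t within {a..b} \<noteq> bot"
  using islimpt_Icc[of a b t] by (simp add: trivial_limit_within)

context lagrangian
begin

lemma Gam_expansion:
  assumes z: "z \<in> Z"
  shows "(\<Sum>j\<in>UNIV. \<Sum>k\<in>UNIV. u $ j * v $ k * \<Gamma> z (axis j 1) (axis k 1) $ i) = \<Gamma> z u v $ i"
proof -
  have "\<Gamma> z u v = (\<Sum>j\<in>UNIV. (u $ j) *\<^sub>R \<Gamma> z (axis j 1) v)"
    by (subst axis_expansion[of u]) (simp add: linear_sum[OF linear_Gam1[OF z]] linear_cmul[OF linear_Gam1[OF z]])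
  also have "\<dots> = (\<Sum>j\<in>UNIV. (u $ j) *\<^sub>R (\<Sum>k\<in>UNIV. (v $ k) *\<^sub>R \<Gamma> z (axis j 1) (axis k 1)))"
    by (subst axis_expansion[of v]) (simp add: linear_sum[OF linear_Gam2[OF z]] linear_cmul[OF linear_Gam2[OF z]])
  finally show ?thesis by (simp add: sum_distrib_left mult.assoc)
qed

abbreviation DGam :: "'n phase \<Rightarrow> real ^ 'n \<Rightarrow> real ^ 'n \<Rightarrow> 'n phase \<Rightarrow> real ^ 'n" where
  "DGam z u v h \<equiv> DD (\<lambda>z. \<Gamma> z u v) z h"

lemma DGam_sym: "z \<in> Z \<Longrightarrow> DGam z u v h = DGam z v u h"
  by (rule fun_cong[OF DD_cong[OF open_Z]]) (auto intro: Gam_sym)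

lemma linear_DGam: "z \<in> Z \<Longrightarrow> linear (DGam z u v)"
  by (rule linear_DD[OF smooth_Gam])

text \<open>The bilinear expansion of \<Gamma> in \<open>u\<close> and \<open>v\<close> is
  differentiated, and the vertical direction is expanded too. This reassembles the triple sum in the
  Chern tensor into one vertical derivative.\<close>

lemma DGam_expansion:
  assumes z: "z \<in> Z"
  shows "(\<Sum>j\<in>UNIV. \<Sum>k\<in>UNIV. \<Sum>l\<in>UNIV. u $ j * v $ k * w $ l * (DGam z (axis j 1) (axis k 1) (0, axis l 1) $ i)) =
    DGam z u v (0, w) $ i"
proof -
  have l: "linear (\<lambda>w. DGam z u v (0, w))" for u v
    using linear_compose[OF linear_pair0 linear_DGam[OF z]] by (simp add: o_def)
  have 1: "DGam z u v (0, w) = (\<Sum>l\<in>UNIV. (w $ l) *\<^sub>R DGam z u v (0, axis l 1))" for u v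
    by (subst axis_expansion[of w]) (simp add: linear_sum[OF l] linear_cmul[OF l])
  have sm: "((\<lambda>z. \<Gamma> z u v $ i) has_derivative (\<lambda>h. DGam z u v h $ i)) (at z)" for u v
    by (rule bounded_linear.has_derivative[OF bounded_linear_vec_nth smooth_on_has_derivative[OF smooth_Gam z]])
  have "DGam z u v h $ i = DD (\<lambda>z. \<Gamma> z u v $ i) z h" for h
    using DD_I[OF sm] by simp
  also have "DD (\<lambda>z. \<Gamma> z u v $ i) z =
      DD (\<lambda>z. \<Sum>j\<in>UNIV. \<Sum>k\<in>UNIV. u $ j * v $ k * \<Gamma> z (axis j 1) (axis k 1) $ i) z"
    by (rule DD_cong[OF open_Z z]) (simp add: Gam_expansion)
  also have "\<dots> = (\<lambda>h. \<Sum>j\<in>UNIV. \<Sum>k\<in>UNIV. u $ j * v $ k * DGam z (axis j 1) (axis k 1) h $ i)"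
    by (intro DD_I has_derivative_sum has_derivative_mult_right sm)
  finally have "DGam z u v (0, w) $ i = (\<Sum>j\<in>UNIV. \<Sum>k\<in>UNIV. u $ j * v $ k * DGam z (axis j 1) (axis k 1) (0, w) $ i)" .
  then show ?thesis unfolding 1[of "axis _ 1"] by (simp add: sum_distrib_left mult.assoc)
qed

end

context finsler_field
begin

lemma chern_tensor_chart:
  assumes c: "c \<in> M" "p \<in> cdom c" and v: "(p, v) \<in> A"
  shows "chern_tensor M A L p v X Y W c = DD (\<lambda>z. lGam (lag c) z (X c) (Y c)) (cmap c p, v c) (0, W c)"
proof -
  interpret lg: lagrangian "lag_dom c" "lag c" by (rule lagrangian_chart[OF c(1)])
  have z: "(cmap c p, v c) \<in> lag_dom c" by (rule lag_dom_I[OF v c(2)])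
  have "deriv (\<lambda>h. christoffel M A L c (p, v + h *\<^sub>R coord_field M c l p) i j k) 0 =
      lg.DGam (cmap c p, v c) (axis j 1) (axis k 1) (0, axis l 1) $ i" for i j k l
  proof -
    \<comment> \<open>\<open>christoffel_eq\<close> applies at vectors of \<open>A\<close> only. For
      small \<open>h\<close> the shifted vector remains in the open set \<open>A\<close>, which
      suffices for the derivative at 0.\<close>
    have "christoffel M A L c (p, v + h *\<^sub>R coord_field M c l p) i j k =
        lGam (lag c) ((cmap c p, v c) + h *\<^sub>R (0, axis l 1)) (axis j 1) (axis k 1) $ i"
      if "(cmap c p, v c) + h *\<^sub>R (0, axis l 1) \<in> lag_dom c" for h
    proof -
      let ?w = "v + h *\<^sub>R coord_field M c l p"
      have w: "?w \<in> TS p" "?w c = v c + h *\<^sub>R axis l 1"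
        using A_tangent[OF v] c
        by (auto simp: coord_field_def coord_vec_same intro!: tangent_add tangent_scaleR coord_vec_tangent)
      then have "(p, ?w) \<in> A" using lag_dom_iff[OF w(1) c] that unfolding w(2) by simp
      from christoffel_eq[OF c this, of i j k] show ?thesis unfolding w(2) by simp
    qed
    then have "deriv (\<lambda>h. christoffel M A L c (p, v + h *\<^sub>R coord_field M c l p) i j k) 0 =
        deriv (\<lambda>h. lGam (lag c) ((cmap c p, v c) + h *\<^sub>R (0, axis l 1)) (axis j 1) (axis k 1) $ i) 0"
      by (intro deriv_cong_ev[OF _ refl] eventually_mono[OF eventually_line_in[OF lg.open_Z z]])
    also have "\<dots> = DD (\<lambda>z. lGam (lag c) z (axis j 1) (axis k 1) $ i) (cmap c p, v c) (0, axis l 1)"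
      by (rule deriv_line_0[OF smooth_on_differentiable[OF smooth_on_vec_nth[OF lg.open_Z lg.smooth_Gam] z]])
    also have "\<dots> = lg.DGam (cmap c p, v c) (axis j 1) (axis k 1) (0, axis l 1) $ i"
      using DD_I[OF bounded_linear.has_derivative[OF bounded_linear_vec_nth smooth_on_has_derivative[OF lg.smooth_Gam z]]]
      by simp
    finally show ?thesis .
  qed
  then show ?thesis
    by (simp add: chern_tensor_def at_chart_apply c lg.DGam_expansion[OF z] vec_eq_iff)
qed

text \<open>The reference vector moves with \<open>V\<close>, so the symbols are differentiated in
  the phase space direction \<open>(h, DD (rep c V) x h)\<close>. Its second entry is the place
  where the Chern tensor enters the curvature.\<close>

lemma DD_rep_nabla:
  assumes c: "c \<in> M" "p \<in> cdom c" and p: "p \<in> \<Omega>" and XY: "sf X" "sf Y"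
  defines "x \<equiv> cmap c p" and "z \<equiv> (cmap c p, V p c)"
  shows "DD (rep c (nabla V X Y)) x h = DD (\<lambda>x. DD (rep c Y) x (X p c)) x h + DD (rep c Y) x (DD (rep c X) x h)
     + DD (\<lambda>z. lGam (lag c) z (X p c) (Y p c)) z (h, DD (rep c V) x h)
     + lGam (lag c) z (DD (rep c X) x h) (Y p c) + lGam (lag c) z (X p c) (DD (rep c Y) x h)"
proof -
  interpret lg: lagrangian "lag_dom c" "lag c" by (rule lagrangian_chart[OF c(1)])
  let ?O = "cmap c ` (\<Omega> \<inter> cdom c)"
  note O = open_cmap_image[OF c(1) open_\<Omega>]
  note r = smooth_on_rep[OF _ c(1)]
  have x: "x \<in> ?O" unfolding x_def using p c by blast
  have rX: "rep c X x = X p c" "rep c Y x = Y p c" "rep c V x = V p c" unfolding x_def by (simp_all add: rep_cmap[OF c])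
  have sV: "smooth_on ?O (\<lambda>x. (x, rep c V x))" by (intro smooth_on_Pair O smooth_on_id r sfV)
  have s1: "smooth_on ?O (\<lambda>x. DD (rep c Y) x (rep c X x))" by (intro smooth_on_DD_var O r XY)
  have s2: "smooth_on ?O (\<lambda>x. lGam (lag c) (x, rep c V x) (rep c X x) (rep c Y x))"
    by (intro lg.smooth_Gam_comp O chart_point[OF c(1)] sV r XY)
  have 1: "DD (rep c (nabla V X Y)) x =
      DD (\<lambda>x. DD (rep c Y) x (rep c X x) + lGam (lag c) (x, rep c V x) (rep c X x) (rep c Y x)) x"
    by (rule DD_cong[OF O x]) (rule rep_nabla[OF c(1)])
  have 2: "DD (\<lambda>x. DD (rep c Y) x (rep c X x) + lGam (lag c) (x, rep c V x) (rep c X x) (rep c Y x)) x =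
      (\<lambda>h. DD (\<lambda>x. DD (rep c Y) x (rep c X x)) x h +
      DD (\<lambda>x. lGam (lag c) (x, rep c V x) (rep c X x) (rep c Y x)) x h)"
    by (rule DD_I[OF has_derivative_add[OF smooth_on_has_derivative[OF s1 x] smooth_on_has_derivative[OF s2 x]]])
  have 3: "DD (\<lambda>x. DD (rep c Y) x (rep c X x)) x h =
      DD (\<lambda>x'. DD (rep c Y) x' (rep c X x)) x h + DD (rep c Y) x (DD (rep c X) x h)"
    by (rule DD_linear_family[OF O linear_DD[OF r[OF XY(2)]] smooth_on_DD[OF r[OF XY(2)]] r[OF XY(1)] x])
  have 4: "DD (\<lambda>x. lGam (lag c) (x, rep c V x) (rep c X x) (rep c Y x)) x h =
      DD (\<lambda>z. lGam (lag c) z (rep c X x) (rep c Y x)) (x, rep c V x) (DD (\<lambda>x. (x, rep c V x)) x h)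
      + lGam (lag c) (x, rep c V x) (DD (rep c X) x h) (rep c Y x)
      + lGam (lag c) (x, rep c V x) (rep c X x) (DD (rep c Y) x h)"
    by (rule lg.DD_Gam_comp[where f = "\<lambda>x. (x, rep c V x)"])
      (assumption | rule O chart_point[OF c(1)] sV r[OF XY(1)] r[OF XY(2)] x)+
  have 5: "DD (\<lambda>x. (x, rep c V x)) x h = (h, DD (rep c V) x h)"
    using DD_Pair[of "\<lambda>x. x" x "rep c V" h] smooth_on_differentiable[OF r[OF sfV] x] by simp
  show ?thesis
    unfolding fun_cong[OF trans[OF 1 2]] 3 4 5 rX z_def x_def[symmetric] by (simp only: add.assoc)
qed

lemma connection_smooth:
  "sf X \<Longrightarrow> sf Y \<Longrightarrow> sf (chern_connection M L \<Omega> V X Y)"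
  by (rule smooth_field_cong[OF nabla_smooth open_\<Omega>]) (simp_all add: chern_connection_eq)

lemma connection_nabla_coord:
  "c \<in> M \<Longrightarrow> p \<in> cdom c \<Longrightarrow> p \<in> \<Omega> \<Longrightarrow> sf X \<Longrightarrow> sf Y \<Longrightarrow> chern_connection M L \<Omega> V X Y p c = nabla_coord c V X Y p"
  by (simp add: chern_connection_eq nabla_apply)

lemma DD_rep_connection:
  assumes c: "c \<in> M" "p \<in> cdom c" and p: "p \<in> \<Omega>" and XY: "sf X" "sf Y"
  shows "DD (rep c (chern_connection M L \<Omega> V X Y)) (cmap c p) = DD (rep c (nabla V X Y)) (cmap c p)"
proof (rule DD_cong[OF open_cmap_image[OF c(1) open_\<Omega>]])
  show "rep c (chern_connection M L \<Omega> V X Y) y = rep c (nabla V X Y) y" if "y \<in> cmap c ` (\<Omega> \<inter> cdom c)" for y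
    using cinv_mem[OF c(1) that] XY by (simp add: rep_def chern_connection_eq)
qed (use c p in blast)

text \<open>All derivatives of \<open>Y\<close> cancel, and the bracket term removes the derivatives
  of \<open>V\<close> and \<open>X\<close> from the arguments of \<Gamma>. The derivative of
  \<open>V\<close> along \<open>X\<close> survives as vertical direction of a derivative of
  \<Gamma>; the Chern tensor on [X, V] replaces it there by the derivative of \<open>X\<close> along
  \<open>V\<close>. The result has the form that a two parameter map produces.\<close>

lemma curvature_chart:
  assumes c: "c \<in> M" "p \<in> cdom c" and p: "p \<in> \<Omega>" and XY: "sf X" "sf Y"
  defines "x \<equiv> cmap c p" and "z \<equiv> (cmap c p, V p c)" and "G \<equiv> lGam (lag c)"
    and "v \<equiv> V p c" and "u \<equiv> X p c" and "w \<equiv> Y p c"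
  shows "(curvature M (chern_connection M L \<Omega> V) V X Y p +
      chern_tensor M A L p (V p) (V p) (Y p) (lie_bracket M X V p)) c =
    DD (\<lambda>z. G z w u) z (v, DD (rep c V) x v) - DD (\<lambda>z. G z w v) z (u, DD (rep c X) x v)
    + G z (G z w u) v - G z (G z w v) u"
proof -
  interpret lg: lagrangian "lag_dom c" "lag c" by (rule lagrangian_chart[OF c(1)])
  have z: "z \<in> lag_dom c" unfolding z_def by (rule lag_dom_I[OF VA[OF p] c(2)])
  let ?N = "chern_connection M L \<Omega> V"
  let ?O = "cmap c ` (\<Omega> \<inter> cdom c)"
  note O = open_cmap_image[OF c(1) open_\<Omega>]
  have xO: "x \<in> ?O" unfolding x_def using p c by blast
  note sm = smooth_on_rep[OF _ c(1)]
  define DV DX DY where "DV = DD (rep c V) x" and "DX = DD (rep c X) x" and "DY = DD (rep c Y) x"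
  define D2 where "D2 h k = DD (\<lambda>x. DD (rep c Y) x h) x k" for h k
  have D2s: "D2 h k = D2 k h" for h k
    unfolding D2_def by (rule DD_symmetric[OF O xO sm[OF XY(2)]])
  have lDY: "linear DY" unfolding DY_def by (rule linear_DD[OF sm[OF XY(2)] xO])
  note simps = linear_add[OF lDY] linear_diff[OF lDY] linear_add[OF lg.linear_Gam1[OF z]] linear_add[OF lg.linear_Gam2[OF z]]
    linear_diff[OF lg.linear_Gam1[OF z]] linear_diff[OF lg.linear_Gam2[OF z]]
  have NVXY: "?N V (?N X Y) p c = D2 u v + DY (DX v) + DD (\<lambda>z. G z u w) z (v, DV v) + G z (DX v) w + G z u (DY v)
      + G z v (DY u + G z u w)"
    unfolding connection_nabla_coord[OF c p sfV connection_smooth[OF XY]]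
    unfolding nabla_coord_def DD_rep_connection[OF c p XY] DD_rep_nabla[OF c p XY] connection_nabla_coord[OF c p XY]
    by (simp add: D2_def DY_def DX_def DV_def G_def u_def v_def w_def z_def x_def)
  have NXVY: "?N X (?N V Y) p c = D2 v u + DY (DV u) + DD (\<lambda>z. G z v w) z (u, DV u) + G z (DV u) w + G z v (DY u)
      + G z u (DY v + G z v w)"
    unfolding connection_nabla_coord[OF c p XY(1) connection_smooth[OF sfV XY(2)]]
    unfolding nabla_coord_def DD_rep_connection[OF c p sfV XY(2)] DD_rep_nabla[OF c p sfV XY(2)] connection_nabla_coord[OF c p sfV XY(2)]
    by (simp add: D2_def DY_def DX_def DV_def G_def u_def v_def w_def z_def x_def)
  have lieVX: "lie_bracket M V X p c = DX v - DV u" and lieXV: "lie_bracket M X V p c = DV u - DX v"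
    by (simp_all add: lie_bracket_coord at_chart_apply c bracket_def DX_def DV_def u_def v_def x_def)
  have NL: "?N (lie_bracket M V X) Y p c = DY (DX v - DV u) + G z (DX v - DV u) w"
    unfolding connection_nabla_coord[OF c p lie_bracket_smooth_field[OF sfV XY(1) open_\<Omega>] XY(2)]
    by (simp add: nabla_coord_def lieVX DY_def G_def w_def z_def x_def)
  have P: "chern_tensor M A L p (V p) (V p) (Y p) (lie_bracket M X V p) c = DD (\<lambda>z. G z v w) z (0, DV u - DX v)"
    unfolding chern_tensor_chart[OF c VA[OF p]] lieXV by (simp add: G_def v_def w_def z_def)
  have "DD (\<lambda>z. G z v w) z (u, DX v) = DD (\<lambda>z. G z v w) z (u, DV u) - DD (\<lambda>z. G z v w) z (0, DV u - DX v)"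
    using linear_diff[OF lg.linear_DGam[OF z], of v w "(u, DV u)" "(0, DV u - DX v)"] by (simp add: G_def)
  moreover have "DD (\<lambda>z. G z w u) z h = DD (\<lambda>z. G z u w) z h" "DD (\<lambda>z. G z w v) z h = DD (\<lambda>z. G z v w) z h" for h
    unfolding G_def by (rule lg.DGam_sym[OF z])+
  moreover have "G z (G z w u) v = G z v (G z u w)" "G z (G z w v) u = G z u (G z v w)"
    unfolding G_def using lg.Gam_sym[OF z] by metis+
  ultimately show ?thesis
    unfolding curvature_def plus_fun_apply fun_diff_def NVXY NXVY NL P DV_def[symmetric] DX_def[symmetric]
    using D2s[of u v] by (simp add: simps[folded G_def])
qed

end

section \<open>Curvature of two parameter maps\<close>

text \<open>\<open>\<Lambda>'\<close> extends \<Lambda> smoothly past the end points of [a, b] and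
  supplies two-sided derivatives, whereas admissibility is known on the strip \<open>I\<close> only.
  Everything is read in the one chart \<open>c\<close>.\<close>

locale two_param_chart = finsler M A L
  for M :: "('m::{t2_space,second_countable_topology}, 'n::finite) chart set" and A L +
  fixes a b a' b' \<epsilon> :: real and \<Lambda> \<Lambda>' :: "real \<times> real \<Rightarrow> 'm" and c :: "('m, 'n) chart"
  assumes ab: "a < b" "a' < a" "b < b'" and c: "c \<in> M"
    and smooth: "smooth_map M ({a'<..<b'} \<times> {-\<epsilon><..<\<epsilon>}) \<Lambda>'"
    and agree: "\<And>x. x \<in> {a..b} \<times> {-\<epsilon><..<\<epsilon>} \<Longrightarrow> \<Lambda>' x = \<Lambda> x"
    and adm: "\<And>x. x \<in> {a..b} \<times> {-\<epsilon><..<\<epsilon>} \<Longrightarrow> (\<Lambda> x, partial_t M a b \<Lambda> x) \<in> A"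
begin

abbreviation "I \<equiv> {a..b} \<times> {-\<epsilon><..<\<epsilon>}"
definition "J = ({a'<..<b'} \<times> {-\<epsilon><..<\<epsilon>}) \<inter> \<Lambda>' -` cdom c"
definition "lam = cmap c \<circ> \<Lambda>'"
definition "zz x = (lam x, DD lam x (1, 0))"
text \<open>The extension need not be admissible beyond \<open>I\<close>; \<open>Q\<close> is the
  open set where it is. By \<open>Q_I\<close> it contains all points of \<open>I\<close> that
  \<Lambda> maps into the chart.\<close>

definition "Q = J \<inter> zz -` lag_dom c"
definition cov :: "(real \<times> real \<Rightarrow> real ^ 'n) \<Rightarrow> real \<times> real \<Rightarrow> real \<times> real \<Rightarrow> real ^ 'n" where
  "cov f x h = DD f x h + lGam (lag c) (zz x) (f x) (DD lam x h)"

lemma open_J: "open J"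
  unfolding J_def using smooth open_cdom[OF c] unfolding smooth_map_def
  by (intro continuous_open_preimage open_Times) auto

lemma smooth_lam: "smooth_on J lam"
  using smooth c unfolding smooth_map_def J_def lam_def by (elim conjE) (erule bspec)

lemma smooth_zz: "smooth_on J zz"
  unfolding zz_def by (intro smooth_on_Pair open_J smooth_lam smooth_on_DD)

lemma open_Q: "open Q"
  unfolding Q_def by (rule continuous_open_preimage[OF smooth_on_continuous[OF smooth_zz] open_J open_lag_dom[OF c]])

lemma Q_J: "x \<in> Q \<Longrightarrow> x \<in> J" and zz_lag_dom: "x \<in> Q \<Longrightarrow> zz x \<in> lag_dom c"
  by (auto simp: Q_def)

lemma J_cdom: "x \<in> J \<Longrightarrow> \<Lambda>' x \<in> cdom c" by (simp add: J_def)

lemma lam_eq: "x \<in> I \<Longrightarrow> lam x = cmap c (\<Lambda> x)"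
  using agree by (simp add: lam_def)

lemma partial_vd:
  fixes F :: "real \<times> real \<Rightarrow> real ^ 'n"
  assumes "F differentiable (at (t, s))" "open T" "(t, s) \<in> T" "(t, s) \<in> I"
    "\<And>y. y \<in> T \<Longrightarrow> y \<in> I \<Longrightarrow> G y = F y"
  shows "vector_derivative (\<lambda>\<tau>. G (\<tau>, s)) (at t within {a..b}) = DD F (t, s) (1, 0)"
    and "vector_derivative (\<lambda>\<sigma>. G (t, \<sigma>)) (at s within {-\<epsilon><..<\<epsilon>}) = DD F (t, s) (0, 1)"
proof -
  have T: "open ((\<lambda>\<tau>. (\<tau>, s)) -` T)" "open ((\<lambda>\<sigma>. (t, \<sigma>)) -` T)"
    by (auto intro!: open_vimage[OF assms(2)] continuous_intros)
  show "vector_derivative (\<lambda>\<tau>. G (\<tau>, s)) (at t within {a..b}) = DD F (t, s) (1, 0)"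
    by (rule vector_derivative_within_eqI[OF DD_comp_curve[OF assms(1) pair_has_vector_derivative(1)] _ T(1)])
      (use assms at_within_Icc_neq_bot[OF ab(1)] in auto)
  show "vector_derivative (\<lambda>\<sigma>. G (t, \<sigma>)) (at s within {-\<epsilon><..<\<epsilon>}) = DD F (t, s) (0, 1)"
    by (rule vector_derivative_within_eqI[OF DD_comp_curve[OF assms(1) pair_has_vector_derivative(2)] _ T(2)])
      (use assms in \<open>auto simp: at_within_open[of s "{-\<epsilon><..<\<epsilon>}"]\<close>)
qed

lemma partial_t_chart: "x \<in> I \<Longrightarrow> x \<in> J \<Longrightarrow> partial_t M a b \<Lambda> x c = DD lam x (1, 0)"
  and partial_s_chart: "x \<in> I \<Longrightarrow> x \<in> J \<Longrightarrow> partial_s M \<epsilon> \<Lambda> x c = DD lam x (0, 1)"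
proof -
  assume x: "x \<in> I" "x \<in> J"
  obtain t s where ts: "x = (t, s)" by (cases x)
  note pv = partial_vd[OF smooth_on_differentiable[OF smooth_lam] open_J, of t s "\<lambda>y. cmap c (\<Lambda> y)"]
  have "\<Lambda> x \<in> cdom c" using J_cdom[OF x(2)] agree[OF x(1)] by simp
  then show "partial_t M a b \<Lambda> x c = DD lam x (1, 0)" "partial_s M \<epsilon> \<Lambda> x c = DD lam x (0, 1)"
    using pv x lam_eq by (simp_all add: partial_t_def partial_s_def velocity_def at_chart_apply c ts)
qed

lemma Q_I: "x \<in> I \<Longrightarrow> \<Lambda> x \<in> cdom c \<Longrightarrow> x \<in> Q"
proof -
  assume x: "x \<in> I" "\<Lambda> x \<in> cdom c"
  then have J: "x \<in> J" using agree[OF x(1)] ab by (auto simp: J_def)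
  have "zz x \<in> lag_dom c"
    using lag_dom_I[OF adm[OF x(1)] x(2)] partial_t_chart[OF x(1) J] lam_eq[OF x(1)] by (simp add: zz_def)
  then show ?thesis using J by (simp add: Q_def)
qed

lemma cov_deriv_chart:
  assumes f: "smooth_on Q f" and F: "\<And>y. y \<in> Q \<Longrightarrow> y \<in> I \<Longrightarrow> F y c = f y" and x: "x \<in> I" "x \<in> Q"
  shows "cov_deriv_t M A L a b \<Lambda> F x c = cov f x (1, 0)"
    and "cov_deriv_s M A L a b \<epsilon> \<Lambda> F x c = cov f x (0, 1)"
proof -
  interpret lg: lagrangian "lag_dom c" "lag c" by (rule lagrangian_chart[OF c])
  obtain t s where ts: "x = (t, s)" by (cases x)
  have xc: "\<Lambda> x \<in> cdom c" using J_cdom[OF Q_J[OF x(2)]] agree[OF x(1)] by simp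
  note pv = partial_vd[OF smooth_on_differentiable[OF f] open_Q, of t s "\<lambda>y. F y c"]
  have z: "(cmap c (\<Lambda> x), partial_t M a b \<Lambda> x c) = zz x"
    using partial_t_chart[OF x(1) Q_J[OF x(2)]] lam_eq[OF x(1)] by (simp add: zz_def)
  have ch: "christoffel M A L c (\<Lambda> x, partial_t M a b \<Lambda> x) i j k = lGam (lag c) (zz x) (axis j 1) (axis k 1) $ i" for i j k
    using christoffel_eq[OF c xc adm[OF x(1)]] z by simp
  have vt: "velocity M {a..b} (\<lambda>\<tau>. \<Lambda> (\<tau>, s)) t c = DD lam x (1, 0)"
    using partial_t_chart[OF x(1) Q_J[OF x(2)]] by (simp add: partial_t_def ts)
  have vs: "velocity M {-\<epsilon><..<\<epsilon>} (\<lambda>\<sigma>. \<Lambda> (t, \<sigma>)) s c = DD lam x (0, 1)"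
    using partial_s_chart[OF x(1) Q_J[OF x(2)]] by (simp add: partial_s_def ts)
  have G: "(\<chi> i. \<Sum>j\<in>UNIV. \<Sum>k\<in>UNIV. f x $ j * h $ k * lGam (lag c) (zz x) (axis j 1) (axis k 1) $ i) =
      lGam (lag c) (zz x) (f x) h" for h
    using lg.Gam_expansion[OF zz_lag_dom[OF x(2)]] by (simp add: vec_eq_iff)
  have "vector_derivative (\<lambda>\<tau>. F (\<tau>, s) c) (at t within {a..b}) = DD f x (1, 0)"
    "vector_derivative (\<lambda>\<sigma>. F (t, \<sigma>) c) (at s within {-\<epsilon><..<\<epsilon>}) = DD f x (0, 1)"
    using pv x F by (simp_all add: ts)
  then show "cov_deriv_t M A L a b \<Lambda> F x c = cov f x (1, 0)"
    "cov_deriv_s M A L a b \<epsilon> \<Lambda> F x c = cov f x (0, 1)"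
    using xc F[OF x(2,1)] G[of "DD lam x (1, 0)"] G[of "DD lam x (0, 1)"] vt vs ch
    by (simp_all add: cov_deriv_t_def cov_deriv_s_def cov_deriv_def cov_def at_chart_apply c ts)
qed

lemma smooth_cov: "smooth_on Q f \<Longrightarrow> smooth_on Q (\<lambda>x. cov f x h)"
proof -
  assume f: "smooth_on Q f"
  interpret lg: lagrangian "lag_dom c" "lag c" by (rule lagrangian_chart[OF c])
  have sub: "Q \<subseteq> J" using Q_J by blast
  show ?thesis
    unfolding cov_def
    by (intro smooth_on_add open_Q smooth_on_DD f lg.smooth_Gam_comp zz_lag_dom
        smooth_on_subset[OF smooth_zz sub] smooth_on_subset[OF smooth_lam sub])
qed

text \<open>The first covariant derivatives are known at all points of \<open>I\<close> in
  \<open>Q\<close> and have the smooth extensions \<open>cov f _ h\<close>; so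
  \<open>cov_deriv_chart\<close> applies a second time.\<close>

lemma curv_two_param_cov:
  assumes f: "smooth_on Q f" and F: "\<And>y. y \<in> Q \<Longrightarrow> y \<in> I \<Longrightarrow> F y c = f y" and x: "x \<in> I" "x \<in> Q"
  shows "curv_two_param M A L a b \<epsilon> \<Lambda> F x c = cov (\<lambda>y. cov f y (0, 1)) x (1, 0) - cov (\<lambda>y. cov f y (1, 0)) x (0, 1)"
proof -
  have 1: "cov_deriv_s M A L a b \<epsilon> \<Lambda> F y c = cov f y (0, 1)"
    and 2: "cov_deriv_t M A L a b \<Lambda> F y c = cov f y (1, 0)" if "y \<in> Q" "y \<in> I" for y
    by (rule cov_deriv_chart[where f = f and F = F, OF f F that(2,1)], assumption+)+
  have "cov_deriv_t M A L a b \<Lambda> (cov_deriv_s M A L a b \<epsilon> \<Lambda> F) x c = cov (\<lambda>y. cov f y (0, 1)) x (1, 0)"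
    by (rule cov_deriv_chart(1)[where f = "\<lambda>y. cov f y (0, 1)" and F = "cov_deriv_s M A L a b \<epsilon> \<Lambda> F", OF smooth_cov[OF f] 1 x])
  moreover have "cov_deriv_s M A L a b \<epsilon> \<Lambda> (cov_deriv_t M A L a b \<Lambda> F) x c = cov (\<lambda>y. cov f y (1, 0)) x (0, 1)"
    by (rule cov_deriv_chart(2)[where f = "\<lambda>y. cov f y (1, 0)" and F = "cov_deriv_t M A L a b \<Lambda> F", OF smooth_cov[OF f] 2 x])
  ultimately show ?thesis by (simp add: curv_two_param_def)
qed

text \<open>Equality of mixed partials removes the second derivatives of \<open>f\<close> and of
  \<open>lam\<close>, and the terms with one derivative of \<open>f\<close> are symmetric in the two
  directions. Only derivatives of the symbols and their quadratic terms remain.\<close>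

lemma cov_commutator:
  assumes f: "smooth_on Q f" and x: "x \<in> Q"
  defines "z \<equiv> zz x" and "G \<equiv> lGam (lag c)" and "w \<equiv> f x" and "v \<equiv> DD lam x (1, 0)" and "u \<equiv> DD lam x (0, 1)"
  shows "cov (\<lambda>y. cov f y (0, 1)) x (1, 0) - cov (\<lambda>y. cov f y (1, 0)) x (0, 1) =
    DD (\<lambda>z. G z w u) z (DD zz x (1, 0)) - DD (\<lambda>z. G z w v) z (DD zz x (0, 1))
    + G z (G z w u) v - G z (G z w v) u"
proof -
  interpret lg: lagrangian "lag_dom c" "lag c" by (rule lagrangian_chart[OF c])
  have z: "z \<in> lag_dom c" unfolding z_def by (rule zz_lag_dom[OF x])
  have sub: "Q \<subseteq> J" using Q_J by blast
  note sz = smooth_on_subset[OF smooth_zz sub] and sl = smooth_on_subset[OF smooth_lam sub]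
  have D: "DD (\<lambda>y. cov f y k) x h = DD (\<lambda>y. DD f y k) x h + DD (\<lambda>z. G z w (DD lam x k)) z (DD zz x h)
      + G z (DD f x h) (DD lam x k) + G z w (DD (\<lambda>y. DD lam y k) x h)" for h k
  proof -
    have s2: "smooth_on Q (\<lambda>y. lGam (lag c) (zz y) (f y) (DD lam y k))"
      by (intro lg.smooth_Gam_comp open_Q zz_lag_dom sz f smooth_on_DD sl)
    have "DD (\<lambda>y. cov f y k) x h = DD (\<lambda>y. DD f y k) x h + DD (\<lambda>y. lGam (lag c) (zz y) (f y) (DD lam y k)) x h"
      unfolding cov_def
      using DD_I[OF has_derivative_add[OF smooth_on_has_derivative[OF smooth_on_DD[OF f] x] smooth_on_has_derivative[OF s2 x]]]
      by simp
    also have "DD (\<lambda>y. lGam (lag c) (zz y) (f y) (DD lam y k)) x h =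
        DD (\<lambda>z. lGam (lag c) z (f x) (DD lam x k)) (zz x) (DD zz x h)
        + lGam (lag c) (zz x) (DD f x h) (DD lam x k) + lGam (lag c) (zz x) (f x) (DD (\<lambda>y. DD lam y k) x h)"
      by (rule lg.DD_Gam_comp[where f = zz])
        (assumption | rule open_Q zz_lag_dom sz f smooth_on_DD[OF sl] x)+
    finally show ?thesis by (simp add: z_def G_def w_def)
  qed
  have c': "cov F x h = DD F x h + G z (F x) (DD lam x h)" for F h by (simp add: cov_def z_def G_def)
  have s: "DD (\<lambda>y. DD f y (0, 1)) x (1, 0) = DD (\<lambda>y. DD f y (1, 0)) x (0, 1)"
    "DD (\<lambda>y. DD lam y (0, 1)) x (1, 0) = DD (\<lambda>y. DD lam y (1, 0)) x (0, 1)"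
    by (rule DD_symmetric[OF open_Q x f]) (rule DD_symmetric[OF open_Q x sl])
  show ?thesis
    unfolding c' D v_def[symmetric] u_def[symmetric] w_def[symmetric]
    using s by (simp add: linear_add[OF lg.linear_Gam1[OF z], folded G_def])
qed

end

text \<open>The variation and \<open>F\<close> are arbitrary and tied to the fields on the axis s =
  0 only. This is enough, since after \<open>cov_commutator\<close> no derivative of
  \<open>F\<close> survives and only the values and first derivatives of \<open>zz\<close> on the
  axis are needed.\<close>

lemma (in finsler_field) curv_two_param_eq:
  assumes ab: "a < b" and \<epsilon>: "\<epsilon> > 0" and adm\<Lambda>: "admissible_two_param M A a b \<epsilon> \<Lambda>"
    and F: "smooth_field_on_two_param M a b \<epsilon> \<Lambda> F"
    and on: "\<And>t. t \<in> {a..b} \<Longrightarrow> \<Lambda> (t, 0) \<in> \<Omega>" "\<And>t. t \<in> {a..b} \<Longrightarrow> partial_t M a b \<Lambda> (t, 0) = V (\<Lambda> (t, 0))"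
      "\<And>t. t \<in> {a..b} \<Longrightarrow> partial_s M \<epsilon> \<Lambda> (t, 0) = X (\<Lambda> (t, 0))" "\<And>t. t \<in> {a..b} \<Longrightarrow> F (t, 0) = Y (\<Lambda> (t, 0))"
    and XY: "sf X" "sf Y" and t: "t \<in> {a..b}"
  defines "p \<equiv> \<Lambda> (t, 0)"
  shows "curv_two_param M A L a b \<epsilon> \<Lambda> F (t, 0) = curvature M (chern_connection M L \<Omega> V) V X Y p +
    chern_tensor M A L p (V p) (V p) (Y p) (lie_bracket M X V p)"
proof
  fix c
  have p: "p \<in> \<Omega>" unfolding p_def by (rule on(1)[OF t])
  show "curv_two_param M A L a b \<epsilon> \<Lambda> F (t, 0) c = (curvature M (chern_connection M L \<Omega> V) V X Y p +
    chern_tensor M A L p (V p) (V p) (Y p) (lie_bracket M X V p)) c"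
  proof (cases "c \<in> M \<and> p \<in> cdom c")
    \<comment> \<open>Away from the charts around \<open>p\<close> both sides have component 0, by
      the convention for tangent vectors.\<close>
    case False
    have "chern_connection M L \<Omega> V X Y p c = 0" if "sf X" "sf Y" for X Y
      by (rule tangent_out[OF smooth_field_tangent[OF connection_smooth[OF that] p] False])
    then show ?thesis
      using False lie_bracket_smooth_field[OF sfV XY(1) open_\<Omega>]
      by (auto simp: curvature_def chern_tensor_def at_chart_apply connection_smooth XY sfV p_def
          curv_two_param_def cov_deriv_t_def cov_deriv_s_def cov_deriv_def)
  next
    case True
    then have c: "c \<in> M" "p \<in> cdom c" by auto
    obtain a' b' \<Lambda>' W' where \<Lambda>': "a' < a" "b < b'" "smooth_map M ({a'<..<b'} \<times> {-\<epsilon><..<\<epsilon>}) \<Lambda>'"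
        "smooth_field_along M ({a'<..<b'} \<times> {-\<epsilon><..<\<epsilon>}) \<Lambda>' W'"
        "\<And>x. x \<in> {a..b} \<times> {-\<epsilon><..<\<epsilon>} \<Longrightarrow> \<Lambda>' x = \<Lambda> x" "\<And>x. x \<in> {a..b} \<times> {-\<epsilon><..<\<epsilon>} \<Longrightarrow> W' x = F x"
      using F unfolding smooth_field_on_two_param_def by blast
    interpret tp: two_param_chart M A L a b a' b' \<epsilon> \<Lambda> \<Lambda>' c
      using adm\<Lambda> ab \<Lambda>' c by unfold_locales (auto simp: admissible_two_param_def)
    interpret lg: lagrangian "lag_dom c" "lag c" by (rule lagrangian_chart[OF c(1)])
    let ?x = "(t, 0::real)"
    let ?w = "\<lambda>x. W' x c"
    have xI: "(\<tau>, 0) \<in> {a..b} \<times> {-\<epsilon><..<\<epsilon>}" if "\<tau> \<in> {a..b}" for \<tau> using that \<epsilon> by auto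
    have xQ: "?x \<in> tp.Q" using tp.Q_I[OF xI[OF t]] c(2) by (simp add: p_def)
    have sw: "smooth_on tp.Q ?w"
      by (rule smooth_on_subset[of tp.J])
        (use \<Lambda>'(4) c in \<open>auto simp: smooth_field_along_def tp.J_def tp.Q_def\<close>)
    have sl: "smooth_on tp.Q tp.lam" by (rule smooth_on_subset[OF tp.smooth_lam]) (use tp.Q_J in blast)
    have onQ: "tp.lam (\<tau>, 0) \<in> cmap c ` (\<Omega> \<inter> cdom c)" "DD tp.lam (\<tau>, 0) (1, 0) = rep c V (tp.lam (\<tau>, 0))"
      "DD tp.lam (\<tau>, 0) (0, 1) = rep c X (tp.lam (\<tau>, 0))" "?w (\<tau>, 0) = rep c Y (tp.lam (\<tau>, 0))"
      if "\<tau> \<in> {a..b}" "(\<tau>, 0) \<in> tp.Q" for \<tau>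
    proof -
      note l = tp.lam_eq[OF xI[OF that(1)]]
      have cd: "\<Lambda> (\<tau>, 0) \<in> cdom c" using tp.J_cdom[OF tp.Q_J[OF that(2)]] tp.agree[OF xI[OF that(1)]] by simp
      show "tp.lam (\<tau>, 0) \<in> cmap c ` (\<Omega> \<inter> cdom c)" using l cd on(1)[OF that(1)] by blast
      note rp = rep_cmap[OF c(1) cd]
      show "DD tp.lam (\<tau>, 0) (1, 0) = rep c V (tp.lam (\<tau>, 0))"
        using tp.partial_t_chart[OF xI[OF that(1)] tp.Q_J[OF that(2)]] on(2)[OF that(1)] by (simp add: l rp)
      show "DD tp.lam (\<tau>, 0) (0, 1) = rep c X (tp.lam (\<tau>, 0))"
        using tp.partial_s_chart[OF xI[OF that(1)] tp.Q_J[OF that(2)]] on(3)[OF that(1)] by (simp add: l rp)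
      show "?w (\<tau>, 0) = rep c Y (tp.lam (\<tau>, 0))"
        using \<Lambda>'(6)[OF xI[OF that(1)]] on(4)[OF that(1)] by (simp add: l rp)
    qed
    have val: "tp.lam ?x = cmap c p" "DD tp.lam ?x (1, 0) = V p c" "DD tp.lam ?x (0, 1) = X p c" "?w ?x = Y p c"
      using onQ[OF t xQ] tp.lam_eq[OF xI[OF t]] by (simp_all add: p_def[symmetric] rep_cmap[OF c])
    \<comment> \<open>A function that equals a field read along \<Lambda> on the axis has the same
      t-derivative there. The equality holds only for t in [a, b], hence the comparison of
      derivatives within [a, b].\<close>
    have along: "DD f ?x (1, 0) = DD (rep c Z) (cmap c p) (V p c)"
      if f: "smooth_on tp.Q f" and Z: "sf Z" and eq: "\<And>\<tau>. \<tau> \<in> {a..b} \<Longrightarrow> (\<tau>, 0) \<in> tp.Q \<Longrightarrow> f (\<tau>, 0) = rep c Z (tp.lam (\<tau>, 0))"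
      for f Z
    proof -
      let ?T = "(\<lambda>\<tau>. (\<tau>, 0)) -` tp.Q"
      have T: "open ?T" "t \<in> ?T" using xQ by (auto intro!: open_vimage[OF tp.open_Q] continuous_intros)
      have d: "rep c Z differentiable at (tp.lam ?x)"
        by (rule smooth_on_differentiable[OF smooth_on_rep[OF Z c(1)] onQ(1)[OF t xQ]])
      have 1: "((\<lambda>\<tau>. tp.lam (\<tau>, 0)) has_vector_derivative DD tp.lam ?x (1, 0)) (at t)"
        by (rule DD_comp_curve[OF smooth_on_differentiable[OF sl xQ] pair_has_vector_derivative(1)])
      have 2: "((\<lambda>\<tau>. rep c Z (tp.lam (\<tau>, 0))) has_vector_derivative DD (rep c Z) (tp.lam ?x) (DD tp.lam ?x (1, 0))) (at t)"
        by (rule DD_comp_curve[OF d 1])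
      have 3: "((\<lambda>\<tau>. f (\<tau>, 0)) has_vector_derivative DD f ?x (1, 0)) (at t)"
        by (rule DD_comp_curve[OF smooth_on_differentiable[OF f xQ] pair_has_vector_derivative(1)])
      have nb: "at t within {a..b} \<noteq> bot" by (rule at_within_Icc_neq_bot[OF ab t])
      have "DD f ?x (1, 0) = vector_derivative (\<lambda>\<tau>. f (\<tau>, 0)) (at t within {a..b})"
        by (rule vector_derivative_within_eqI[OF 3 nb T t, symmetric]) simp
      also have "\<dots> = DD (rep c Z) (tp.lam ?x) (DD tp.lam ?x (1, 0))"
        by (rule vector_derivative_within_eqI[OF 2 nb T t]) (use eq in simp)
      finally show ?thesis by (simp add: val)
    qed
    have zz: "tp.zz ?x = (cmap c p, V p c)" by (simp add: tp.zz_def val)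
    have Dzz: "DD tp.zz ?x h = (DD tp.lam ?x h, DD (\<lambda>y. DD tp.lam y (1, 0)) ?x h)" for h
      unfolding tp.zz_def
      by (rule DD_Pair[OF smooth_on_differentiable[OF sl xQ] smooth_on_differentiable[OF smooth_on_DD[OF sl] xQ]])
    have Dt: "DD tp.zz ?x (1, 0) = (V p c, DD (rep c V) (cmap c p) (V p c))"
      unfolding Dzz val using along[OF smooth_on_DD[OF sl] sfV onQ(2)] by simp
    \<comment> \<open>The s-derivative of \<Lambda>_t leaves the axis, off which nothing is
      prescribed; it is exchanged for the t-derivative of \<Lambda>_s, which is \<open>X\<close>
      along the axis.\<close>
    have Ds: "DD tp.zz ?x (0, 1) = (X p c, DD (rep c X) (cmap c p) (V p c))"
      unfolding Dzz val DD_symmetric[OF tp.open_Q xQ sl, of "(1, 0)" "(0, 1)"]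
      using along[OF smooth_on_DD[OF sl] XY(1) onQ(3)] by simp
    have "curv_two_param M A L a b \<epsilon> \<Lambda> F ?x c =
        tp.cov (\<lambda>y. tp.cov ?w y (0, 1)) ?x (1, 0) - tp.cov (\<lambda>y. tp.cov ?w y (1, 0)) ?x (0, 1)"
      by (rule tp.curv_two_param_cov[OF sw _ xI[OF t] xQ]) (use \<Lambda>'(6) in simp)
    then show ?thesis
      unfolding curvature_chart[OF c p XY] tp.cov_commutator[OF sw xQ] zz val Dt Ds .
  qed
qed

section \<open>Variations with prescribed variation field\<close>

lemma DD_eq_partial_s:
  fixes s t :: real
  assumes "F differentiable (at (t, s))" "((\<lambda>\<sigma>. F (t, \<sigma>)) has_vector_derivative D) (at s)"
  shows "DD F (t, s) (0, 1) = D"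
proof -
  have "((\<lambda>\<sigma>. (t, \<sigma>)) has_vector_derivative (0, 1)) (at s)"
      by (rule pair_has_vector_derivative)
  from DD_comp_curve[OF assms(1) this] show ?thesis
    using assms(2) vector_derivative_unique_at by blast
qed

context smooth_mfd
begin

lemma smooth_map_subset: "smooth_map M S f \<Longrightarrow> T \<subseteq> S \<Longrightarrow> smooth_map M T f"
  unfolding smooth_map_def by (meson Int_mono continuous_on_subset order_refl smooth_on_subset)

lemma smooth_map_continuous: "smooth_map M S f \<Longrightarrow> continuous_on S f"
  by (simp add: smooth_map_def)

lemma smooth_map_chart: "smooth_map M S f \<Longrightarrow> c \<in> M \<Longrightarrow> smooth_on (S \<inter> f -` cdom c) (cmap c \<circ> f)"
  by (simp add: smooth_map_def)

lemma open_chart_preimage: "smooth_map M S f \<Longrightarrow> open S \<Longrightarrow> c \<in> M \<Longrightarrow> open (S \<inter> f -` cdom c)"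
  by (rule continuous_open_preimage[OF smooth_map_continuous _ open_cdom])

lemma smooth_map_local:
  assumes "\<And>x. x \<in> S \<Longrightarrow> \<exists>T g. open T \<and> x \<in> T \<and> smooth_map M T g \<and> (\<forall>y\<in>T. f y = g y)"
  shows "smooth_map M S f"
  unfolding smooth_map_def
proof (intro conjI ballI)
  show "continuous_on S f"
  proof (rule continuous_at_imp_continuous_on, rule ballI)
    fix x assume "x \<in> S"
    then obtain T g where T: "open T" "x \<in> T" "smooth_map M T g" "\<forall>y\<in>T. f y = g y" using assms by blast
    then have "continuous_on T f" using smooth_map_continuous[OF T(3)] continuous_on_cong[of T T f g] by simp
    then show "isCont f x" using T continuous_on_eq_continuous_at by blast
  qed
  fix c assume c: "c \<in> M"
  show "smooth_on (S \<inter> f -` cdom c) (cmap c \<circ> f)"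
  proof (rule smooth_on_local_eq)
    fix x assume x: "x \<in> S \<inter> f -` cdom c"
    then obtain T g where T: "open T" "x \<in> T" "smooth_map M T g" "\<forall>y\<in>T. f y = g y" using assms by blast
    show "\<exists>T g. open T \<and> x \<in> T \<and> smooth_on T g \<and> (\<forall>y\<in>T. (cmap c \<circ> f) y = g y)"
      using open_chart_preimage[OF T(3,1) c] smooth_map_chart[OF T(3) c] x T(2,4)
      by (intro exI[of _ "T \<inter> g -` cdom c"] exI[of _ "cmap c \<circ> g"]) auto
  qed
qed

text \<open>For maps built from their coordinates \<open>B\<close> in one chart: smoothness and
  derivatives in all other charts follow through the transition maps.\<close>

lemma smooth_map_cinv:
  assumes c: "c \<in> M" and S: "open S" and B: "smooth_on S B" "\<And>x. x \<in> S \<Longrightarrow> B x \<in> cim c"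
  shows "smooth_map M S (\<lambda>x. cinv c (B x))"
    and "d \<in> M \<Longrightarrow> x \<in> S \<Longrightarrow> cinv c (B x) \<in> cdom d \<Longrightarrow>
      DD (cmap d \<circ> (\<lambda>x. cinv c (B x))) x h = dtr c d (cinv c (B x)) (DD B x h)"
proof -
  have cont: "continuous_on S (\<lambda>x. cinv c (B x))"
    using B by (intro continuous_on_compose2[OF continuous_on_cinv[OF c] smooth_on_continuous[OF B(1)]]) auto
  have in_dom: "B x \<in> cmap c ` (cdom c \<inter> cdom d)" if "x \<in> S" "cinv c (B x) \<in> cdom d" for x d
    using B(2)[OF that(1)] that(2) cinv_cdom[OF c B(2)[OF that(1)]] cmap_cinv[OF c B(2)[OF that(1)]]
    by (metis IntI image_eqI)
  have O: "open (S \<inter> (\<lambda>x. cinv c (B x)) -` cdom d)" if "d \<in> M" for d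
    by (rule continuous_open_preimage[OF cont S open_cdom[OF that]])
  show "smooth_map M S (\<lambda>x. cinv c (B x))"
    unfolding smooth_map_def
  proof (intro conjI ballI cont)
    fix d assume d: "d \<in> M"
    have "smooth_on (S \<inter> (\<lambda>x. cinv c (B x)) -` cdom d) (\<lambda>x. tr c d (B x))"
      by (rule smooth_on_comp[OF O[OF d] open_tr_dom[OF c d] _ smooth_on_tr[OF c d] smooth_on_subset[OF B(1)]])
        (use in_dom in auto)
    then show "smooth_on (S \<inter> (\<lambda>x. cinv c (B x)) -` cdom d) (cmap d \<circ> (\<lambda>x. cinv c (B x)))"
      by (simp add: o_def)
  qed
  assume d: "d \<in> M" "x \<in> S" "cinv c (B x) \<in> cdom d"
  have "DD (\<lambda>x. tr c d (B x)) x h = DD (tr c d) (B x) (DD B x h)"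
    by (rule DD_comp(1)[OF smooth_on_differentiable[OF smooth_on_tr[OF c d(1)] in_dom[OF d(2,3)]]
          smooth_on_differentiable[OF B(1) d(2)]])
  then show "DD (cmap d \<circ> (\<lambda>x. cinv c (B x))) x h = dtr c d (cinv c (B x)) (DD B x h)"
    by (simp add: dtr_def cmap_cinv[OF c B(2)[OF d(2)]] o_def)
qed

end

locale variation_data = smooth_mfd M
  for M :: "('m::{t2_space,second_countable_topology}, 'n::finite) chart set" +
  fixes \<Omega> :: "'m set" and X :: "'m \<Rightarrow> ('m, 'n) tvec" and a' b' a b :: real and \<gamma> :: "real \<Rightarrow> 'm"
  assumes open_\<Omega>: "open \<Omega>" and X: "smooth_field M \<Omega> X" and ab: "a' < a" "a < b" "b < b'"
    and \<gamma>: "smooth_map M {a'<..<b'} \<gamma>" and \<gamma>\<Omega>: "\<gamma> ` {a..b} \<subseteq> \<Omega>"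
begin

text \<open>Local variations over an arbitrary open parameter set, with conditions only on the part
  of the axis inside it. Not prescribing a rectangle makes restriction and gluing easy; a rectangle
  is cut out at the end.\<close>

definition var_on :: "(real \<times> real) set \<Rightarrow> (real \<times> real \<Rightarrow> 'm) \<Rightarrow> bool" where
  "var_on S \<Lambda> \<longleftrightarrow> open S \<and> smooth_map M S \<Lambda> \<and>
     (\<forall>t. (t, 0) \<in> S \<longrightarrow> t \<in> {a'<..<b'} \<and> \<Lambda> (t, 0) = \<gamma> t \<and>
        (\<forall>c\<in>M. \<gamma> t \<in> cdom c \<longrightarrow> DD (cmap c \<circ> \<Lambda>) (t, 0) (0, 1) = X (\<gamma> t) c))"

lemma var_on_open: "var_on S \<Lambda> \<Longrightarrow> open S" and var_on_smooth: "var_on S \<Lambda> \<Longrightarrow> smooth_map M S \<Lambda>"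
  and var_on_axis: "var_on S \<Lambda> \<Longrightarrow> (t, 0) \<in> S \<Longrightarrow> \<Lambda> (t, 0) = \<gamma> t"
  and var_on_DD: "var_on S \<Lambda> \<Longrightarrow> (t, 0) \<in> S \<Longrightarrow> c \<in> M \<Longrightarrow> \<gamma> t \<in> cdom c \<Longrightarrow>
    DD (cmap c \<circ> \<Lambda>) (t, 0) (0, 1) = X (\<gamma> t) c"
  by (simp_all add: var_on_def)

lemma var_on_subset: "var_on S \<Lambda> \<Longrightarrow> open T \<Longrightarrow> T \<subseteq> S \<Longrightarrow> var_on T \<Lambda>"
  unfolding var_on_def using smooth_map_subset by blast

lemma var_on_local:
  assumes S: "open S" and loc: "\<And>x. x \<in> S \<Longrightarrow> \<exists>T \<Lambda>'. x \<in> T \<and> var_on T \<Lambda>' \<and> (\<forall>y\<in>T. \<Lambda> y = \<Lambda>' y)"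
  shows "var_on S \<Lambda>"
  unfolding var_on_def
proof (intro conjI allI impI S)
  show "smooth_map M S \<Lambda>"
    by (rule smooth_map_local) (use loc var_on_open var_on_smooth in metis)
  fix t assume "(t, 0) \<in> S"
  then obtain T \<Lambda>' where T: "(t, 0) \<in> T" "var_on T \<Lambda>'" "\<forall>y\<in>T. \<Lambda> y = \<Lambda>' y" using loc by blast
  then show "t \<in> {a'<..<b'}" "\<Lambda> (t, 0) = \<gamma> t" by (simp_all add: var_on_def)
  show "\<forall>c\<in>M. \<gamma> t \<in> cdom c \<longrightarrow> DD (cmap c \<circ> \<Lambda>) (t, 0) (0, 1) = X (\<gamma> t) c"
  proof (intro ballI impI)
    fix c assume c: "c \<in> M" "\<gamma> t \<in> cdom c"
    have "DD (cmap c \<circ> \<Lambda>) (t, 0) = DD (cmap c \<circ> \<Lambda>') (t, 0)"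
      by (rule DD_cong[OF var_on_open[OF T(2)] T(1)]) (use T(3) in simp)
    then show "DD (cmap c \<circ> \<Lambda>) (t, 0) (0, 1) = X (\<gamma> t) c" using var_on_DD[OF T(2,1) c] by simp
  qed
qed

definition dom_t :: "('m, 'n) chart \<Rightarrow> real set" where
  "dom_t c = {a'<..<b'} \<inter> \<gamma> -` (\<Omega> \<inter> cdom c)"

lemma open_dom_t: "c \<in> M \<Longrightarrow> open (dom_t c)"
  unfolding dom_t_def
  by (intro continuous_open_preimage[OF smooth_map_continuous[OF \<gamma>]] open_Int open_\<Omega> open_cdom) auto

text \<open>The variation field is checked in the chart \<open>c\<close> alone; tangency of
  \<open>X\<close> carries the equation to the other charts.\<close>

lemma var_on_chart:
  assumes c: "c \<in> M" and S: "open S" and B: "smooth_on S B" "\<And>x. x \<in> S \<Longrightarrow> B x \<in> cim c"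
    and axis: "\<And>t. (t, 0) \<in> S \<Longrightarrow> t \<in> dom_t c" "\<And>t. (t, 0) \<in> S \<Longrightarrow> B (t, 0) = cmap c (\<gamma> t)"
      "\<And>t. (t, 0) \<in> S \<Longrightarrow> ((\<lambda>\<sigma>. B (t, \<sigma>)) has_vector_derivative X (\<gamma> t) c) (at 0)"
  shows "var_on S (\<lambda>x. cinv c (B x))"
  unfolding var_on_def
proof (intro conjI allI impI S smooth_map_cinv(1)[OF c S B])
  fix t assume t: "(t, 0) \<in> S"
  have g: "t \<in> {a'<..<b'}" "\<gamma> t \<in> \<Omega>" "\<gamma> t \<in> cdom c" using axis(1)[OF t] by (auto simp: dom_t_def)
  show "t \<in> {a'<..<b'}" by (rule g(1))
  show eq: "cinv c (B (t, 0)) = \<gamma> t" using axis(2)[OF t] cinv_cmap[OF c g(3)] by simp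
  show "\<forall>d\<in>M. \<gamma> t \<in> cdom d \<longrightarrow> DD (cmap d \<circ> (\<lambda>x. cinv c (B x))) (t, 0) (0, 1) = X (\<gamma> t) d"
  proof (intro ballI impI)
    fix d assume d: "d \<in> M" "\<gamma> t \<in> cdom d"
    have "DD B (t, 0) (0, 1) = X (\<gamma> t) c"
      by (rule DD_eq_partial_s[OF smooth_on_differentiable[OF B(1) t] axis(3)[OF t]])
    then show "DD (cmap d \<circ> (\<lambda>x. cinv c (B x))) (t, 0) (0, 1) = X (\<gamma> t) d"
      using smooth_map_cinv(2)[OF c S B d(1) t, of "(0, 1)"] eq d
        tangent_dtr[OF smooth_field_tangent[OF X g(2)] c d(1) g(3) d(2)] by simp
  qed
qed

definition straight :: "('m, 'n) chart \<Rightarrow> real \<times> real \<Rightarrow> real ^ 'n" where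
  "straight c x = cmap c (\<gamma> (fst x)) + snd x *\<^sub>R rep c X (cmap c (\<gamma> (fst x)))"

lemma smooth_straight:
  assumes c: "c \<in> M" shows "smooth_on (dom_t c \<times> UNIV) (straight c)"
proof -
  have O: "open (dom_t c \<times> (UNIV :: real set))" using open_dom_t[OF c] by (intro open_Times) auto
  have "smooth_on (dom_t c) (cmap c \<circ> \<gamma>)"
    by (rule smooth_on_subset[OF smooth_map_chart[OF \<gamma> c]]) (auto simp: dom_t_def)
  then have 1: "smooth_on (dom_t c \<times> (UNIV :: real set)) (\<lambda>x. cmap c (\<gamma> (fst x)))"
    using smooth_on_comp[OF O open_dom_t[OF c] _ _ smooth_on_fst, of "cmap c \<circ> \<gamma>"] by auto
  have 2: "smooth_on (dom_t c \<times> (UNIV :: real set)) (\<lambda>x. rep c X (cmap c (\<gamma> (fst x))))"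
    by (rule smooth_on_comp[OF O open_cmap_image[OF c open_\<Omega>] _ smooth_on_rep[OF X c] 1]) (auto simp: dom_t_def)
  show ?thesis
    unfolding straight_def by (intro smooth_on_add smooth_on_scaleR O 1 2 smooth_on_snd)
qed

lemma straight_axis: "straight c (t, 0) = cmap c (\<gamma> t)"
  by (simp add: straight_def)

lemma straight_derivative:
  assumes "c \<in> M" "t \<in> dom_t c"
  shows "((\<lambda>\<sigma>. straight c (t, \<sigma>)) has_vector_derivative X (\<gamma> t) c) (at 0)"
  using line_has_vector_derivative[of "cmap c (\<gamma> t)" "rep c X (cmap c (\<gamma> t))" 0] assms
  by (simp add: straight_def rep_cmap dom_t_def)

text \<open>A straight line may leave the image of the chart. The parameters for which it does not
  form an open set, which contains the axis over \<open>T\<close>.\<close>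

lemma var_on_straight:
  assumes c: "c \<in> M" and T: "open T" "T \<subseteq> dom_t c"
  shows "var_on ((T \<times> UNIV) \<inter> straight c -` cim c) (\<lambda>x. cinv c (straight c x))"
proof -
  have sm: "smooth_on (T \<times> UNIV) (straight c)"
    by (rule smooth_on_subset[OF smooth_straight[OF c]]) (use T in auto)
  show ?thesis
  proof (rule var_on_chart[OF c])
    show "open ((T \<times> UNIV) \<inter> straight c -` cim c)"
      by (rule continuous_open_preimage[OF smooth_on_continuous[OF sm] open_Times[OF T(1) open_UNIV] open_cim[OF c]])
    show "smooth_on ((T \<times> UNIV) \<inter> straight c -` cim c) (straight c)"
      by (rule smooth_on_subset[OF sm]) auto
  qed (use T straight_axis straight_derivative[OF c] in auto)
qed

text \<open>
  To pass from a variation along \<open>[a, x]\<close> to one along \<open>[a, y]\<close>, interpolate within a chart between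
  the old variation and the straight one: convex combinations of variations with the same base curve
  and variation field are again such variations.
\<close>

lemma var_on_extend:
  assumes c: "c \<in> M" and T: "{t0<..<t3} \<subseteq> dom_t c" and xy: "t0 < x" "x < t3" "y < t3"
    and S: "var_on S \<Lambda>" "{a..x} \<times> {0} \<subseteq> S"
  shows "\<exists>S \<Lambda>. var_on S \<Lambda> \<and> {a..y} \<times> {0} \<subseteq> S"
proof -
  \<comment> \<open>t0 < t1 < t2 < x: the transition takes place between \<open>t1\<close> and
    \<open>t2\<close>, inside the chart interval and before the end of the old variation.\<close>
  obtain t2 where t2: "t0 < t2" "t2 < x" using dense xy(1) by blast
  obtain t1 where t1: "t0 < t1" "t1 < t2" using dense t2(1) by blast
  obtain \<sigma> :: "real \<Rightarrow> real" where \<sigma>: "smooth_on UNIV \<sigma>" "\<And>t. t \<le> t1 \<Longrightarrow> \<sigma> t = 0" "\<And>t. t \<ge> t2 \<Longrightarrow> \<sigma> t = 1"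
    using ex_smooth_step[OF t1(2)] by blast
  define B where "B p = (1 - \<sigma> (fst p)) *\<^sub>R cmap c (\<Lambda> p) + \<sigma> (fst p) *\<^sub>R straight c p" for p
  \<comment> \<open>Inside the chart the formula with \<open>B\<close> already gives \<Lambda> below
    \<open>t1\<close>, and it gives the straight variation beyond \<open>t2\<close>. The case
    distinction keeps \<Lambda> also where it lies outside the chart.\<close>
  define \<Lambda>' where "\<Lambda>' p = (if fst p < t1 then \<Lambda> p else cinv c (B p))" for p
  define S1 where "S1 = S \<inter> {..<t1} \<times> UNIV"
  define R where "R = (S \<inter> \<Lambda> -` cdom c) \<inter> {t0<..<x} \<times> UNIV"
  define S2 where "S2 = R \<inter> B -` cim c"
  define S3 where "S3 = ({t2<..<t3} \<times> UNIV) \<inter> straight c -` cim c"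
  note oS = var_on_open[OF S(1)]
  have v1: "var_on S1 \<Lambda>"
    by (rule var_on_subset[OF S(1)]) (auto simp: S1_def intro!: open_Int oS open_Times)
  have v3: "var_on S3 (\<lambda>x. cinv c (straight c x))"
    unfolding S3_def by (rule var_on_straight[OF c]) (use T t1 in auto)
  have oR: "open R"
    unfolding R_def by (intro open_Int[OF open_chart_preimage[OF var_on_smooth[OF S(1)] oS c]] open_Times) auto
  have sR: "smooth_on R (cmap c \<circ> \<Lambda>)"
    by (rule smooth_on_subset[OF smooth_map_chart[OF var_on_smooth[OF S(1)] c]]) (auto simp: R_def)
  have s\<sigma>: "smooth_on R (\<lambda>p. \<sigma> (fst p))"
    by (rule smooth_on_comp[OF oR open_UNIV _ \<sigma>(1) smooth_on_fst]) simp
  have sB: "smooth_on R B"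
    unfolding B_def
  proof (intro smooth_on_add smooth_on_scaleR smooth_on_diff smooth_on_const oR s\<sigma>)
    show "smooth_on R (\<lambda>p. cmap c (\<Lambda> p))" using sR by (simp add: o_def)
    show "smooth_on R (straight c)"
      by (rule smooth_on_subset[OF smooth_straight[OF c]]) (use T xy in \<open>auto simp: R_def\<close>)
  qed
  have tR: "t \<in> dom_t c" "\<Lambda> (t, 0) = \<gamma> t" if "(t, 0) \<in> R" for t
    using that T xy var_on_axis[OF S(1)] by (auto simp: R_def)
  have B0: "B (t, 0) = cmap c (\<gamma> t)" if "\<Lambda> (t, 0) = \<gamma> t" for t
    by (simp add: B_def that straight_axis scaleR_left_diff_distrib)
  have v2: "var_on S2 (\<lambda>x. cinv c (B x))"
  proof (rule var_on_chart[OF c])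
    show "open S2"
      unfolding S2_def by (rule continuous_open_preimage[OF smooth_on_continuous[OF sB] oR open_cim[OF c]])
    show "smooth_on S2 B" by (rule smooth_on_subset[OF sB]) (auto simp: S2_def)
    fix t assume t: "(t, 0) \<in> S2"
    then have t': "(t, 0) \<in> R" "(t, 0) \<in> S" by (auto simp: S2_def R_def)
    have "\<gamma> t \<in> cdom c" using tR(1)[OF t'(1)] by (simp add: dom_t_def)
    then have "DD (cmap c \<circ> \<Lambda>) (t, 0) (0, 1) = X (\<gamma> t) c" using var_on_DD[OF S(1) t'(2) c] by blast
    moreover have "((\<lambda>\<sigma>. (t, \<sigma>)) has_vector_derivative (0, 1)) (at (0::real))"
      by (rule pair_has_vector_derivative)
    ultimately have 1: "((\<lambda>\<sigma>. cmap c (\<Lambda> (t, \<sigma>))) has_vector_derivative X (\<gamma> t) c) (at 0)"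
      using DD_comp_curve[of "cmap c \<circ> \<Lambda>" "\<lambda>\<sigma>. (t, \<sigma>)" 0 "(0, 1)"] smooth_on_differentiable[OF sR t'(1)]
      by simp
    \<comment> \<open>For fixed t the weights are constants with sum 1, and both variations have the
      same s-velocity on the axis, so the average has it too.\<close>
    have "((\<lambda>s. B (t, s)) has_vector_derivative (1 - \<sigma> t) *\<^sub>R X (\<gamma> t) c + \<sigma> t *\<^sub>R X (\<gamma> t) c) (at 0)"
      unfolding B_def fst_conv
      by (intro has_vector_derivative_add bounded_linear.has_vector_derivative[OF bounded_linear_scaleR_right]
          1 straight_derivative[OF c tR(1)[OF t'(1)]])
    then show "((\<lambda>\<sigma>. B (t, \<sigma>)) has_vector_derivative X (\<gamma> t) c) (at 0)"
      by (simp add: scaleR_left_diff_distrib)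
  qed (use tR B0 in \<open>auto simp: S2_def\<close>)
  have e1: "\<forall>p\<in>S1. \<Lambda>' p = \<Lambda> p" by (auto simp: S1_def \<Lambda>'_def)
  have e2: "\<forall>p\<in>S2. \<Lambda>' p = cinv c (B p)"
    by (auto simp: S2_def R_def \<Lambda>'_def B_def \<sigma>(2) cinv_cmap[OF c])
  have e3: "\<forall>p\<in>S3. \<Lambda>' p = cinv c (straight c p)"
    using t1 by (auto simp: S3_def \<Lambda>'_def B_def \<sigma>(3))
  have "var_on (S1 \<union> S2 \<union> S3) \<Lambda>'"
  proof (rule var_on_local)
    show "open (S1 \<union> S2 \<union> S3)" by (intro open_Un var_on_open[OF v1] var_on_open[OF v2] var_on_open[OF v3])
    fix p assume "p \<in> S1 \<union> S2 \<union> S3"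
    then consider "p \<in> S1" | "p \<in> S2" | "p \<in> S3" by blast
    then show "\<exists>T \<Lambda>''. p \<in> T \<and> var_on T \<Lambda>'' \<and> (\<forall>y\<in>T. \<Lambda>' y = \<Lambda>'' y)"
      by cases (use v1 v2 v3 e1 e2 e3 in blast)+
  qed
  moreover have "{a..y} \<times> {0} \<subseteq> S1 \<union> S2 \<union> S3"
  proof
    fix p assume "p \<in> {a..y} \<times> {0 :: real}"
    then obtain t where p: "p = (t, 0)" and t: "a \<le> t" "t \<le> y" by auto
    have d: "\<gamma> t \<in> cdom c" if "t0 < t" using subsetD[OF T, of t] that t xy by (simp add: dom_t_def)
    consider "t < t1" | "t1 \<le> t" "t < x" | "x \<le> t" by linarith
    then show "p \<in> S1 \<union> S2 \<union> S3"
    proof cases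
      case 1
      then have "(t, 0) \<in> S" using S(2) t t1 t2 by auto
      then show ?thesis using 1 by (simp add: S1_def p)
    next
      case 2
      then have tS: "(t, 0) \<in> S" using S(2) t by auto
      note ax = var_on_axis[OF S(1) this]
      then show ?thesis using 2 t1 d tS B0[OF ax] by (simp add: S2_def R_def p)
    next
      case 3
      then show ?thesis using t t1 t2 xy d by (simp add: S3_def p straight_axis)
    qed
  qed
  ultimately show ?thesis by blast
qed

text \<open>Around each t there is a chart interval in which \<open>var_on_extend\<close> passes
  from existence along [a, x] to existence along [a, y], for any x and y. Connectedness of [a, b]
  then does the work of a finite cover.\<close>

lemma ex_var_on: "\<exists>S \<Lambda>. var_on S \<Lambda> \<and> {a..b} \<times> {0} \<subseteq> S"
proof (rule connected_induction_simple[where S = "{a..b}" and a = a and b = b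
      and P = "\<lambda>T. \<exists>S \<Lambda>. var_on S \<Lambda> \<and> {a..T} \<times> {0} \<subseteq> S"])
  have ex: "\<exists>c\<in>M. \<exists>\<eta>>0. {t - \<eta><..<t + \<eta>} \<subseteq> dom_t c" if t: "t \<in> {a..b}" for t
  proof -
    obtain c where c: "c \<in> M" "\<gamma> t \<in> cdom c" using ex_chart by blast
    have "t \<in> dom_t c" using c t ab \<gamma>\<Omega> by (auto simp: dom_t_def)
    then obtain \<eta> where "\<eta> > 0" "ball t \<eta> \<subseteq> dom_t c" using open_dom_t[OF c(1)] open_contains_ball by blast
    then show ?thesis using c(1) by (intro bexI[of _ c] exI[of _ \<eta>]) (auto simp: ball_eq_greaterThanLessThan)
  qed
  show "connected {a..b}" "a \<in> {a..b}" "b \<in> {a..b}" using ab by auto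
  show "\<exists>S \<Lambda>. var_on S \<Lambda> \<and> {a..a} \<times> {0} \<subseteq> S"
  proof -
    obtain c \<eta> where c: "c \<in> M" "\<eta> > 0" "{a - \<eta><..<a + \<eta>} \<subseteq> dom_t c" using ex[of a] ab by auto
    have "\<gamma> a \<in> cdom c" using subsetD[OF c(3), of a] c(2) by (simp add: dom_t_def)
    then show ?thesis
      using var_on_straight[OF c(1) _ c(3)] c(2)
      by (intro exI[of _ "({a - \<eta><..<a + \<eta>} \<times> UNIV) \<inter> straight c -` cim c"] exI[of _ "\<lambda>x. cinv c (straight c x)"])
        (auto simp: straight_axis)
  qed
  fix t assume t: "t \<in> {a..b}"
  obtain c \<eta> where c: "c \<in> M" "\<eta> > 0" "{t - \<eta><..<t + \<eta>} \<subseteq> dom_t c" using ex[OF t] by auto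
  let ?T = "{a..b} \<inter> {t - \<eta><..<t + \<eta>}"
  have "openin (top_of_set {a..b}) ?T" by (rule openin_open_Int) simp
  moreover have "t \<in> ?T" using t c(2) by auto
  moreover have "(\<exists>S \<Lambda>. var_on S \<Lambda> \<and> {a..x} \<times> {0} \<subseteq> S) \<longrightarrow> (\<exists>S \<Lambda>. var_on S \<Lambda> \<and> {a..y} \<times> {0} \<subseteq> S)"
    if "x \<in> ?T" "y \<in> ?T" for x y
    using var_on_extend[OF c(1,3), of x y] that by auto
  ultimately show "\<exists>T. openin (top_of_set {a..b}) T \<and> t \<in> T \<and> (\<forall>x\<in>T. \<forall>y\<in>T.
      (\<exists>S \<Lambda>. var_on S \<Lambda> \<and> {a..x} \<times> {0} \<subseteq> S) \<longrightarrow> (\<exists>S \<Lambda>. var_on S \<Lambda> \<and> {a..y} \<times> {0} \<subseteq> S))"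
    by (intro exI[of _ ?T]) blast
qed

end

lemma velocity_cong:
  assumes "t \<in> S" "\<And>\<tau>. \<tau> \<in> S \<Longrightarrow> f \<tau> = g \<tau>"
  shows "velocity M S f t = velocity M S g t"
proof -
  have "vector_derivative (\<lambda>\<tau>. cmap c (f \<tau>)) (at t within S) = vector_derivative (\<lambda>\<tau>. cmap c (g \<tau>)) (at t within S)"
    for c :: "('a, 'b::finite) chart"
    by (rule vector_derivative_within_cong) (use assms in auto)
  then show ?thesis using assms by (simp add: velocity_def)
qed

text \<open>A two parameter map needs one \<epsilon> for all t; compactness of the axis segment
  provides it, with room beyond both end points.\<close>

lemma compact_segment_tube:
  fixes a b :: real and S :: "(real \<times> real) set"
  assumes "a < b" "open S" "{a..b} \<times> {0} \<subseteq> S"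
  obtains e where "e > 0" "{a - e<..<b + e} \<times> {-e<..<e} \<subseteq> S"
proof -
  have "compact ({a..b} \<times> {0 :: real})" "{a..b} \<times> {0 :: real} \<noteq> {}"
    using assms(1) by (auto intro: compact_Times)
  then obtain r where r: "r > 0" "{x. infdist x ({a..b} \<times> {0}) \<le> r} \<subseteq> S"
    using compact_in_open_separated[OF _ _ assms(2,3)] by blast
  have "{a - r / 2<..<b + r / 2} \<times> {- (r / 2)<..<r / 2} \<subseteq> S"
  proof
    fix x assume x: "x \<in> {a - r / 2<..<b + r / 2} \<times> {- (r / 2)<..<r / 2}"
    \<comment> \<open>The point of [a, b] nearest to \<open>fst x\<close>; each coordinate then
      contributes at most r / 2 to the distance from the segment.\<close>
    define t where "t = max a (min b (fst x))"
    have t: "(t, 0) \<in> {a..b} \<times> {0 :: real}" "\<bar>fst x - t\<bar> \<le> r / 2"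
      using assms(1) x r(1) by (auto simp: t_def max_def min_def abs_if)
    have "infdist x ({a..b} \<times> {0}) \<le> dist x (t, 0)" by (rule infdist_le[OF t(1)])
    also have "\<dots> \<le> dist (fst x) t + dist (snd x) 0"
      using norm_Pair_le[of "fst x - t" "snd x"] by (cases x) (simp add: dist_norm)
    also have "\<dots> \<le> r"
    proof -
      have "\<bar>snd x\<bar> < r / 2" using x by (auto simp: abs_less_iff)
      then show ?thesis using t(2) unfolding dist_real_def by simp
    qed
    finally show "x \<in> S" using r(2) by blast
  qed
  then show thesis using that[of "r / 2"] r(1) by simp
qed

locale variation_finsler = finsler_field M A L \<Omega> V + variation_data M \<Omega> X a' b' a b \<gamma>
  for M :: "('m::{t2_space,second_countable_topology}, 'n::finite) chart set" and A L \<Omega> V X a' b' a b \<gamma> +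
  assumes velocity_V: "\<And>t. t \<in> {a..b} \<Longrightarrow> velocity M {a..b} \<gamma> t = V (\<gamma> t)"
begin

text \<open>Two-sided counterpart of \<open>partial_t\<close>, meaningful for t outside [a, b] too,
  so that admissibility can be studied on an open set.\<close>

definition tvec_t :: "(real \<times> real \<Rightarrow> 'm) \<Rightarrow> real \<times> real \<Rightarrow> ('m, 'n) tvec" where
  "tvec_t \<Lambda> x = at_chart M (\<Lambda> x) (\<lambda>c. DD (cmap c \<circ> \<Lambda>) x (1, 0))"

lemma tvec_t_tangent:
  assumes S: "open S" "smooth_map M S \<Lambda>" and x: "x \<in> S" shows "tvec_t \<Lambda> x \<in> TS (\<Lambda> x)"
proof -
  obtain c where c: "c \<in> M" "\<Lambda> x \<in> cdom c" using ex_chart by blast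
  have "tvec_t \<Lambda> x = coord_vec M c (\<Lambda> x) (DD (cmap c \<circ> \<Lambda>) x (1, 0))"
    unfolding tvec_t_def
  proof (rule at_chart_tangentI[OF c])
    fix d assume d: "d \<in> M" "\<Lambda> x \<in> cdom d"
    let ?S = "S \<inter> \<Lambda> -` cdom c"
    have O: "open ?S" by (rule open_chart_preimage[OF S(2,1) c(1)])
    have xO: "x \<in> ?S" using x c by simp
    have inv: "cinv c ((cmap c \<circ> \<Lambda>) y) = \<Lambda> y" if "y \<in> ?S" for y using that by (simp add: cinv_cmap[OF c(1)])
    have "DD (cmap d \<circ> \<Lambda>) x (1, 0) = DD (cmap d \<circ> (\<lambda>y. cinv c ((cmap c \<circ> \<Lambda>) y))) x (1, 0)"
      by (rule fun_cong[OF DD_cong[OF O xO]]) (simp add: cinv_cmap[OF c(1)])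
    also have "\<dots> = dtr c d (cinv c ((cmap c \<circ> \<Lambda>) x)) (DD (cmap c \<circ> \<Lambda>) x (1, 0))"
      by (rule smooth_map_cinv(2)[OF c(1) O smooth_map_chart[OF S(2) c(1)] _ d(1) xO])
        (use d inv[OF xO] in auto)
    finally show "DD (cmap d \<circ> \<Lambda>) x (1, 0) = dtr c d (\<Lambda> x) (DD (cmap c \<circ> \<Lambda>) x (1, 0))"
      unfolding inv[OF xO] .
  qed
  then show ?thesis using coord_vec_tangent[OF c] by simp
qed

lemma open_admissible:
  assumes S: "open S" "smooth_map M S \<Lambda>"
  shows "open {x \<in> S. (\<Lambda> x, tvec_t \<Lambda> x) \<in> A}"
proof (subst open_subopen, rule ballI)
  fix x assume "x \<in> {x \<in> S. (\<Lambda> x, tvec_t \<Lambda> x) \<in> A}"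
  then have x: "x \<in> S" "(\<Lambda> x, tvec_t \<Lambda> x) \<in> A" by auto
  obtain c where c: "c \<in> M" "\<Lambda> x \<in> cdom c" using ex_chart by blast
  let ?S = "S \<inter> \<Lambda> -` cdom c"
  let ?z = "\<lambda>y. ((cmap c \<circ> \<Lambda>) y, DD (cmap c \<circ> \<Lambda>) y (1, 0))"
  have O: "open ?S" by (rule open_chart_preimage[OF S(2,1) c(1)])
  have sl: "smooth_on ?S (cmap c \<circ> \<Lambda>)" by (rule smooth_map_chart[OF S(2) c(1)])
  have "smooth_on ?S ?z" by (intro smooth_on_Pair O sl smooth_on_DD)
  then have O2: "open (?S \<inter> ?z -` lag_dom c)"
    by (rule continuous_open_preimage[OF smooth_on_continuous O open_lag_dom[OF c(1)]])
  have iff: "?z y \<in> lag_dom c \<longleftrightarrow> (\<Lambda> y, tvec_t \<Lambda> y) \<in> A" if "y \<in> ?S" for y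
    using lag_dom_iff[OF tvec_t_tangent[OF S] c(1), of y] that by (simp add: tvec_t_def at_chart_apply c(1))
  show "\<exists>T. open T \<and> x \<in> T \<and> T \<subseteq> {x \<in> S. (\<Lambda> x, tvec_t \<Lambda> x) \<in> A}"
    by (rule exI[of _ "?S \<inter> ?z -` lag_dom c"]) (use O2 x c iff in blast)
qed

lemma partial_t_tvec:
  assumes S: "open S" "smooth_map M S \<Lambda>" and x: "(t, s) \<in> S" "t \<in> {a..b}"
  shows "partial_t M a b \<Lambda> (t, s) = tvec_t \<Lambda> (t, s)"
proof
  fix c
  show "partial_t M a b \<Lambda> (t, s) c = tvec_t \<Lambda> (t, s) c"
  proof (cases "c \<in> M \<and> \<Lambda> (t, s) \<in> cdom c")
    case True
    then have "(t, s) \<in> S \<inter> \<Lambda> -` cdom c" using x by simp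
    then have d: "(cmap c \<circ> \<Lambda>) differentiable (at (t, s))"
      using smooth_on_differentiable[OF smooth_map_chart[OF S(2)]] True by blast
    have "((\<lambda>\<tau>. (\<tau>, s)) has_vector_derivative (1, 0)) (at t)"
      by (rule pair_has_vector_derivative)
    then have "((\<lambda>\<tau>. (cmap c \<circ> \<Lambda>) (\<tau>, s)) has_vector_derivative DD (cmap c \<circ> \<Lambda>) (t, s) (1, 0)) (at t)"
      by (rule DD_comp_curve[of "cmap c \<circ> \<Lambda>" "\<lambda>\<tau>. (\<tau>, s)", OF d])
    then have "vector_derivative (\<lambda>\<tau>. cmap c (\<Lambda> (\<tau>, s))) (at t within {a..b}) = DD (cmap c \<circ> \<Lambda>) (t, s) (1, 0)"
      using vector_derivative_at_within_ivl x(2) ab(2) by fastforce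
    then show ?thesis by (simp add: partial_t_def velocity_def tvec_t_def at_chart_apply)
  qed (auto simp: partial_t_def velocity_def tvec_t_def at_chart_apply)
qed

lemma ex_variation:
  assumes Y: "smooth_field M \<Omega> Y"
  shows "\<exists>\<epsilon> \<Lambda>. \<epsilon> > 0 \<and> admissible_two_param M A a b \<epsilon> \<Lambda> \<and>
     (\<forall>t\<in>{a..b}. \<Lambda> (t, 0) = \<gamma> t \<and> partial_s M \<epsilon> \<Lambda> (t, 0) = X (\<gamma> t)) \<and>
     smooth_field_on_two_param M a b \<epsilon> \<Lambda> (\<lambda>x. Y (\<Lambda> x))"
proof -
  obtain S \<Lambda> where S: "var_on S \<Lambda>" "{a..b} \<times> {0} \<subseteq> S" using ex_var_on by blast
  note oS = var_on_open[OF S(1)] and sS = var_on_smooth[OF S(1)]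
  \<comment> \<open>On the axis \<Lambda>_t is \<open>V\<close>, so the axis lies in this open set,
    and a rectangle around it is found by compactness. Staying in \<Omega> allows the field along
    \<Lambda> to be the composition with \<open>Y\<close>.\<close>
  define S' where "S' = (S \<inter> \<Lambda> -` \<Omega>) \<inter> {x \<in> S. (\<Lambda> x, tvec_t \<Lambda> x) \<in> A}"
  have oS': "open S'"
    unfolding S'_def
    by (intro open_Int open_admissible[OF oS sS] continuous_open_preimage[OF smooth_map_continuous[OF sS] oS open_\<Omega>])
  have axis: "\<Lambda> (t, 0) = \<gamma> t" "tvec_t \<Lambda> (t, 0) = V (\<gamma> t)" "(t, 0) \<in> S" if t: "t \<in> {a..b}" for t
  proof -
    show tS: "(t, 0) \<in> S" using S(2) t by blast
    show "\<Lambda> (t, 0) = \<gamma> t" by (rule var_on_axis[OF S(1) tS])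
    have "tvec_t \<Lambda> (t, 0) = velocity M {a..b} (\<lambda>\<tau>. \<Lambda> (\<tau>, 0)) t"
      using partial_t_tvec[OF oS sS tS t] by (simp add: partial_t_def)
    also have "\<dots> = velocity M {a..b} \<gamma> t"
      by (rule velocity_cong[OF t]) (use S(2) var_on_axis[OF S(1)] in blast)
    finally show "tvec_t \<Lambda> (t, 0) = V (\<gamma> t)" using velocity_V[OF t] by simp
  qed
  have "{a..b} \<times> {0} \<subseteq> S'"
    using axis \<gamma>\<Omega> VA by (auto simp: S'_def)
  then obtain \<epsilon> where \<epsilon>: "\<epsilon> > 0" "{a - \<epsilon><..<b + \<epsilon>} \<times> {-\<epsilon><..<\<epsilon>} \<subseteq> S'"
    using compact_segment_tube[OF ab(2) oS'] by metis
  let ?J = "{a - \<epsilon><..<b + \<epsilon>} \<times> {-\<epsilon><..<\<epsilon>}"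
  have JS: "?J \<subseteq> S" using \<epsilon>(2) by (auto simp: S'_def)
  have IJ: "{a..b} \<times> {-\<epsilon><..<\<epsilon>} \<subseteq> ?J" using \<epsilon>(1) by auto
  have sJ: "smooth_map M ?J \<Lambda>" by (rule smooth_map_subset[OF sS JS])
  have oJ: "open ?J" by (intro open_Times) auto
  have "two_param_map M a b \<epsilon> \<Lambda>"
    unfolding two_param_map_def using sJ \<epsilon>(1) by (intro exI[of _ "a - \<epsilon>"] exI[of _ "b + \<epsilon>"] exI[of _ \<Lambda>]) simp
  moreover have "(\<Lambda> x, partial_t M a b \<Lambda> x) \<in> A" if x: "x \<in> {a..b} \<times> {-\<epsilon><..<\<epsilon>}" for x
  proof -
    have "x \<in> S'" "x \<in> S" using x IJ JS \<epsilon>(2) by blast+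
    then show ?thesis
      using partial_t_tvec[OF oS sS, of "fst x" "snd x"] x by (auto simp: S'_def)
  qed
  ultimately have "admissible_two_param M A a b \<epsilon> \<Lambda>" by (simp add: admissible_two_param_def)
  moreover have "partial_s M \<epsilon> \<Lambda> (t, 0) = X (\<gamma> t)" if t: "t \<in> {a..b}" for t
  proof
    fix c
    have g: "\<gamma> t \<in> \<Omega>" using \<gamma>\<Omega> t by blast
    show "partial_s M \<epsilon> \<Lambda> (t, 0) c = X (\<gamma> t) c"
    proof (cases "c \<in> M \<and> \<gamma> t \<in> cdom c")
      case False
      then show ?thesis
        using tangent_out[OF smooth_field_tangent[OF X g] False]
        by (auto simp: partial_s_def velocity_def at_chart_apply axis(1)[OF t])
    next
      case True
      then have "(t, 0) \<in> S \<inter> \<Lambda> -` cdom c" using axis[OF t] by simp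
      then have d: "(cmap c \<circ> \<Lambda>) differentiable (at (t, 0))"
        using smooth_on_differentiable[OF smooth_map_chart[OF sS]] True by blast
      have "((\<lambda>\<sigma>. (t, \<sigma>)) has_vector_derivative (0, 1)) (at (0::real))"
      by (rule pair_has_vector_derivative)
      then have "((\<lambda>\<sigma>. (cmap c \<circ> \<Lambda>) (t, \<sigma>)) has_vector_derivative DD (cmap c \<circ> \<Lambda>) (t, 0) (0, 1)) (at 0)"
        by (rule DD_comp_curve[of "cmap c \<circ> \<Lambda>" "\<lambda>\<sigma>. (t, \<sigma>)", OF d])
      then have "vector_derivative (\<lambda>\<sigma>. cmap c (\<Lambda> (t, \<sigma>))) (at 0 within {-\<epsilon><..<\<epsilon>}) = X (\<gamma> t) c"
        using var_on_DD[OF S(1) axis(3)[OF t]] True \<epsilon>(1)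
        by (simp add: vector_derivative_at at_within_open[of 0 "{-\<epsilon><..<\<epsilon>}"])
      then show ?thesis using True by (simp add: partial_s_def velocity_def at_chart_apply axis(1)[OF t])
    qed
  qed
  moreover have "smooth_field_on_two_param M a b \<epsilon> \<Lambda> (\<lambda>x. Y (\<Lambda> x))"
  proof -
    have J\<Omega>: "\<Lambda> x \<in> \<Omega>" if "x \<in> ?J" for x using that \<epsilon>(2) by (auto simp: S'_def)
    have "smooth_field_along M ?J \<Lambda> (\<lambda>x. Y (\<Lambda> x))"
      unfolding smooth_field_along_def
    proof (intro conjI ballI)
      show "Y (\<Lambda> x) \<in> TS (\<Lambda> x)" if "x \<in> ?J" for x using smooth_field_tangent[OF Y J\<Omega>[OF that]] .
      fix c assume c: "c \<in> M"
      have O: "open (?J \<inter> \<Lambda> -` cdom c)" by (rule open_chart_preimage[OF sJ oJ c])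
      have "smooth_on (?J \<inter> \<Lambda> -` cdom c) (\<lambda>x. rep c Y ((cmap c \<circ> \<Lambda>) x))"
        by (rule smooth_on_comp[OF O open_cmap_image[OF c open_\<Omega>] _ smooth_on_rep[OF Y c] smooth_map_chart[OF sJ c]])
          (use J\<Omega> in auto)
      then show "smooth_on (?J \<inter> \<Lambda> -` cdom c) (\<lambda>x. Y (\<Lambda> x) c)"
        by (rule smooth_on_cong[OF _ O]) (simp add: rep_cmap[OF c])
    qed
    then show ?thesis
      unfolding smooth_field_on_two_param_def using sJ \<epsilon>(1)
      by (intro exI[of _ "a - \<epsilon>"] exI[of _ "b + \<epsilon>"] exI[of _ \<Lambda>] exI[of _ "\<lambda>x. Y (\<Lambda> x)"]) simp
  qed
  ultimately show ?thesis using \<epsilon>(1) axis(1) by blast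
qed

end

theorem theorem2p2:
  fixes M :: "('m::{t2_space,second_countable_topology}, 'n::finite) chart set"
    and A :: "('m \<times> ('m, 'n) tvec) set"
    and L :: "'m \<times> ('m, 'n) tvec \<Rightarrow> real"
    and a b :: real
    and \<gamma> :: "real \<Rightarrow> 'm"
    and \<Omega> :: "'m set"
    and V U' W' :: "'m \<Rightarrow> ('m, 'n) tvec"
    and U W :: "real \<Rightarrow> ('m, 'n) tvec"
  assumes "pseudo_finsler M A L"
    and "a < b"
    and "embedded_curve M a b \<gamma>"
    and "admissible_curve M A a b \<gamma>"
    and "open \<Omega>"
    and "admissible_field M A \<Omega> V"
    and "\<gamma> ` {a..b} \<subseteq> \<Omega>"
    and "\<forall>t\<in>{a..b}. V (\<gamma> t) = velocity M {a..b} \<gamma> t"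
    and "smooth_field_on_curve M a b \<gamma> U"
    and "smooth_field_on_curve M a b \<gamma> W"
    and "smooth_field M \<Omega> U'"
    and "\<forall>t\<in>{a..b}. U' (\<gamma> t) = U t"
    and "smooth_field M \<Omega> W'"
    and "\<forall>t\<in>{a..b}. W' (\<gamma> t) = W t"
  shows "\<forall>t\<in>{a..b}. curv_curve M A L a b \<gamma> U W t =
           curvature M (chern_connection M L \<Omega> V) V U' W' (\<gamma> t) +
           chern_tensor M A L (\<gamma> t) (V (\<gamma> t)) (V (\<gamma> t)) (W' (\<gamma> t)) (lie_bracket M U' V (\<gamma> t))"
proof -
  interpret ff: finsler_field M A L \<Omega> V
    using assms(1,5,6) by (simp add: finsler_field_def finsler_def finsler_field_axioms_def)
  \<comment> \<open>The variation is built on an extension of \<gamma> past the end points. Within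
    [a, b] both curves have the same velocity.\<close>
  obtain a' b' \<gamma>' where \<gamma>': "a' < a" "b < b'" "smooth_map M {a'<..<b'} \<gamma>'" "\<And>t. t \<in> {a..b} \<Longrightarrow> \<gamma>' t = \<gamma> t"
    using assms(3) unfolding embedded_curve_def smooth_curve_def by blast
  have vel: "velocity M {a..b} \<gamma>' t = V (\<gamma>' t)" if "t \<in> {a..b}" for t
    using velocity_cong[OF that, of \<gamma>' \<gamma> M] \<gamma>'(4) assms(8) that by simp
  interpret vf: variation_finsler M A L \<Omega> V U' a' b' a b \<gamma>'
    by unfold_locales (use assms(2,5,7,11) \<gamma>' vel in auto)
  define P where "P r \<longleftrightarrow> (\<exists>\<epsilon> \<Lambda> W'. \<epsilon> > 0 \<and> admissible_two_param M A a b \<epsilon> \<Lambda> \<and>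
     (\<forall>t\<in>{a..b}. \<Lambda> (t, 0) = \<gamma> t \<and> partial_s M \<epsilon> \<Lambda> (t, 0) = U t) \<and>
     smooth_field_on_two_param M a b \<epsilon> \<Lambda> W' \<and> (\<forall>t\<in>{a..b}. W' (t, 0) = W t) \<and>
     r = (\<lambda>t. curv_two_param M A L a b \<epsilon> \<Lambda> W' (t, 0)))" for r
  \<comment> \<open>This variation only shows that the choice in \<open>curv_curve\<close> is not
    void. The computation is made for the variation and the extension \<open>F\<close> that the
    choice delivers, of which nothing but \<open>P\<close> is known.\<close>
  obtain \<epsilon> \<Lambda> where "\<epsilon> > 0" "admissible_two_param M A a b \<epsilon> \<Lambda>"
     "\<forall>t\<in>{a..b}. \<Lambda> (t, 0) = \<gamma>' t \<and> partial_s M \<epsilon> \<Lambda> (t, 0) = U' (\<gamma>' t)"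
     "smooth_field_on_two_param M a b \<epsilon> \<Lambda> (\<lambda>x. W' (\<Lambda> x))"
    using vf.ex_variation[OF assms(13)] by blast
  then have "P (\<lambda>t. curv_two_param M A L a b \<epsilon> \<Lambda> (\<lambda>x. W' (\<Lambda> x)) (t, 0))"
    unfolding P_def using \<gamma>'(4) assms(12,14)
    by (intro exI[of _ \<epsilon>] exI[of _ \<Lambda>] exI[of _ "\<lambda>x. W' (\<Lambda> x)"]) simp
  then have "P (curv_curve M A L a b \<gamma> U W)"
    unfolding curv_curve_def P_def[symmetric] by (rule someI[of P])
  then obtain \<epsilon> \<Lambda> F where \<Lambda>: "\<epsilon> > 0" "admissible_two_param M A a b \<epsilon> \<Lambda>"
     "\<And>t. t \<in> {a..b} \<Longrightarrow> \<Lambda> (t, 0) = \<gamma> t" "\<And>t. t \<in> {a..b} \<Longrightarrow> partial_s M \<epsilon> \<Lambda> (t, 0) = U t"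
     "smooth_field_on_two_param M a b \<epsilon> \<Lambda> F" "\<And>t. t \<in> {a..b} \<Longrightarrow> F (t, 0) = W t"
     "curv_curve M A L a b \<gamma> U W = (\<lambda>t. curv_two_param M A L a b \<epsilon> \<Lambda> F (t, 0))"
    unfolding P_def by blast
  have vel\<Lambda>: "partial_t M a b \<Lambda> (t, 0) = V (\<Lambda> (t, 0))" if "t \<in> {a..b}" for t
    using velocity_cong[OF that, of "\<lambda>\<tau>. \<Lambda> (\<tau>, 0)" \<gamma> M] \<Lambda>(3) assms(8) that by (simp add: partial_t_def)
  show ?thesis
  proof
    fix t assume t: "t \<in> {a..b}"
    have "curv_two_param M A L a b \<epsilon> \<Lambda> F (t, 0) = curvature M (chern_connection M L \<Omega> V) V U' W' (\<Lambda> (t, 0)) +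
        chern_tensor M A L (\<Lambda> (t, 0)) (V (\<Lambda> (t, 0))) (V (\<Lambda> (t, 0))) (W' (\<Lambda> (t, 0))) (lie_bracket M U' V (\<Lambda> (t, 0)))"
      by (rule ff.curv_two_param_eq[OF assms(2) \<Lambda>(1,2,5) _ vel\<Lambda> _ _ assms(11,13) t])
        (use \<Lambda> assms(7,12,14) in auto)
    then show "curv_curve M A L a b \<gamma> U W t =
           curvature M (chern_connection M L \<Omega> V) V U' W' (\<gamma> t) +
           chern_tensor M A L (\<gamma> t) (V (\<gamma> t)) (V (\<gamma> t)) (W' (\<gamma> t)) (lie_bracket M U' V (\<gamma> t))"
      by (simp add: \<Lambda>(7) \<Lambda>(3)[OF t])
  qed
qed

end
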